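(* Let $n$ be a positive integer, $X=(X_1,\dots,X_n)$ and $dX=dX_1\cdots dX_n$. Each of the four families of polynomials $\{\mathcal{P}^{I,+}_k\}_{k\in P^+}$, $\{\mathcal{P}^{I,-}_k\}_{k\in P^+}$, $\{\mathcal{P}^{III,+}_k\}_{k\in P^+}$, $\{\mathcal{P}^{III,-}_k\}_{k\in P^+}$ forms an orthogonal basis of the vector space of all polynomials in $\mathbb{R}[X]$ with the scalar product of two polynomials $f,g$ defined by the weighted integral $$\int_{\mathfrak{F}} f(X)g(X)w(X)\,dX,$$ where the weight function $w$ is, respectively, $$w^{I,+}=\frac{1}{\mathcal{J}},\quad w^{I,-}=\frac{\mathcal{J}^{I,-}}{\mathcal{J}},\quad w^{III,+}=\frac{\mathcal{J}^{III,+}}{\mathcal{J}},\quad w^{III,-}=\frac{\mathcal{J}^{III,-}}{\mathcal{J}}.$$ For all $k,k'\in P^+$ the orthogonality relations are $$\int_{\mathfrak{F}}\mathcal{P}^{I,+}_k(X)\mathcal{P}^{I,+}_{k'}(X)w^{I,+}(X)\,dX=h_kH_k\delta_{kk'},$$ $$\int_{\mathfrak{F}}\mathcal{P}^{I,-}_k(X)\mathcal{P}^{I,-}_{k'}(X)w^{I,-}(X)\,dX=h_{k+\rho_1}\delta_{kk'},$$ $$\int_{\mathfrak{F}}\mathcal{P}^{III,+}_k(X)\mathcal{P}^{III,+}_{k'}(X)w^{III,+}(X)\,dX=2^{-n}H_k\delta_{kk'},$$ $$\int_{\mathfrak{F}}\mathcal{P}^{III,-}_k(X)\mathcal{P}^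{III,-}_{k'}(X)w^{III,-}(X)\,dX=2^{-n}\delta_{kk'}.$$
   Context: For $\lambda,x\in\mathbb{R}^n$: $\cos^-_\lambda(x)=\sum_{\sigma\in S_n}\mathrm{sgn}(\sigma)\prod_{i=1}^n\cos(\pi\lambda_{\sigma(i)}x_i)$ and $\cos^+_\lambda(x)=\sum_{\sigma\in S_n}\prod_{i=1}^n\cos(\pi\lambda_{\sigma(i)}x_i)$. $P^+=\{(k_1,\dots,k_n)\in\mathbb{Z}^n : k_1\ge\dots\ge k_n\ge0\}$; $\rho=(\frac12,\dots,\frac12)$, $\rho_1=(n-1,n-2,\dots,0)$, $\rho_2=(n-\frac12,n-\frac32,\dots,\frac12)$. For $k\in\mathbb{R}^n$, $H_k=\#\{\sigma\in S_n:\sigma(k)=k\}$ where $\sigma(k)=(k_{\sigma(1)},\dots,k_{\sigma(n)})$. For $k\in\mathbb{Z}^n$, $h_k=h_{k_1}\cdots h_{k_n}$ with $h_{m}=1$ if $m=0$ and $h_m=\frac12$ otherwise. $F=\{x\in\mathbb{R}^n : 1\ge x_1\ge x_2\ge\dots\ge x_n\ge0\}$, with interior $F^\circ$. Let $X_j(x)=\cos^+_{(1,\dots,1,0,\dots,0)}(x)$ with $j$ ones and $n-j$ zeros, $j=1,\dots,n$; let $\varphi(x)=(X_1(x),\dots,X_n(x))$ for $x\in F$ and $\mathfrak{F}=\varphi(F)$. For $k\in P^+$, the polynomials $\mathcal{P}^{I,\pm}_k,\mathcal{P}^{III,\pm}_k\in\mathbb{R}[X_1,\dots,X_n]$ are determined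 by the following relations for all $x\in F^\circ$: $$\mathcal{P}^{I,+}_k(\varphi(x))=\cos^+_k(x),\quad \mathcal{P}^{I,-}_k(\varphi(x))=\frac{\cos^-_{k+\rho_1}(x)}{\cos^-_{\rho_1}(x)},\quad \mathcal{P}^{III,+}_k(\varphi(x))=\frac{\cos^+_{k+\rho}(x)}{\cos^+_{\rho}(x)},\quad \mathcal{P}^{III,-}_k(\varphi(x))=\frac{\cos^-_{k+\rho_2}(x)}{\cos^-_{\rho_2}(x)}.$$ Let $J(x)=\det\frac{\partial(X_1,\dots,X_n)}{\partial(x_1,\dots,x_n)}$. Then $J(x)^2=p^{I,+}(\varphi(x))$ for a polynomial $p^{I,+}\in\mathbb{R}[X_1,\dots,X_n]$, and $\mathcal{J}(X)=\sqrt{p^{I,+}(X)}$ for $X\in\mathfrak{F}$, so $\mathcal{J}(\varphi(x))=|J(x)|$ for $x\in F$. The polynomials $\mathcal{J}^{I,-},\mathcal{J}^{III,+},\mathcal{J}^{III,-}\in\mathbb{R}[X_1,\dots,X_n]$ are determined by $\mathcal{J}^{I,-}(\varphi(x))=\cos^-_{\rho_1}(x)^2$, $\mathcal{J}^{III,+}(\varphi(x))=\cos^+_{\rho}(x)^2$, $\mathcal{J}^{III,-}(\varphi(x))=\cos^-_{\rho_2}(x)^2$. *)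

theory Defs
  imports "HOL-Analysis.Analysis" "HOL-Library.Poly_Mapping"
begin

text \<open>
  The number \<open>n\<close> is \<open>CARD('n)\<close> for a finite, linearly ordered index type \<open>'n\<close>; the order on \<open>'n\<close>
  plays the role of the order on \<open>1, \<dots>, n\<close>.  (On a finite linear order the class \<open>wellorder\<close> is no
  restriction; it is the sort used by the change-of-variables theorems of the library.)  The elements
  of \<open>\<int>\<^sup>n\<close> are treated as vectors in \<open>\<real>\<^sup>n\<close> with integer components.
\<close>

section \<open>Symmetric and antisymmetric multivariate cosine functions\<close>

definition cos_minus :: "real^'n \<Rightarrow> real^'n \<Rightarrow> real" where
  "cos_minus l x =
    (\<Sum>\<sigma> | \<sigma> permutes (UNIV :: 'n set). of_int (sign \<sigma>) * (\<Prod>i\<in>UNIV. cos (pi * l $ \<sigma> i * x $ i)))"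

definition cos_plus :: "real^'n \<Rightarrow> real^'n \<Rightarrow> real" where
  "cos_plus l x =
    (\<Sum>\<sigma> | \<sigma> permutes (UNIV :: 'n set). (\<Prod>i\<in>UNIV. cos (pi * l $ \<sigma> i * x $ i)))"

definition P_plus :: "(real^'n::{finite,wellorder}) set" where
  "P_plus = {k. (\<forall>i. k $ i \<in> \<int>) \<and> (\<forall>i j. i \<le> j \<longrightarrow> k $ j \<le> k $ i) \<and> (\<forall>i. 0 \<le> k $ i)}"

definition rho :: "real^'n" where
  "rho = (\<chi> i. 1/2)"

text \<open>The number of indices above the \<open>i\<close>-th one is \<open>n - i\<close>, so
  \<open>rho1 = (n - 1, n - 2, \<dots>, 0)\<close> and \<open>rho2 = (n - 1/2, n - 3/2, \<dots>, 1/2)\<close>.\<close>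

definition rho1 :: "real^'n::{finite,wellorder}" where
  "rho1 = (\<chi> i. real (card {j. i < j}))"

definition rho2 :: "real^'n::{finite,wellorder}" where
  "rho2 = (\<chi> i. real (card {j. i < j}) + 1/2)"

definition H_const :: "real^'n \<Rightarrow> nat" where
  "H_const k = card {\<sigma>. \<sigma> permutes (UNIV :: 'n set) \<and> (\<chi> i. k $ \<sigma> i) = k}"

definition h_const :: "real^'n \<Rightarrow> real" where
  "h_const k = (\<Prod>i\<in>UNIV. if k $ i = 0 then 1 else 1/2)"


section \<open>Fundamental domain and the map \<open>\<phi>\<close>\<close>

definition F_dom :: "(real^'n::{finite,wellorder}) set" where
  "F_dom = {x. (\<forall>i. 0 \<le> x $ i \<and> x $ i \<le> 1) \<and> (\<forall>i j. i \<le> j \<longrightarrow> x $ j \<le> x $ i)}"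

text \<open>The \<open>j\<close>-th component of \<open>phi x\<close> is \<open>X\<^sub>j(x)\<close>; the inner vector is \<open>(1, \<dots>, 1, 0, \<dots>, 0)\<close> with
  ones at the positions \<open>1, \<dots>, j\<close>.\<close>

definition phi :: "real^'n::{finite,wellorder} \<Rightarrow> real^'n::_" where
  "phi x = (\<chi> j. cos_plus (\<chi> i. if i \<le> j then 1 else 0) x)"

definition F_frak :: "(real^'n::{finite,wellorder}) set" where
  "F_frak = phi ` F_dom"

definition J_det :: "real^'n::{finite,wellorder} \<Rightarrow> real" where
  "J_det x = det (jacobian phi (at x))"


section \<open>The polynomial ring in the variables \<open>X\<^sub>1, \<dots>, X\<^sub>n\<close>\<close>

text \<open>A polynomial is a finitely supported map from exponent vectors to coefficients; the library's
  multiplication on this type is the convolution product, i.e. multiplication of polynomials.\<close>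

type_synonym 'n real_mpoly = "('n \<Rightarrow>\<^sub>0 nat) \<Rightarrow>\<^sub>0 real"

definition eval_mpoly :: "'n real_mpoly \<Rightarrow> real^'n \<Rightarrow> real" where
  "eval_mpoly p x =
    (\<Sum>m\<in>Poly_Mapping.keys p. Poly_Mapping.lookup p m * (\<Prod>i\<in>UNIV. x $ i ^ Poly_Mapping.lookup m i))"

definition scale_mpoly :: "real \<Rightarrow> 'n real_mpoly \<Rightarrow> 'n real_mpoly" where
  "scale_mpoly c p = Poly_Mapping.single 0 c * p"

global_interpretation mpoly: vector_space scale_mpoly
proof
  fix a b :: real and x y :: "'n real_mpoly"
  show "scale_mpoly a (x + y) = scale_mpoly a x + scale_mpoly a y"
    by (simp add: scale_mpoly_def distrib_left)
  show "scale_mpoly (a + b) x = scale_mpoly a x + scale_mpoly b x"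
    by (simp add: scale_mpoly_def distrib_right single_add)
  show "scale_mpoly a (scale_mpoly b x) = scale_mpoly (a * b) x"
    by (simp add: scale_mpoly_def mult_single flip: mult.assoc)
  show "scale_mpoly 1 x = x"
    by (simp add: scale_mpoly_def)
qed


section \<open>The four families of orthogonal polynomials\<close>

definition poly_I_plus :: "real^'n::{finite,wellorder} \<Rightarrow> 'n real_mpoly" where
  "poly_I_plus k = (THE p. \<forall>x\<in>interior F_dom. eval_mpoly p (phi x) = cos_plus k x)"

definition poly_I_minus :: "real^'n::{finite,wellorder} \<Rightarrow> 'n real_mpoly" where
  "poly_I_minus k =
    (THE p. \<forall>x\<in>interior F_dom. eval_mpoly p (phi x) = cos_minus (k + rho1) x / cos_minus rho1 x)"

definition poly_III_plus :: "real^'n::{finite,wellorder} \<Rightarrow> 'n real_mpoly" where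
  "poly_III_plus k =
    (THE p. \<forall>x\<in>interior F_dom. eval_mpoly p (phi x) = cos_plus (k + rho) x / cos_plus rho x)"

definition poly_III_minus :: "real^'n::{finite,wellorder} \<Rightarrow> 'n real_mpoly" where
  "poly_III_minus k =
    (THE p. \<forall>x\<in>interior F_dom. eval_mpoly p (phi x) = cos_minus (k + rho2) x / cos_minus rho2 x)"


section \<open>Weight functions\<close>

definition p_I_plus :: "'n::{finite,wellorder} real_mpoly" where
  "p_I_plus = (THE p. \<forall>x\<in>F_dom. eval_mpoly p (phi x) = (J_det x)\<^sup>2)"

definition J_frak :: "real^'n::{finite,wellorder} \<Rightarrow> real" where
  "J_frak X = sqrt (eval_mpoly p_I_plus X)"

definition J_I_minus :: "'n::{finite,wellorder} real_mpoly" where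
  "J_I_minus = (THE p. \<forall>x\<in>F_dom. eval_mpoly p (phi x) = (cos_minus rho1 x)\<^sup>2)"

definition J_III_plus :: "'n::{finite,wellorder} real_mpoly" where
  "J_III_plus = (THE p. \<forall>x\<in>F_dom. eval_mpoly p (phi x) = (cos_plus rho x)\<^sup>2)"

definition J_III_minus :: "'n::{finite,wellorder} real_mpoly" where
  "J_III_minus = (THE p. \<forall>x\<in>F_dom. eval_mpoly p (phi x) = (cos_minus rho2 x)\<^sup>2)"

text \<open>On \<open>F_frak\<close>, \<open>J_frak\<close> vanishes exactly on the image of the boundary of \<open>F_dom\<close>, which is a null set; there
  the weights take the conventional value \<open>0\<close>.\<close>

definition w_I_plus :: "real^'n::{finite,wellorder} \<Rightarrow> real" where
  "w_I_plus X = 1 / J_frak X"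

definition w_I_minus :: "real^'n::{finite,wellorder} \<Rightarrow> real" where
  "w_I_minus X = eval_mpoly J_I_minus X / J_frak X"

definition w_III_plus :: "real^'n::{finite,wellorder} \<Rightarrow> real" where
  "w_III_plus X = eval_mpoly J_III_plus X / J_frak X"

definition w_III_minus :: "real^'n::{finite,wellorder} \<Rightarrow> real" where
  "w_III_minus X = eval_mpoly J_III_minus X / J_frak X"


section \<open>Weighted integrals and orthogonal bases\<close>

definition weighted_integral ::
    "(real^'n::{finite,wellorder} \<Rightarrow> real) \<Rightarrow> 'n real_mpoly \<Rightarrow> 'n real_mpoly \<Rightarrow> real" where
  "weighted_integral w f g = (LINT X:F_frak|lborel. eval_mpoly f X * eval_mpoly g X * w X)"

definition is_scalar_product :: "('n real_mpoly \<Rightarrow> 'n real_mpoly \<Rightarrow> real) \<Rightarrow> bool" where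
  "is_scalar_product ip \<longleftrightarrow>
    (\<forall>f g. ip f g = ip g f) \<and>
    (\<forall>f g h. ip (f + g) h = ip f h + ip g h) \<and>
    (\<forall>c f g. ip (scale_mpoly c f) g = c * ip f g) \<and>
    (\<forall>f. f \<noteq> 0 \<longrightarrow> 0 < ip f f)"

text \<open>Besides the basis property and pairwise orthogonality this records that the weighted integral
  really is a scalar product on polynomials: all integrals exist (a divergent one would have the
  value \<open>0\<close>) and the scalar product axioms hold.\<close>

definition orthogonal_basis ::
    "(real^'n::{finite,wellorder} \<Rightarrow> real) \<Rightarrow> 'k set \<Rightarrow> ('k \<Rightarrow> 'n real_mpoly) \<Rightarrow> bool" where
  "orthogonal_basis w K P \<longleftrightarrow>
    (\<forall>f g. set_integrable lborel F_frak (\<lambda>X. eval_mpoly f X * eval_mpoly g X * w X)) \<and>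
    is_scalar_product (weighted_integral w) \<and>
    inj_on P K \<and> mpoly.independent (P ` K) \<and> mpoly.span (P ` K) = UNIV \<and>
    (\<forall>k\<in>K. \<forall>k'\<in>K. k \<noteq> k' \<longrightarrow> weighted_integral w (P k) (P k') = 0)"

end

theory Submission
  imports Defs "HOL-Library.Function_Algebras"
begin

text \<open>Write \<open>y\<^sub>i = cos (\<pi> x\<^sub>i)\<close>.  All four families have one shape: the numerators are sums over \<open>S\<^sub>n\<close>,
weighted by a character \<open>s\<close> (trivial or sign), of products of cosines whose frequencies are the
entries of \<open>k + r\<close>, where \<open>r\<close> is \<open>0\<close>, \<open>rho1\<close>, \<open>rho\<close> or \<open>rho2\<close>; the denominator \<open>d\<close> is \<open>1\<close>, or the
same sum with \<open>k = 0\<close>.  The locale \<open>polynomial_family\<close> treats them together.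

The map \<open>phi\<close> is governed by one identity, \<open>generating_function\<close>: the product of all \<open>t - y\<^sub>i\<close> is an
affine function of \<open>phi x\<close>.  Comparing roots gives injectivity on the interior of the simplex
(\<open>inj_on_phi\<close>), and differentiating it gives a nonzero Jacobian there (\<open>J_det_nonzero\<close>).  So \<open>phi\<close>
has open image, whence a polynomial is determined by its values there, and substitution turns the
weighted integral of two polynomials into the integral of \<open>(f \<circ> phi) d (g \<circ> phi) d\<close> over the
simplex (\<open>integral_F_frak_substitution\<close>): the weight is \<open>d\<^sup>2\<close> divided by the absolute value of the Jacobian.  For members
of a family this is the integral of a product of two numerators.  By symmetry it is a fraction
\<open>1 / n!\<close> of the integral over the unit cube, where products of cosines are orthogonal one variable
at a time (\<open>integral_cos_sym_cos_sym\<close>).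

That the quotients are polynomials and that they span is one dimension count
(\<open>numerator_in_span_monom_fun\<close>).  Multiplying out cosines, every \<open>X\<^sup>m\<close> of degree at most \<open>N\<close>,
evaluated at \<open>phi\<close> and multiplied by \<open>d\<close>, is a combination of the numerators with \<open>k\<^sub>1 \<le> N\<close>.  These
products are linearly independent because \<open>phi\<close> has open image, and passing to the conjugate
partition shows that there are at least as many exponents \<open>m\<close> as weights \<open>k\<close>.  Hence both sets
span the same space.

The squared Jacobian and the squares of the denominators are symmetric trigonometric polynomials
with integral frequencies, so the count for the family \<open>I,+\<close> makes them polynomials in \<open>phi\<close>;
this is what gives the weights their meaning (\<open>square_ex1\<close>, \<open>J_det_square_ex1\<close>).  Finally
the alternating denominators have no zero in the interior: up to a nonzero factor they are
determinants of polynomials of degrees \<open>0, \<dots>, n - 1\<close> at \<open>n\<close> distinct points (\<open>cos_minus_nonzero\<close>).\<close>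

section \<open>Finite linear orders\<close>

text \<open>A permutation that maximizes \<open>\<Sum>i. v (\<sigma> i) * w i\<close> for strictly decreasing \<open>w\<close> sorts \<open>v\<close>: exchanging
two values that are in the wrong order would increase the sum.\<close>

lemma exists_antimono_permutation:
  fixes v :: "'n::{finite,wellorder} \<Rightarrow> real"
  shows "\<exists>\<sigma>. \<sigma> permutes UNIV \<and> antimono (v \<circ> \<sigma>)"
proof -
  define w where "w i = real (card {j. i < j})" for i :: 'n
  define E where "E \<sigma> = (\<Sum>i\<in>UNIV. v (\<sigma> i) * w i)" for \<sigma> :: "'n \<Rightarrow> 'n"
  let ?P = "{\<sigma>. \<sigma> permutes (UNIV :: 'n set)}"
  have fin: "finite ?P" by (simp add: finite_permutations)
  have ne: "?P \<noteq> {}" using permutes_id by blast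
  have wlt: "w j < w i" if "i < j" for i j
    unfolding w_def of_nat_less_iff using that by (intro psubset_card_mono) auto
  obtain \<sigma> where \<sigma>: "\<sigma> permutes UNIV" and max: "\<And>\<tau>. \<tau> permutes UNIV \<Longrightarrow> E \<tau> \<le> E \<sigma>"
  proof -
    have "Max (E ` ?P) \<in> E ` ?P" using fin ne by (intro Max_in) auto
    then obtain \<sigma> where s: "\<sigma> permutes UNIV" and eq: "E \<sigma> = Max (E ` ?P)" by auto
    show ?thesis
    proof (rule that[OF s])
      fix \<tau> :: "'n \<Rightarrow> 'n" assume "\<tau> permutes UNIV"
      then show "E \<tau> \<le> E \<sigma>" unfolding eq using fin by (intro Max_ge) auto
    qed
  qed
  have "v (\<sigma> j) \<le> v (\<sigma> i)" if "i < j" for i j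
  proof (rule ccontr)
    assume neg: "\<not> v (\<sigma> j) \<le> v (\<sigma> i)"
    define \<tau> where "\<tau> = \<sigma> \<circ> Transposition.transpose i j"
    have \<tau>: "\<tau> permutes UNIV"
      unfolding \<tau>_def by (intro permutes_compose permutes_swap_id \<sigma>) auto
    have split: "(\<Sum>l\<in>UNIV. f l) = f i + f j + (\<Sum>l\<in>UNIV - {i,j}. f l)" for f :: "'n \<Rightarrow> real"
    proof -
      have "sum f UNIV = sum f (UNIV - {i,j}) + sum f {i,j}"
        by (rule sum.subset_diff) auto
      then show ?thesis using \<open>i < j\<close> by simp
    qed
    have "(\<Sum>l\<in>UNIV - {i,j}. v (\<tau> l) * w l) = (\<Sum>l\<in>UNIV - {i,j}. v (\<sigma> l) * w l)"
      by (rule sum.cong) (auto simp: \<tau>_def transpose_def)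
    then have "E \<tau> - E \<sigma> = v (\<sigma> j) * w i + v (\<sigma> i) * w j - v (\<sigma> i) * w i - v (\<sigma> j) * w j"
      unfolding E_def split by (simp add: \<tau>_def)
    also have "\<dots> = (v (\<sigma> j) - v (\<sigma> i)) * (w i - w j)" by (simp add: algebra_simps)
    also have "\<dots> > 0" using neg wlt[OF that] by (intro mult_pos_pos) auto
    finally show False using max[OF \<tau>] by simp
  qed
  then have "antimono (v \<circ> \<sigma>)"
    unfolding antimono_def by (auto simp: order.order_iff_strict)
  with \<sigma> show ?thesis by blast
qed

text \<open>The superlevel sets of a decreasing function are initial segments, and an initial segment is
determined by its cardinality.\<close>

lemma antimono_permutation_unique:
  fixes a b :: "'n::{finite,wellorder} \<Rightarrow> real"
  assumes "antimono a" "antimono b" "\<sigma> permutes UNIV" "\<tau> permutes UNIV"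
    and eq: "\<And>i. a (\<sigma> i) = b (\<tau> i)"
  shows "a = b"
proof -
  have "{i. c \<le> a i} = {i. c \<le> b i}" for c
  proof -
    let ?A = "{i. c \<le> a i}" and ?B = "{i. c \<le> b i}"
    have "card ?A = card {i. c \<le> a (\<sigma> i)}"
      using card_vimage_inj[of \<sigma> ?A] permutes_inj[OF assms(3)] permutes_surj[OF assms(3)]
      by (simp add: vimage_def)
    moreover have "card ?B = card {i. c \<le> b (\<tau> i)}"
      using card_vimage_inj[of \<tau> ?B] permutes_inj[OF assms(4)] permutes_surj[OF assms(4)]
      by (simp add: vimage_def)
    ultimately have card: "card ?A = card ?B" by (simp add: eq)
    have "?A \<subseteq> ?B \<or> ?B \<subseteq> ?A"
    proof (rule ccontr)
      assume "\<not> ?thesis"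
      then obtain i j where "c \<le> a i" "\<not> c \<le> b i" "c \<le> b j" "\<not> c \<le> a j" by auto
      then show False
        using antimonoD[OF assms(2), of i j] antimonoD[OF assms(1), of j i] using linear[of i j] by auto
    qed
    with card show ?thesis
      using card_subset_eq[of ?A ?B] card_subset_eq[of ?B ?A] by auto
  qed
  then have "c \<le> a i \<longleftrightarrow> c \<le> b i" for c i by (metis mem_Collect_eq)
  then have "a i = b i" for i by (metis order_antisym order_refl)
  then show ?thesis by (rule ext)
qed

lemma exists_initial_segment_card:
  fixes S :: "'n::{finite,wellorder} set"
  assumes "S \<noteq> {}"
  shows "\<exists>j::'n. card {..j} = card S"
proof -
  have inj: "inj (\<lambda>j::'n. card {..j})"
  proof (rule injI)
    fix x y :: 'n assume eq: "card {..x} = card {..y}"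
    have "{..x} \<subseteq> {..y} \<or> {..y} \<subseteq> {..x}" by (meson atMost_subset_iff linear)
    then have "{..x} = {..y}" using eq card_subset_eq[of "{..x}" "{..y}"] card_subset_eq[of "{..y}" "{..x}"] by auto
    then show "x = y" by simp
  qed
  have "(\<lambda>j::'n. card {..j}) ` UNIV \<subseteq> {1..CARD('n)}"
    by (auto simp: card_mono Suc_le_eq card_gt_0_iff)
  then have "(\<lambda>j::'n. card {..j}) ` UNIV = {1..CARD('n)}"
    by (intro card_subset_eq) (auto simp: card_image inj)
  moreover have "card S \<in> {1..CARD('n)}"
    using assms by (auto simp: card_mono Suc_le_eq card_gt_0_iff)
  ultimately have "card S \<in> (\<lambda>j::'n. card {..j}) ` UNIV" by simp
  then show ?thesis by (metis (no_types) imageE)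
qed

section \<open>Products of cosines and their symmetrizations\<close>

definition fscale :: "real \<Rightarrow> ('a \<Rightarrow> real) \<Rightarrow> 'a \<Rightarrow> real" where
  "fscale c f = (\<lambda>x. c * f x)"

lemma fscale_apply: "fscale c f x = c * f x"
  by (simp add: fscale_def)

text \<open>Dimension arguments take place in the vector space of all real functions on a type.\<close>

global_interpretation fs: vector_space "fscale :: real \<Rightarrow> ('a \<Rightarrow> real) \<Rightarrow> 'a \<Rightarrow> real"
  by unfold_locales (auto simp: fun_eq_iff fscale_apply algebra_simps)

lemma sum_fun_apply: "(\<Sum>a\<in>A. f a) x = (\<Sum>a\<in>A. f a x :: real)"
  by (induction A rule: infinite_finite_induct) auto

definition cos_prod :: "real^'n \<Rightarrow> real^'n \<Rightarrow> real" where
  "cos_prod l x = (\<Prod>i\<in>UNIV. cos (pi * l $ i * x $ i))"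

definition permv :: "('n \<Rightarrow> 'n) \<Rightarrow> real^'n \<Rightarrow> real^'n" where
  "permv \<sigma> x = (\<chi> i. x $ \<sigma> i)"

lemma permv_nth [simp]: "permv \<sigma> x $ i = x $ \<sigma> i"
  by (simp add: permv_def)

lemma permv_permv: "permv \<sigma> (permv \<tau> x) = permv (\<tau> \<circ> \<sigma>) x"
  by (simp add: vec_eq_iff)

definition cos_sym :: "(('n \<Rightarrow> 'n) \<Rightarrow> real) \<Rightarrow> real^'n \<Rightarrow> real^'n \<Rightarrow> real" where
  "cos_sym s l x = (\<Sum>\<sigma> | \<sigma> permutes (UNIV :: 'n set). s \<sigma> * cos_prod (permv \<sigma> l) x)"

lemma cos_plus_eq: "cos_plus = cos_sym (\<lambda>_. 1)"
  by (auto simp: fun_eq_iff fscale_apply cos_plus_def cos_sym_def cos_prod_def)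

lemma cos_minus_eq: "cos_minus = cos_sym (\<lambda>\<sigma>. of_int (sign \<sigma>))"
  by (auto simp: fun_eq_iff fscale_apply cos_minus_def cos_sym_def cos_prod_def)

lemma cos_prod_permv:
  assumes "\<sigma> permutes (UNIV :: 'n::finite set)"
  shows "cos_prod l (permv \<sigma> x) = cos_prod (permv (inv \<sigma>) l) (x :: real^'n)"
proof -
  have "cos_prod l (permv \<sigma> x) = (\<Prod>i\<in>UNIV. cos (pi * l $ i * x $ \<sigma> i))"
    by (simp add: cos_prod_def)
  also have "\<dots> = (\<Prod>i\<in>UNIV. ((\<lambda>i. cos (pi * l $ i * x $ \<sigma> i)) \<circ> inv \<sigma>) i)"
    by (rule prod.permute[OF permutes_inv[OF assms]])
  also have "\<dots> = cos_prod (permv (inv \<sigma>) l) x"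
    using permutes_inverses(1)[OF assms] by (simp add: cos_prod_def)
  finally show ?thesis .
qed

lemma cos_prod_abs: "cos_prod (\<chi> i. \<bar>l $ i\<bar>) = cos_prod l"
proof -
  have "cos (pi * \<bar>a\<bar> * b) = cos (pi * a * b)" for a b :: real
    by (cases "0 \<le> a") auto
  then show ?thesis by (simp add: fun_eq_iff fscale_apply cos_prod_def)
qed

lemma cos_sym_abs: "cos_sym s (\<chi> i. \<bar>l $ i\<bar>) = cos_sym s l"
proof -
  have "permv \<sigma> (\<chi> i. \<bar>l $ i\<bar>) = (\<chi> i. \<bar>permv \<sigma> l $ i\<bar>)" for \<sigma>
    by (simp add: vec_eq_iff)
  then show ?thesis by (simp only: fun_eq_iff cos_sym_def cos_prod_abs) simp
qed

text \<open>The addition theorem in every coordinate: a set \<open>S\<close> records the coordinates in which the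
frequencies are added rather than subtracted.\<close>

lemma cos_prod_mult:
  "cos_prod a x * cos_prod b x =
    (\<Sum>S\<in>Pow UNIV. (1/2) ^ CARD('n) * cos_prod (\<chi> i. if i \<in> S then a $ i + b $ i else a $ i - b $ i) x)"
  for x :: "real^'n::finite"
proof -
  have "cos_prod a x * cos_prod b x =
      (\<Prod>i\<in>UNIV. (1/2) * cos (pi * (a $ i + b $ i) * x $ i) + (1/2) * cos (pi * (a $ i - b $ i) * x $ i))"
    unfolding cos_prod_def prod.distrib[symmetric]
  proof (rule prod.cong)
    fix i
    have e: "pi * (a $ i + b $ i) * x $ i = pi * a $ i * x $ i + pi * b $ i * x $ i"
            "pi * (a $ i - b $ i) * x $ i = pi * a $ i * x $ i - pi * b $ i * x $ i"
      by (simp_all add: algebra_simps)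
    show "cos (pi * a $ i * x $ i) * cos (pi * b $ i * x $ i) =
      (1/2) * cos (pi * (a $ i + b $ i) * x $ i) + (1/2) * cos (pi * (a $ i - b $ i) * x $ i)"
      unfolding e cos_add cos_diff by (simp add: field_simps)
  qed simp
  also have "\<dots> = (\<Sum>S\<in>Pow UNIV. (\<Prod>i\<in>S. (1/2) * cos (pi * (a $ i + b $ i) * x $ i)) *
      (\<Prod>i\<in>UNIV - S. (1/2) * cos (pi * (a $ i - b $ i) * x $ i)))"
    by (rule prod_add) simp
  also have "\<dots> = (\<Sum>S\<in>Pow UNIV. (1/2) ^ CARD('n) *
      cos_prod (\<chi> i. if i \<in> S then a $ i + b $ i else a $ i - b $ i) x)"
  proof (rule sum.cong[OF refl])
    fix S :: "'n set"
    have "(1/2) ^ CARD('n) * cos_prod (\<chi> i. if i \<in> S then a $ i + b $ i else a $ i - b $ i) x =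
      (\<Prod>i\<in>UNIV. (1/2) * cos (pi * (if i \<in> S then a $ i + b $ i else a $ i - b $ i) * x $ i))"
      by (simp only: cos_prod_def prod.distrib prod_constant vec_lambda_beta)
    also have "\<dots> = (\<Prod>i\<in>UNIV - S. (1/2) * cos (pi * (if i \<in> S then a $ i + b $ i else a $ i - b $ i) * x $ i)) *
      (\<Prod>i\<in>S. (1/2) * cos (pi * (if i \<in> S then a $ i + b $ i else a $ i - b $ i) * x $ i))"
      by (rule prod.subset_diff) auto
    finally show "(\<Prod>i\<in>S. (1/2) * cos (pi * (a $ i + b $ i) * x $ i)) *
      (\<Prod>i\<in>UNIV - S. (1/2) * cos (pi * (a $ i - b $ i) * x $ i)) = (1/2) ^ CARD('n) *
      cos_prod (\<chi> i. if i \<in> S then a $ i + b $ i else a $ i - b $ i) x"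
      by (simp add: mult.commute)
  qed
  finally show ?thesis .
qed

text \<open>The frequencies of a product are sums and differences, coordinate by coordinate, of the frequencies
of the factors.\<close>

lemma span_cos_prod_mult:
  fixes A B C :: "(real^'n::finite) set"
  assumes f: "f \<in> fs.span (cos_prod ` A)" and g: "g \<in> fs.span (cos_prod ` B)"
    and C: "\<And>a b e. a \<in> A \<Longrightarrow> b \<in> B \<Longrightarrow> (\<And>i. e $ i = a $ i + b $ i \<or> e $ i = a $ i - b $ i) \<Longrightarrow> e \<in> C"
  shows "f * g \<in> fs.span (cos_prod ` C)"
  using f
proof (induction rule: fs.span_induct_alt)
  case base
  show ?case unfolding mult_zero_left mult_zero_right by (rule fs.span_zero)
next
  case (step c f1 f2)
  then obtain a where a: "a \<in> A" and f1: "f1 = cos_prod a" by auto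
  have "cos_prod a * g \<in> fs.span (cos_prod ` C)"
    using g
  proof (induction rule: fs.span_induct_alt)
    case base
    show ?case unfolding mult_zero_left mult_zero_right by (rule fs.span_zero)
  next
    case (step c g1 g2)
    then obtain b where b: "b \<in> B" and g1: "g1 = cos_prod b" by auto
    have "cos_prod a * cos_prod b = (\<Sum>S\<in>Pow UNIV. fscale ((1/2) ^ CARD('n))
        (cos_prod (\<chi> i. if i \<in> S then a $ i + b $ i else a $ i - b $ i)))"
      by (rule ext) (simp add: fscale_apply cos_prod_mult sum_fun_apply fscale_apply)
    also have "\<dots> \<in> fs.span (cos_prod ` C)"
      by (intro fs.span_sum fs.span_scale fs.span_base imageI C[OF a b]) auto
    finally have "fscale c (cos_prod a * cos_prod b) + cos_prod a * g2 \<in> fs.span (cos_prod ` C)"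
      by (intro fs.span_add fs.span_scale step.IH)
    also have "fscale c (cos_prod a * cos_prod b) + cos_prod a * g2 = cos_prod a * (fscale c g1 + g2)"
      by (auto simp: fun_eq_iff fscale_apply algebra_simps g1)
    finally show ?case .
  qed
  then have "fscale c (cos_prod a * g) + f2 * g \<in> fs.span (cos_prod ` C)"
    by (intro fs.span_add fs.span_scale step.IH)
  also have "fscale c (cos_prod a * g) + f2 * g = (fscale c f1 + f2) * g"
    by (auto simp: fun_eq_iff fscale_apply algebra_simps f1)
  finally show ?case .
qed

text \<open>\<open>s\<close> is the trivial or the sign character of the symmetric group; a function with
\<open>f (permv \<sigma> x) = s \<sigma> * f x\<close> is then symmetric or alternating.\<close>

locale sym_char =
  fixes s :: "('n::{finite,wellorder} \<Rightarrow> 'n) \<Rightarrow> real"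
  assumes s_compose: "\<sigma> permutes UNIV \<Longrightarrow> \<tau> permutes UNIV \<Longrightarrow> s (\<sigma> \<circ> \<tau>) = s \<sigma> * s \<tau>"
    and s_square: "s \<sigma> * s \<sigma> = 1"
begin

lemma s_id: "s id = 1"
  using s_compose[OF permutes_id permutes_id] s_square[of id] by simp

lemma s_inv: "\<sigma> permutes UNIV \<Longrightarrow> s (inv \<sigma>) = s \<sigma>"
  using s_compose[OF permutes_inv, of \<sigma> \<sigma>] s_id s_square[of \<sigma>] permutes_inv_o(2)[of \<sigma> UNIV]
  by (metis (no_types, lifting) mult.assoc mult.commute mult_1)

lemma cos_sym_permv_left:
  assumes "\<tau> permutes UNIV"
  shows "cos_sym s (permv \<tau> l) x = s \<tau> * cos_sym s l x"
proof -
  have "s \<tau> * cos_sym s l x = (\<Sum>\<sigma> | \<sigma> permutes UNIV. s \<tau> * (s (\<tau> \<circ> \<sigma>) * cos_prod (permv (\<tau> \<circ> \<sigma>) l) x))"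
    unfolding cos_sym_def by (subst setum_permutations_compose_left[OF assms]) (simp add: sum_distrib_left)
  also have "\<dots> = (\<Sum>\<sigma> | \<sigma> permutes UNIV. s \<sigma> * cos_prod (permv \<sigma> (permv \<tau> l)) x)"
    using s_square[of \<tau>] by (intro sum.cong) (auto simp: s_compose[OF assms] permv_permv mult.assoc[symmetric])
  finally show ?thesis by (simp add: cos_sym_def)
qed

lemma cos_sym_permv_right:
  assumes "\<tau> permutes UNIV"
  shows "cos_sym s l (permv \<tau> x) = s \<tau> * cos_sym s l x"
proof -
  note inv = permutes_inv[OF assms]
  have "s \<tau> * cos_sym s l x = (\<Sum>\<sigma> | \<sigma> permutes UNIV. s \<tau> * (s (\<sigma> \<circ> inv \<tau>) * cos_prod (permv (\<sigma> \<circ> inv \<tau>) l) x))"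
    unfolding cos_sym_def by (subst sum_permutations_compose_right[OF inv]) (simp add: sum_distrib_left)
  also have "\<dots> = (\<Sum>\<sigma> | \<sigma> permutes UNIV. s \<sigma> * cos_prod (permv \<sigma> l) (permv \<tau> x))"
    using s_square[of \<tau>]
    by (intro sum.cong) (auto simp: s_compose[OF _ inv] s_inv[OF assms] cos_prod_permv[OF assms] permv_permv)
  finally show ?thesis by (simp add: cos_sym_def)
qed

lemma sym_sum_cos_prod:
  "(\<Sum>\<sigma> | \<sigma> permutes UNIV. s \<sigma> * cos_prod l (permv \<sigma> x)) = cos_sym s l x"
  unfolding cos_sym_def
  by (subst sum_permutations_inverse, rule sum.cong)
     (auto simp: s_inv cos_prod_permv permutes_inv inv_inv_eq permutes_bij)

text \<open>Averaging over the symmetric group with the character \<open>s\<close> reproduces \<open>f\<close>, and it sends a product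
of cosines to the corresponding \<open>cos_sym\<close>.\<close>

lemma symmetric_in_span_cos_sym:
  assumes f: "f \<in> fs.span (cos_prod ` A)"
    and sym: "\<And>\<sigma> x. \<sigma> permutes UNIV \<Longrightarrow> f (permv \<sigma> x) = s \<sigma> * f x"
  shows "f \<in> fs.span (cos_sym s ` A)"
proof -
  let ?P = "{\<sigma>. \<sigma> permutes (UNIV :: 'n set)}"
  have "(\<lambda>x. \<Sum>\<sigma>\<in>?P. s \<sigma> * f (permv \<sigma> x)) \<in> fs.span (cos_sym s ` A)"
    using f
  proof (induction rule: fs.span_induct_alt)
    case base
    show ?case using fs.span_zero[of "cos_sym s ` A"] by (simp only: zero_fun_def mult_zero_right sum.neutral_const)
  next
    case (step c f1 f2)
    then obtain a where a: "a \<in> A" and f1: "f1 = cos_prod a" by auto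
    have "(\<lambda>x. \<Sum>\<sigma>\<in>?P. s \<sigma> * (fscale c f1 + f2) (permv \<sigma> x)) =
       fscale c (cos_sym s a) + (\<lambda>x. \<Sum>\<sigma>\<in>?P. s \<sigma> * f2 (permv \<sigma> x))"
      by (rule ext) (simp add: fscale_apply f1 sym_sum_cos_prod[symmetric] sum.distrib sum_distrib_left algebra_simps)
    also have "\<dots> \<in> fs.span (cos_sym s ` A)"
      using a by (intro fs.span_add fs.span_scale step.IH fs.span_base imageI)
    finally show ?case .
  qed
  also have "(\<lambda>x. \<Sum>\<sigma>\<in>?P. s \<sigma> * f (permv \<sigma> x)) = (\<lambda>x. real (card ?P) * f x)"
    by (rule ext) (simp add: sym mult.assoc[symmetric] s_square)
  finally have "fscale (1 / real (card ?P)) (\<lambda>x. real (card ?P) * f x) \<in> fs.span (cos_sym s ` A)"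
    by (rule fs.span_scale)
  moreover have "card ?P \<noteq> 0" by (simp add: card_permutations)
  ultimately show ?thesis by (simp add: fscale_def)
qed

end

lemma sym_char_one: "sym_char (\<lambda>_. 1)"
  by unfold_locales auto

lemma sym_char_sign: "sym_char (\<lambda>\<sigma> :: 'n::{finite,wellorder} \<Rightarrow> 'n. real_of_int (sign \<sigma>))"
proof
  fix \<sigma> \<tau> :: "'n \<Rightarrow> 'n"
  show "real_of_int (sign \<sigma>) * real_of_int (sign \<sigma>) = 1" by (simp add: sign_def)
  assume "\<sigma> permutes UNIV" "\<tau> permutes UNIV"
  then show "real_of_int (sign (\<sigma> \<circ> \<tau>)) = real_of_int (sign \<sigma>) * real_of_int (sign \<tau>)"
    by (subst sign_compose) (auto simp: permutation_permutes)
qed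

text \<open>The coset of the integral lattice is given by \<open>r0\<close>, which is \<open>0\<close> or \<open>1/2\<close>; the bound on the
frequencies plays the role of a degree.\<close>

definition weight_box :: "real \<Rightarrow> real \<Rightarrow> (real^'n) set" where
  "weight_box r0 N = {l. \<forall>i. l $ i - r0 \<in> \<int> \<and> \<bar>l $ i\<bar> \<le> N}"

definition P_plus_upto :: "nat \<Rightarrow> (real^'n::{finite,wellorder}) set" where
  "P_plus_upto N = {k \<in> P_plus. \<forall>i. k $ i \<le> real N}"

definition first_index :: "'n::{finite,wellorder}" where
  "first_index = (LEAST i. True)"

lemma first_index_le: "first_index \<le> i"
  unfolding first_index_def by (rule Least_le) simp

text \<open>The common part of the four families.  Beyond the values of \<open>s\<close>, \<open>r0\<close> and \<open>r\<close>, they differ in the reason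
why \<open>reduce\<close> holds: a decreasing nonnegative frequency vector is of the form \<open>k + r\<close> with \<open>k\<close> in \<open>P_plus\<close>,
unless its cosine sum vanishes.\<close>

locale cosine_family = sym_char s for s :: "('n::{finite,wellorder} \<Rightarrow> 'n) \<Rightarrow> real" +
  fixes r0 :: real and r :: "real^'n::_"
  assumes two_r0: "2 * r0 \<in> \<int>"
    and r_shift: "r $ i - r0 \<in> \<int>"
    and r_nonneg: "0 \<le> r $ i"
    and r_antimono: "i \<le> j \<Longrightarrow> r $ j \<le> r $ i"
    and reduce: "\<And>b. (\<And>i. b $ i - r0 \<in> \<int>) \<Longrightarrow> (\<And>i. 0 \<le> b $ i) \<Longrightarrow> (\<And>i j. i \<le> j \<Longrightarrow> b $ j \<le> b $ i) \<Longrightarrow>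
      cos_sym s b = 0 \<or> b - r \<in> P_plus"
begin

text \<open>Up to sign, a cosine sum does not change when the frequencies are replaced by their absolute values
and sorted, so that \<open>reduce\<close> applies.\<close>

lemma cos_sym_in_span_dominant:
  assumes l: "l \<in> weight_box r0 (real N + r $ first_index)"
  shows "cos_sym s l \<in> fs.span ((\<lambda>k. cos_sym s (k + r)) ` P_plus_upto N)"
proof -
  let ?a = "\<chi> i. \<bar>l $ i\<bar>"
  obtain \<sigma> where \<sigma>: "\<sigma> permutes UNIV" and anti: "antimono ((\<lambda>i. ?a $ i) \<circ> \<sigma>)"
    using exists_antimono_permutation by blast
  define b where "b = permv \<sigma> ?a"
  have b_anti: "b $ j \<le> b $ i" if "i \<le> j" for i j
    using antimonoD[OF anti that] by (simp add: b_def)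
  have b_int: "b $ i - r0 \<in> \<int>" for i
  proof -
    let ?z = "l $ \<sigma> i"
    have z: "?z - r0 \<in> \<int>" using l by (simp add: weight_box_def)
    have "- ?z - r0 = - ((?z - r0) + 2 * r0)" by simp
    also have "\<dots> \<in> \<int>" using z two_r0 by (intro Ints_minus Ints_add)
    finally show ?thesis using z by (simp add: b_def abs_if)
  qed
  have b_nonneg: "0 \<le> b $ i" for i by (simp add: b_def)
  have "cos_sym s b = fscale (s \<sigma>) (cos_sym s l)"
    using cos_sym_permv_left[OF \<sigma>, of ?a] by (auto simp: fun_eq_iff fscale_apply b_def cos_sym_abs)
  then have eq: "cos_sym s l = fscale (s \<sigma>) (cos_sym s b)"
    using s_square[of \<sigma>] by (auto simp: fun_eq_iff fscale_apply mult.assoc[symmetric])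
  show ?thesis
    using reduce[OF b_int b_nonneg b_anti]
  proof
    assume "cos_sym s b = 0"
    then show ?thesis unfolding eq by (metis fs.scale_zero_right fs.span_zero)
  next
    assume k: "b - r \<in> P_plus"
    have "(b - r) $ i \<le> real N" for i
    proof -
      have "(b - r) $ i \<le> (b - r) $ first_index"
        using k first_index_le[of i] unfolding P_plus_def by blast
      also have "\<dots> \<le> real N" using l unfolding weight_box_def by (auto simp: b_def diff_le_eq)
      finally show ?thesis .
    qed
    with k have "b - r \<in> P_plus_upto N" by (simp add: P_plus_upto_def)
    then have "cos_sym s (b - r + r) \<in> (\<lambda>k. cos_sym s (k + r)) ` P_plus_upto N" by blast
    then show ?thesis unfolding eq by (intro fs.span_scale fs.span_base) simp
  qed
qed

end

section \<open>Geometry of the map \<open>phi\<close>\<close>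

definition open_simplex :: "(real^'n::{finite,wellorder}) set" where
  "open_simplex = {x. (\<forall>i. 0 < x $ i \<and> x $ i < 1) \<and> (\<forall>i j. i < j \<longrightarrow> x $ j < x $ i)}"

lemma open_simplex_subset: "open_simplex \<subseteq> F_dom"
  unfolding open_simplex_def F_dom_def by (auto simp: order.order_iff_strict)

lemma open_simplex_antimono: "x \<in> open_simplex \<Longrightarrow> antimono (\<lambda>i. x $ i)"
  unfolding open_simplex_def antimono_def by (auto simp: order.order_iff_strict)

lemma open_simplex_coordinate_inj:
  assumes "x \<in> open_simplex" "x $ i = x $ j"
  shows "i = j"
  using assms unfolding open_simplex_def
  by (metis (no_types, lifting) less_irrefl linorder_neqE mem_Collect_eq)

lemma open_simplex_cos_inj:
  assumes "x \<in> open_simplex" "z \<in> open_simplex" "cos (pi * x $ i) = cos (pi * z $ j)"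
  shows "x $ i = z $ j"
proof -
  have "0 \<le> pi * x $ i" "pi * x $ i \<le> pi" "0 \<le> pi * z $ j" "pi * z $ j \<le> pi"
    using assms by (auto simp: open_simplex_def less_imp_le)
  with assms(3) have "pi * x $ i = pi * z $ j" by (metis cos_inj_pi)
  then show ?thesis by simp
qed

lemma open_open_simplex: "open (open_simplex :: (real^'n::{finite,wellorder}) set)"
proof -
  have "open_simplex = (\<Inter>i. {x :: real^'n::_. 0 < x $ i}) \<inter> (\<Inter>i. {x. x $ i < 1}) \<inter>
      (\<Inter>i. \<Inter>j\<in>{i<..}. {x. x $ j < x $ i})"
    by (auto simp: open_simplex_def)
  also have "open \<dots>"
    by (intro open_Int open_INT ballI open_Collect_less continuous_intros) auto
  finally show ?thesis .
qed

lemma interior_F_dom: "interior F_dom = (open_simplex :: (real^'n::{finite,wellorder}) set)"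
proof
  show "open_simplex \<subseteq> interior (F_dom :: (real^'n::_) set)"
    by (rule interior_maximal[OF open_simplex_subset open_open_simplex])
  show "interior F_dom \<subseteq> (open_simplex :: (real^'n::_) set)"
  proof
    fix x :: "real^'n::_" assume "x \<in> interior F_dom"
    then obtain e where e: "e > 0" "cball x e \<subseteq> F_dom"
      unfolding mem_interior_cball by auto
    have "x + t *\<^sub>R axis i 1 \<in> F_dom" if "\<bar>t\<bar> \<le> e" for t i
      using that e(2) by (intro subsetD[OF e(2)]) (simp add: dist_norm)
    from this[of e] this[of "-e"] e(1)
    have *: "x + e *\<^sub>R axis i 1 \<in> F_dom" "x - e *\<^sub>R axis i 1 \<in> F_dom" for i by auto
    have lo: "0 < x $ i" for i
    proof -
      have "0 \<le> (x - e *\<^sub>R axis i 1) $ i" using *(2)[of i] unfolding F_dom_def by blast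
      then show ?thesis using e(1) by simp
    qed
    have hi: "x $ i < 1" for i
    proof -
      have "(x + e *\<^sub>R axis i 1) $ i \<le> 1" using *(1)[of i] unfolding F_dom_def by blast
      then show ?thesis using e(1) by simp
    qed
    have "x $ j < x $ i" if "i < j" for i j
    proof -
      have "(x + e *\<^sub>R axis j 1) $ j \<le> (x + e *\<^sub>R axis j 1) $ i"
        using *(1)[of j] less_imp_le[OF that] unfolding F_dom_def by blast
      moreover have "i \<noteq> j" using that by simp
      ultimately show ?thesis using e(1) by (simp add: axis_def)
    qed
    with lo hi show "x \<in> open_simplex" by (simp add: open_simplex_def)
  qed
qed

lemma open_simplex_nonempty: "(open_simplex :: (real^'n::{finite,wellorder}) set) \<noteq> {}"
proof -
  let ?x = "(\<chi> i. real (card {i..}) / (real CARD('n) + 1)) :: real^'n::_"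
  have "card {j..} < card {i..}" if "i < j" for i j :: 'n
    using that by (intro psubset_card_mono) auto
  moreover have "0 < card {i..}" "card {i..} \<le> CARD('n)" for i :: 'n
    by (auto simp: card_gt_0_iff card_mono)
  moreover have "real (card {i..}) < real CARD('n) + 1" for i :: 'n
    using card_mono[of UNIV "{i..}"] by simp
  ultimately have "?x \<in> open_simplex"
    by (auto simp: open_simplex_def divide_simps card_gt_0_iff intro: le_less_trans)
  then show ?thesis by blast
qed

lemma convex_F_dom: "convex (F_dom :: (real^'n::{finite,wellorder}) set)"
proof -
  have "F_dom = (\<Inter>i. {x :: real^'n::_. 0 \<le> x $ i}) \<inter> (\<Inter>i. {x. x $ i \<le> 1}) \<inter> (\<Inter>i. \<Inter>j\<in>{i..}. {x. x $ j - x $ i \<le> 0})"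
    by (auto simp: F_dom_def)
  also have "convex \<dots>"
  proof (intro convex_Int convex_INT ballI)
    fix i j :: 'n
    show "convex {x :: real^'n::_. 0 \<le> x $ i}" "convex {x :: real^'n::_. x $ i \<le> 1}"
      using convex_halfspace_ge[of 0 "axis i 1 :: real^'n::_"] convex_halfspace_le[of "axis i 1 :: real^'n::_" 1]
      by (simp_all add: inner_axis' inner_axis)
    show "convex {x :: real^'n::_. x $ j - x $ i \<le> 0}"
      using convex_halfspace_le[of "axis j 1 - axis i 1 :: real^'n::_" 0]
      by (simp add: inner_axis' inner_diff_left)
  qed
  finally show ?thesis .
qed

lemma compact_F_dom: "compact (F_dom :: (real^'n::{finite,wellorder}) set)"
proof -
  have "F_dom = (\<Inter>i. {x :: real^'n::_. 0 \<le> x $ i}) \<inter> (\<Inter>i. {x. x $ i \<le> 1}) \<inter> (\<Inter>i. \<Inter>j\<in>{i..}. {x. x $ j \<le> x $ i})"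
    by (auto simp: F_dom_def)
  also have "closed \<dots>"
    by (intro closed_Int closed_INT ballI closed_Collect_le continuous_intros)
  finally have "closed (F_dom :: (real^'n::_) set)" .
  moreover have "F_dom \<subseteq> cbox 0 (\<chi> i. (1 :: real))"
    by (auto simp: F_dom_def mem_box_cart)
  then have "bounded (F_dom :: (real^'n::_) set)" by (rule bounded_subset[OF bounded_cbox])
  ultimately show ?thesis by (simp add: compact_eq_bounded_closed)
qed

lemma negligible_F_dom_boundary: "negligible (F_dom - open_simplex :: (real^'n::{finite,wellorder}) set)"
proof (rule negligible_subset[OF negligible_convex_frontier[OF convex_F_dom]])
  show "F_dom - open_simplex \<subseteq> (frontier F_dom :: (real^'n::_) set)"
    unfolding interior_F_dom[symmetric] frontier_def using closure_subset by blast
qed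

lemma phi_nth_eq:
  "phi x $ j = (\<Sum>\<sigma> | \<sigma> permutes (UNIV :: 'n::{finite,wellorder} set). \<Prod>l\<in>{..j}. cos (pi * x $ \<sigma> l))"
proof -
  interpret sym_char "\<lambda>_ :: 'n \<Rightarrow> 'n. 1" by (rule sym_char_one)
  let ?w = "\<chi> i. (if i \<le> j then 1 else 0 :: real)"
  have "phi x $ j = (\<Sum>\<sigma> | \<sigma> permutes (UNIV :: 'n set). 1 * cos_prod ?w (permv \<sigma> x))"
    unfolding sym_sum_cos_prod by (simp add: phi_def cos_plus_eq)
  also have "\<dots> = (\<Sum>\<sigma> | \<sigma> permutes (UNIV :: 'n set). \<Prod>l\<in>{..j}. cos (pi * x $ \<sigma> l))"
  proof (rule sum.cong[OF refl])
    fix \<sigma> :: "'n \<Rightarrow> 'n"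
    have "cos_prod ?w (permv \<sigma> x) = (\<Prod>l\<in>UNIV. if l \<in> {..j} then cos (pi * x $ \<sigma> l) else 1)"
      unfolding cos_prod_def by (rule prod.cong) auto
    also have "\<dots> = (\<Prod>l\<in>{..j}. cos (pi * x $ \<sigma> l))"
      by (subst prod.inter_restrict[symmetric]) auto
    finally show "1 * cos_prod ?w (permv \<sigma> x) = (\<Prod>l\<in>{..j}. cos (pi * x $ \<sigma> l))" by simp
  qed
  finally show ?thesis .
qed

lemma phi_permv:
  assumes "\<sigma> permutes UNIV"
  shows "phi (permv \<sigma> x) = phi (x :: real^'n::{finite,wellorder})"
proof -
  interpret sym_char "\<lambda>_ :: 'n \<Rightarrow> 'n. 1" by (rule sym_char_one)
  show ?thesis using cos_sym_permv_right[OF assms] by (simp add: phi_def cos_plus_eq)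
qed

text \<open>A permutation carrying \<open>T\<close> onto \<open>S\<close> can be absorbed into the summation over all permutations.\<close>

lemma sum_permutations_prod_card:
  fixes S T :: "'n::finite set" and f :: "'n \<Rightarrow> real"
  assumes "card S = card T"
  shows "(\<Sum>\<sigma> | \<sigma> permutes UNIV. \<Prod>l\<in>S. f (\<sigma> l)) = (\<Sum>\<sigma> | \<sigma> permutes UNIV. \<Prod>l\<in>T. f (\<sigma> l))"
proof -
  obtain g where g: "bij_betw g T S"
    using finite_same_card_bij[of T S] assms by auto
  have "card (- T) = card (- S)" using assms by (simp add: Compl_eq_Diff_UNIV card_Diff_subset)
  then obtain h where h: "bij_betw h (- T) (- S)"
    using finite_same_card_bij[of "- T" "- S"] by auto
  define p where "p i = (if i \<in> T then g i else h i)" for i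
  have pT: "bij_betw p T S" using g by (rule bij_betw_cong[THEN iffD1, rotated]) (simp add: p_def)
  have "bij_betw p (- T) (- S)" using h by (rule bij_betw_cong[THEN iffD1, rotated]) (simp add: p_def)
  with pT have "bij_betw p (T \<union> - T) (S \<union> - S)" by (rule bij_betw_combine) auto
  then have p: "p permutes UNIV" by (intro bij_imp_permutes) auto
  show ?thesis
    by (subst sum_permutations_compose_right[OF p, of "\<lambda>\<sigma>. \<Prod>l\<in>T. f (\<sigma> l)"])
       (simp add: prod.reindex_bij_betw[OF pT, of "\<lambda>l. f (_ l)"])
qed

text \<open>Expanding the product gives the elementary symmetric functions of the \<open>y\<^sub>i\<close>.  Averaging over the
permutations of the variables identifies the term of a nonempty set \<open>S\<close> with a multiple of the
component of \<open>phi\<close> whose index \<open>J S\<close> has initial segment of the same size as \<open>S\<close>; the empty set gives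
the constant.\<close>

lemma generating_function:
  fixes t :: real
  obtains d :: real and c :: "'n::{finite,wellorder} set \<Rightarrow> real" and J :: "'n set \<Rightarrow> 'n"
    where "\<And>x :: real^'n::_. (\<Prod>i\<in>UNIV. t - cos (pi * x $ i)) = d + (\<Sum>S | S \<noteq> {}. c S * phi x $ J S)"
proof -
  let ?P = "{\<sigma>. \<sigma> permutes (UNIV :: 'n set)}"
  have cP: "real (card ?P) \<noteq> 0" by (simp add: card_permutations)
  define J where "J S = (SOME j :: 'n. card {..j} = card S)" for S :: "'n set"
  have J: "card {..J S} = card S" if "S \<noteq> {}" for S
    unfolding J_def using exists_initial_segment_card[OF that] by (rule someI_ex)
  define c where "c S = (-1) ^ card S * t ^ card (- S) / real (card ?P)" for S :: "'n set"
  have "(\<Prod>i\<in>UNIV. t - cos (pi * x $ i)) = t ^ CARD('n) + (\<Sum>S | S \<noteq> {}. c S * phi x $ J S)" for x :: "real^'n::_"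
  proof -
    let ?y = "\<lambda>i. cos (pi * x $ i)"
    have expand: "(\<Prod>i\<in>UNIV. t - cos (pi * x $ i)) = (\<Sum>S\<in>UNIV. (-1) ^ card S * t ^ card (- S) * (\<Prod>i\<in>S. ?y (\<sigma> i)))"
      if "\<sigma> permutes UNIV" for \<sigma>
    proof -
      have "(\<Prod>i\<in>UNIV. t - ?y i) = (\<Prod>i\<in>UNIV. - ?y (\<sigma> i) + t)"
        by (subst prod.permute[OF that]) (simp add: comp_def)
      also have "\<dots> = (\<Sum>S\<in>Pow UNIV. (\<Prod>i\<in>S. - ?y (\<sigma> i)) * (\<Prod>i\<in>UNIV - S. t))"
        by (rule prod_add) simp
      also have "\<dots> = (\<Sum>S\<in>UNIV. (-1) ^ card S * t ^ card (- S) * (\<Prod>i\<in>S. ?y (\<sigma> i)))"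
        by (rule sum.cong) (auto simp: prod_uminus Compl_eq_Diff_UNIV)
      finally show ?thesis .
    qed
    have "real (card ?P) * (\<Prod>i\<in>UNIV. t - cos (pi * x $ i)) =
        (\<Sum>\<sigma>\<in>?P. \<Sum>S\<in>UNIV. (-1) ^ card S * t ^ card (- S) * (\<Prod>i\<in>S. ?y (\<sigma> i)))"
    proof -
      have "(\<Sum>\<sigma>\<in>?P. \<Sum>S\<in>UNIV. (-1) ^ card S * t ^ card (- S) * (\<Prod>i\<in>S. ?y (\<sigma> i))) =
          (\<Sum>\<sigma>\<in>?P. \<Prod>i\<in>UNIV. t - cos (pi * x $ i))"
        by (rule sum.cong[OF refl], rule expand[symmetric], simp)
      then show ?thesis by simp
    qed
    also have "\<dots> = (\<Sum>S\<in>UNIV. (-1) ^ card S * t ^ card (- S) * (\<Sum>\<sigma>\<in>?P. \<Prod>i\<in>S. ?y (\<sigma> i)))"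
      by (subst sum.swap) (simp add: sum_distrib_left)
    also have "\<dots> = t ^ CARD('n) * real (card ?P) +
        (\<Sum>S\<in>UNIV - {{}}. (-1) ^ card S * t ^ card (- S) * (\<Sum>\<sigma>\<in>?P. \<Prod>i\<in>S. ?y (\<sigma> i)))"
      by (subst sum.remove[of _ "{}"]) auto
    also have "(\<Sum>S\<in>UNIV - {{}}. (-1) ^ card S * t ^ card (- S) * (\<Sum>\<sigma>\<in>?P. \<Prod>i\<in>S. ?y (\<sigma> i))) =
        real (card ?P) * (\<Sum>S | S \<noteq> {}. c S * phi x $ J S)"
      unfolding sum_distrib_left[where r = "real (card ?P)"]
    proof (rule sum.cong)
      fix S :: "'n set" assume "S \<in> {S. S \<noteq> {}}"
      then have "(\<Sum>\<sigma>\<in>?P. \<Prod>i\<in>S. ?y (\<sigma> i)) = phi x $ J S"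
        unfolding phi_nth_eq by (intro sum_permutations_prod_card) (simp add: J)
      then show "(-1) ^ card S * t ^ card (- S) * (\<Sum>\<sigma>\<in>?P. \<Prod>i\<in>S. ?y (\<sigma> i)) =
          real (card ?P) * (c S * phi x $ J S)"
        using cP by (simp add: c_def)
    qed auto
    finally have "real (card ?P) * (\<Prod>i\<in>UNIV. t - cos (pi * x $ i)) =
        real (card ?P) * (t ^ CARD('n) + (\<Sum>S | S \<noteq> {}. c S * phi x $ J S))"
      by (simp only: distrib_left mult.commute)
    then show ?thesis by (rule mult_left_cancel[OF cP, THEN iffD1])
  qed
  then show ?thesis by (rule that)
qed

text \<open>Equal values of \<open>phi\<close> give equal polynomials \<open>\<Prod>i. t - y\<^sub>i\<close>, hence equal sets of roots; as \<open>cos\<close> is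
injective on \<open>[0, \<pi>]\<close> the two points have the same coordinates up to order, and both are sorted.\<close>

lemma inj_on_phi: "inj_on phi (open_simplex :: (real^'n::{finite,wellorder}) set)"
proof (rule inj_onI)
  fix x z :: "real^'n::_" assume x: "x \<in> open_simplex" and z: "z \<in> open_simplex" and eq: "phi x = phi z"
  have prod_eq: "(\<Prod>i\<in>UNIV. t - cos (pi * x $ i)) = (\<Prod>i\<in>UNIV. t - cos (pi * z $ i))" for t
  proof -
    obtain d c and J :: "'n set \<Rightarrow> 'n"
      where gen: "\<And>x :: real^'n::_. (\<Prod>i\<in>UNIV. t - cos (pi * x $ i)) = d + (\<Sum>S | S \<noteq> {}. c S * phi x $ J S)"
      using generating_function[of t] by blast
    show ?thesis unfolding gen eq ..
  qed
  have "\<exists>l. x $ i = z $ l" for i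
  proof -
    have "(\<Prod>l\<in>UNIV. cos (pi * x $ i) - cos (pi * x $ l)) = 0"
      by (rule prod_zero) auto
    then have "(\<Prod>l\<in>UNIV. cos (pi * x $ i) - cos (pi * z $ l)) = 0"
      using prod_eq by simp
    then obtain l where l: "cos (pi * x $ i) = cos (pi * z $ l)" by auto
    then show ?thesis using open_simplex_cos_inj[OF x z] by blast
  qed
  then obtain \<sigma> where \<sigma>: "\<And>i. x $ i = z $ \<sigma> i" by metis
  have "inj \<sigma>"
  proof (rule injI)
    fix i j assume "\<sigma> i = \<sigma> j"
    then have "x $ i = x $ j" by (simp add: \<sigma>)
    then show "i = j" by (rule open_simplex_coordinate_inj[OF x])
  qed
  then have "\<sigma> permutes UNIV" by (intro bij_imp_permutes) (auto simp: bij_def finite_UNIV_inj_surj)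
  then have "(\<lambda>i. x $ i) = (\<lambda>i. z $ i)"
    using \<sigma> open_simplex_antimono[OF x] open_simplex_antimono[OF z]
    by (intro antimono_permutation_unique[where \<sigma> = id and \<tau> = \<sigma>]) (auto simp: permutes_id)
  then show "x = z" by (simp add: vec_eq_iff fun_eq_iff)
qed

section \<open>The derivative of \<open>phi\<close>\<close>

text \<open>\<open>phi_factor j i\<close> is the partial derivative of the \<open>j\<close>-th component of \<open>phi\<close> in direction \<open>i\<close>,
without the factor \<open>- \<pi> sin (\<pi> x\<^sub>i)\<close>.  Splitting off the sine leaves a combination of products of
cosines.\<close>

definition phi_factor :: "'n \<Rightarrow> 'n \<Rightarrow> real^'n::{finite,wellorder} \<Rightarrow> real" where
  "phi_factor j i x = (\<Sum>\<sigma> | \<sigma> permutes UNIV.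
     (if \<sigma> i \<le> j then 1 else 0) * cos_prod (\<chi> l. if l \<noteq> i \<and> \<sigma> l \<le> j then 1 else 0) x)"

definition dphi :: "real^'n::{finite,wellorder} \<Rightarrow> real^'n::_ \<Rightarrow> real^'n::_" where
  "dphi x v = (\<chi> j. \<Sum>i\<in>UNIV. - pi * sin (pi * x $ i) * phi_factor j i x * v $ i)"

lemma has_derivative_cart:
  fixes f :: "'a::real_normed_vector \<Rightarrow> real^'n"
  assumes "\<And>i. ((\<lambda>x. f x $ i) has_derivative (\<lambda>v. f' v $ i)) (at x within S)"
  shows "(f has_derivative f') (at x within S)"
  using assms by (subst has_derivative_componentwise_within) (auto simp: Basis_vec_def inner_axis)

lemma has_derivative_vec_nth [derivative_intros]:
  "(f has_derivative f') F \<Longrightarrow> ((\<lambda>x. f x $ i) has_derivative (\<lambda>v. f' v $ i)) F"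
  by (rule bounded_linear.has_derivative[OF bounded_linear_vec_nth])

lemma has_derivative_add_const_left:
  "(f has_derivative f') F \<Longrightarrow> ((\<lambda>x. d + f x) has_derivative f') F"
  using has_derivative_add[OF has_derivative_const[of d]] by force

lemma has_derivative_phi:
  fixes x :: "real^'n::{finite,wellorder}"
  shows "(phi has_derivative dphi x) (at x within S)"
proof (rule has_derivative_cart)
  fix j :: 'n
  have "((\<lambda>x. cos_prod (\<chi> l. if \<sigma> l \<le> j then 1 else 0) x) has_derivative
     (\<lambda>v. \<Sum>i\<in>UNIV. - pi * sin (pi * x $ i) * ((if \<sigma> i \<le> j then 1 else 0) *
        cos_prod (\<chi> l. if l \<noteq> i \<and> \<sigma> l \<le> j then 1 else 0) x) * v $ i)) (at x within S)" for \<sigma> :: "'n \<Rightarrow> 'n"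
  proof -
    let ?w = "\<lambda>i. if \<sigma> i \<le> j then 1 else 0 :: real"
    have A: "((\<lambda>x. \<Prod>i\<in>UNIV. cos (pi * ?w i * x $ i)) has_derivative
       (\<lambda>v. \<Sum>i\<in>UNIV. (- sin (pi * ?w i * x $ i) * (pi * ?w i * v $ i)) *
           (\<Prod>l\<in>UNIV - {i}. cos (pi * ?w l * x $ l)))) (at x within S)"
      by (intro has_derivative_prod) (auto intro!: derivative_eq_intros)
    have B: "(- sin (pi * ?w i * x $ i) * (pi * ?w i * v $ i)) * (\<Prod>l\<in>UNIV - {i}. cos (pi * ?w l * x $ l))
       = - pi * sin (pi * x $ i) * (?w i * cos_prod (\<chi> l. if l \<noteq> i \<and> \<sigma> l \<le> j then 1 else 0) x) * v $ i" for v i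
    proof -
      have "cos_prod (\<chi> l. if l \<noteq> i \<and> \<sigma> l \<le> j then 1 else 0) x =
          (\<Prod>l\<in>UNIV - {i}. cos (pi * (if l \<noteq> i \<and> \<sigma> l \<le> j then 1 else 0) * x $ l))"
        unfolding cos_prod_def by (subst prod.remove[of UNIV i]) auto
      also have "\<dots> = (\<Prod>l\<in>UNIV - {i}. cos (pi * ?w l * x $ l))"
        by (rule prod.cong) auto
      finally show ?thesis by simp
    qed
    show ?thesis using A unfolding B by (simp only: cos_prod_def vec_lambda_beta)
  qed
  then have "((\<lambda>x. \<Sum>\<sigma> | \<sigma> permutes (UNIV :: 'n set). cos_prod (\<chi> l. if \<sigma> l \<le> j then 1 else 0) x) has_derivative
     (\<lambda>v. \<Sum>\<sigma> | \<sigma> permutes (UNIV :: 'n set). \<Sum>i\<in>UNIV. - pi * sin (pi * x $ i) * ((if \<sigma> i \<le> j then 1 else 0) *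
        cos_prod (\<chi> l. if l \<noteq> i \<and> \<sigma> l \<le> j then 1 else 0) x) * v $ i)) (at x within S)"
    by (intro has_derivative_sum)
  moreover have "(\<Sum>\<sigma> | \<sigma> permutes (UNIV :: 'n set). cos_prod (\<chi> l. if \<sigma> l \<le> j then 1 else 0) x) = phi x $ j" for x
    by (simp add: phi_def cos_plus_def cos_prod_def)
  moreover have "(\<Sum>\<sigma> | \<sigma> permutes (UNIV :: 'n set). \<Sum>i\<in>UNIV. - pi * sin (pi * x $ i) * ((if \<sigma> i \<le> j then 1 else 0) *
        cos_prod (\<chi> l. if l \<noteq> i \<and> \<sigma> l \<le> j then 1 else 0) x) * v $ i) = dphi x v $ j" for v
    unfolding dphi_def phi_factor_def
    by (subst sum.swap) (simp add: sum_distrib_left sum_distrib_right)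
  ultimately show "((\<lambda>x. phi x $ j) has_derivative (\<lambda>v. dphi x v $ j)) (at x within S)" by simp
qed

lemma continuous_on_phi: "continuous_on S phi"
  by (rule has_derivative_continuous_on[OF has_derivative_phi])

lemma J_det_eq_dphi: "J_det x = det (matrix (dphi x))"
  unfolding J_det_def jacobian_def frechet_derivative_at[OF has_derivative_phi, symmetric] ..

lemma J_det_eq: "J_det x = (\<Prod>i\<in>UNIV. - pi * sin (pi * x $ i)) * det (\<chi> i j. phi_factor j i x)"
proof -
  have "J_det x = det (transpose (matrix (dphi x)))" by (simp add: J_det_eq_dphi det_transpose)
  also have "transpose (matrix (dphi x)) = (\<chi> i. (- pi * sin (pi * x $ i)) *s (\<chi> j. phi_factor j i x))"
    by (auto simp: vec_eq_iff transpose_def matrix_def dphi_def axis_def if_distrib cong: if_cong)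
  also have "det \<dots> = (\<Prod>i\<in>UNIV. - pi * sin (pi * x $ i)) * det (\<chi> i j. phi_factor j i x)"
    by (rule det_rows_mul)
  finally show ?thesis .
qed

lemma linear_dphi: "linear (dphi x)"
  using has_derivative_phi[of x UNIV] by (rule has_derivative_linear)

text \<open>Differentiate \<open>generating_function\<close> in a direction \<open>v\<close> in the kernel of the derivative of \<open>phi\<close>: the
right-hand side gives \<open>0\<close>.  At \<open>t = y\<^sub>i\<close> the only surviving term of the product rule on the left is
\<open>\<pi> sin (\<pi> x\<^sub>i) v\<^sub>i\<close> times the product of the nonzero differences \<open>y\<^sub>i - y\<^sub>m\<close>, so \<open>v\<^sub>i = 0\<close>.\<close>

lemma J_det_nonzero:
  fixes x :: "real^'n::{finite,wellorder}"
  assumes x: "x \<in> open_simplex"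
  shows "J_det x \<noteq> 0"
proof -
  have "v = 0" if v: "dphi x v = 0" for v
  proof -
    have "v $ i = 0" for i
    proof -
      let ?t = "cos (pi * x $ i)"
      obtain d c and J :: "'n set \<Rightarrow> 'n"
        where gen: "\<And>x :: real^'n::_. (\<Prod>i\<in>UNIV. ?t - cos (pi * x $ i)) = d + (\<Sum>S | S \<noteq> {}. c S * phi x $ J S)"
        using generating_function[of ?t] by blast
      have "((\<lambda>x :: real^'n::_. \<Prod>l\<in>UNIV. ?t - cos (pi * x $ l)) has_derivative
         (\<lambda>v. \<Sum>l\<in>UNIV. (sin (pi * x $ l) * (pi * v $ l)) * (\<Prod>m\<in>UNIV - {l}. ?t - cos (pi * x $ m)))) (at x)"
        by (intro has_derivative_prod) (auto intro!: derivative_eq_intros)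
      moreover have "((\<lambda>x :: real^'n::_. \<Prod>l\<in>UNIV. ?t - cos (pi * x $ l)) has_derivative
         (\<lambda>v. \<Sum>S | S \<noteq> {}. c S * dphi x v $ J S)) (at x)"
        unfolding gen
        by (intro has_derivative_add_const_left has_derivative_sum has_derivative_mult_right has_derivative_vec_nth has_derivative_phi)
      ultimately have eqd: "(\<lambda>v. \<Sum>l\<in>UNIV. (sin (pi * x $ l) * (pi * v $ l)) * (\<Prod>m\<in>UNIV - {l}. ?t - cos (pi * x $ m))) =
          (\<lambda>v. \<Sum>S | S \<noteq> {}. c S * dphi x v $ J S)"
        by (rule has_derivative_unique)
      then have "(\<Sum>l\<in>UNIV. (sin (pi * x $ l) * (pi * v $ l)) * (\<Prod>m\<in>UNIV - {l}. ?t - cos (pi * x $ m))) = 0"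
        using fun_cong[OF eqd, of v] v by simp
      moreover have "(\<Sum>l\<in>UNIV. (sin (pi * x $ l) * (pi * v $ l)) * (\<Prod>m\<in>UNIV - {l}. ?t - cos (pi * x $ m))) =
          (\<Sum>l\<in>{i}. (sin (pi * x $ l) * (pi * v $ l)) * (\<Prod>m\<in>UNIV - {l}. ?t - cos (pi * x $ m)))"
      proof (rule sum.mono_neutral_right)
        show "\<forall>l\<in>UNIV - {i}. (sin (pi * x $ l) * (pi * v $ l)) * (\<Prod>m\<in>UNIV - {l}. ?t - cos (pi * x $ m)) = 0"
          by auto
      qed auto
      ultimately have z: "(sin (pi * x $ i) * (pi * v $ i)) * (\<Prod>m\<in>UNIV - {i}. ?t - cos (pi * x $ m)) = 0"
        by simp
      have "0 < sin (pi * x $ i)" using x by (intro sin_gt_zero) (auto simp: open_simplex_def)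
      moreover have "?t - cos (pi * x $ m) \<noteq> 0" if "m \<noteq> i" for m
      proof
        assume "?t - cos (pi * x $ m) = 0"
        then have "x $ i = x $ m" by (intro open_simplex_cos_inj[OF x x]) simp
        then have "i = m" by (rule open_simplex_coordinate_inj[OF x])
        with that show False by simp
      qed
      then have "(\<Prod>m\<in>UNIV - {i}. ?t - cos (pi * x $ m)) \<noteq> 0" by (simp add: prod_zero_iff)
      ultimately show ?thesis using z by auto
    qed
    then show "v = 0" by (simp add: vec_eq_iff)
  qed
  then have "inj (dphi x)" using linear_injective_0[OF linear_dphi] by blast
  then show ?thesis by (simp add: J_det_eq_dphi det_nz_iff_inj[OF linear_dphi])
qed

lemma open_phi_image: "open (phi ` (open_simplex :: (real^'n::{finite,wellorder}) set))"
  by (rule invariance_of_domain[OF continuous_on_phi open_open_simplex inj_on_phi])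

lemma abs_det_matrix_permv:
  fixes \<sigma> :: "'n::{finite,wellorder} \<Rightarrow> 'n"
  assumes \<sigma>: "\<sigma> permutes UNIV"
  shows "\<bar>det (matrix (permv \<sigma> :: real^'n::_ \<Rightarrow> real^'n::_))\<bar> = 1"
proof -
  have "matrix (permv \<sigma> :: real^'n::_ \<Rightarrow> real^'n::_) = (\<chi> i. mat 1 $ \<sigma> i)"
    by (auto simp: vec_eq_iff matrix_def mat_def axis_def)
  then have "det (matrix (permv \<sigma> :: real^'n::_ \<Rightarrow> real^'n::_)) = of_int (sign \<sigma>)"
    using det_permute_rows[OF \<sigma>, of "mat 1 :: (real^'n::_)^'n::_"] by simp
  then show ?thesis by (simp add: sign_def)
qed

lemma linear_permv: "linear (permv \<sigma> :: real^'n \<Rightarrow> real^'n)"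
  by (auto simp: linear_iff vec_eq_iff)

text \<open>The chain rule for \<open>phi \<circ> permv \<sigma> = phi\<close>: the Jacobian changes by the determinant \<open>\<plusminus>1\<close> of a
permutation matrix.\<close>

lemma J_det_permv_square:
  assumes \<sigma>: "\<sigma> permutes UNIV"
  shows "(J_det (permv \<sigma> x))\<^sup>2 = (J_det (x :: real^'n::{finite,wellorder}))\<^sup>2"
proof -
  let ?p = "permv \<sigma> :: real^'n::_ \<Rightarrow> real^'n::_"
  note lin = linear_permv[of \<sigma>]
  have "(phi \<circ> ?p has_derivative dphi (?p x) \<circ> ?p) (at x)"
    by (rule diff_chain_at[OF linear_imp_has_derivative[OF lin] has_derivative_phi])
  moreover have "phi \<circ> ?p = phi" by (auto simp: phi_permv[OF \<sigma>])
  ultimately have "dphi (?p x) \<circ> ?p = dphi x"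
    using has_derivative_unique[OF _ has_derivative_phi] by metis
  then have "J_det x = J_det (?p x) * det (matrix ?p)"
    unfolding J_det_eq_dphi by (metis det_mul matrix_compose lin linear_dphi)
  moreover have "(det (matrix ?p))\<^sup>2 = 1"
    using abs_det_matrix_permv[OF \<sigma>] by (metis one_power2 power2_abs)
  ultimately show ?thesis by (simp add: power_mult_distrib)
qed

section \<open>Polynomials as functions\<close>

definition eval_monom :: "('n \<Rightarrow>\<^sub>0 nat) \<Rightarrow> real^'n::finite \<Rightarrow> real" where
  "eval_monom m x = (\<Prod>i\<in>UNIV. x $ i ^ Poly_Mapping.lookup m i)"

lemma eval_mpoly_superset:
  assumes "finite A" "Poly_Mapping.keys p \<subseteq> A"
  shows "eval_mpoly p x = (\<Sum>m\<in>A. Poly_Mapping.lookup p m * eval_monom m x)"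
  unfolding eval_mpoly_def eval_monom_def
  by (rule sum.mono_neutral_left) (use assms in \<open>auto simp: in_keys_iff\<close>)

lemma eval_mpoly_add: "eval_mpoly (p + q) x = eval_mpoly p x + eval_mpoly q x"
proof -
  let ?A = "Poly_Mapping.keys p \<union> Poly_Mapping.keys q"
  have "Poly_Mapping.keys (p + q) \<subseteq> ?A" by (rule Poly_Mapping.keys_add)
  then show ?thesis
    by (simp add: eval_mpoly_superset[of ?A] lookup_add algebra_simps sum.distrib)
qed

lemma lookup_scale_mpoly: "Poly_Mapping.lookup (scale_mpoly c p) m = c * Poly_Mapping.lookup p m"
  unfolding scale_mpoly_def mult_map_scale_conv_mult[symmetric] by (simp add: map.rep_eq when_def)

lemma eval_mpoly_scale: "eval_mpoly (scale_mpoly c p) x = c * eval_mpoly p x"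
proof -
  have "Poly_Mapping.keys (scale_mpoly c p) \<subseteq> Poly_Mapping.keys p"
    by (auto simp: in_keys_iff lookup_scale_mpoly)
  then show ?thesis
    by (simp add: eval_mpoly_superset[of "Poly_Mapping.keys p"] lookup_scale_mpoly sum_distrib_left algebra_simps)
qed

lemma eval_mpoly_zero [simp]: "eval_mpoly 0 x = 0"
  by (simp add: eval_mpoly_def)

lemma eval_mpoly_single: "eval_mpoly (Poly_Mapping.single m c) x = c * eval_monom m x"
  by (subst eval_mpoly_superset[of "{m}"]) auto

lemma eval_mpoly_diff: "eval_mpoly (p - q) x = eval_mpoly p x - eval_mpoly q x"
  using eval_mpoly_add[of "p - q" q x] by simp

lemma continuous_on_eval_mpoly [continuous_intros]:
  "continuous_on S f \<Longrightarrow> continuous_on S (\<lambda>x. eval_mpoly p (f x))"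
  unfolding eval_mpoly_def by (intro continuous_intros)

text \<open>Induction on the set of variables: for fixed values of the other variables the sum is a univariate
polynomial in the new one with infinitely many roots, so its coefficients vanish, and these are sums
of the same kind over fewer variables.  That the exponents are distinguished by their values
on \<open>I\<close> is preserved when the exponent of the new variable is fixed.\<close>

lemma monomials_independent_on_grid:
  fixes c :: "('i \<Rightarrow> nat) \<Rightarrow> real" and A :: "'i \<Rightarrow> real set"
  assumes "finite I" "finite S" "\<And>i. i \<in> I \<Longrightarrow> infinite (A i)"
    and "\<And>m m'. m \<in> S \<Longrightarrow> m' \<in> S \<Longrightarrow> (\<And>i. i \<in> I \<Longrightarrow> m i = m' i) \<Longrightarrow> m = m'"
    and "\<And>y. (\<And>i. i \<in> I \<Longrightarrow> y i \<in> A i) \<Longrightarrow> (\<Sum>m\<in>S. c m * (\<Prod>i\<in>I. y i ^ m i)) = 0"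
    and "m \<in> S"
  shows "c m = 0"
  using assms
proof (induction I arbitrary: S m rule: finite_induct)
  case empty
  then have "S = {m}" by auto
  with empty show ?case by simp
next
  case (insert a I)
  let ?S = "{m' \<in> S. m' a = m a}"
  show ?case
  proof (rule insert.IH[of ?S])
    show "finite ?S" using insert.prems by simp
    show "infinite (A i)" if "i \<in> I" for i using insert.prems that by simp
    show "m \<in> ?S" using insert.prems by simp
    show "m1 = m2" if "m1 \<in> ?S" "m2 \<in> ?S" "\<And>i. i \<in> I \<Longrightarrow> m1 i = m2 i" for m1 m2
      using that by (intro insert.prems(3)) auto
    show "(\<Sum>m'\<in>?S. c m' * (\<Prod>i\<in>I. y i ^ m' i)) = 0" if y: "\<And>i. i \<in> I \<Longrightarrow> y i \<in> A i" for y
    proof -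
      define q where "q = (\<Sum>m'\<in>S. monom (c m' * (\<Prod>i\<in>I. y i ^ m' i)) (m' a))"
      have "poly q t = 0" if "t \<in> A a" for t
      proof -
        have "(\<Sum>m'\<in>S. c m' * (\<Prod>i\<in>insert a I. (y(a := t)) i ^ m' i)) = 0"
          using that y insert.hyps by (intro insert.prems(4)) auto
        moreover have "(\<Prod>i\<in>insert a I. (y(a := t)) i ^ m' i) = t ^ m' a * (\<Prod>i\<in>I. y i ^ m' i)" for m'
        proof -
          have "(\<Prod>i\<in>I. (y(a := t)) i ^ m' i) = (\<Prod>i\<in>I. y i ^ m' i)"
            using insert.hyps by (intro prod.cong) auto
          then show ?thesis using insert.hyps by simp
        qed
        ultimately show ?thesis by (simp add: q_def poly_sum poly_monom algebra_simps)
      qed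
      then have "infinite {t. poly q t = 0}"
        using insert.prems(2)[of a] by (metis (mono_tags, lifting) infinite_super insertI1 mem_Collect_eq subsetI)
      then have "q = 0" using poly_roots_finite by blast
      then have "0 = coeff q (m a)" by simp
      also have "\<dots> = (\<Sum>m'\<in>S. if m' a = m a then c m' * (\<Prod>i\<in>I. y i ^ m' i) else 0)"
        by (simp add: q_def coeff_sum)
      also have "\<dots> = (\<Sum>m'\<in>?S. c m' * (\<Prod>i\<in>I. y i ^ m' i))"
        using insert.prems(1) by (simp add: sum.inter_filter)
      finally show ?thesis by simp
    qed
  qed
qed

lemma mpoly_eq_zero_on_open:
  fixes p :: "'n::finite real_mpoly"
  assumes "open U" "U \<noteq> {}" and zero: "\<And>x. x \<in> U \<Longrightarrow> eval_mpoly p x = 0"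
  shows "p = 0"
proof (rule ccontr)
  assume "p \<noteq> 0"
  then obtain m where m: "m \<in> Poly_Mapping.keys p" using keys_eq_empty[of p] by blast
  obtain x e where e: "e > 0" "ball x e \<subseteq> U" "x \<in> U"
    using assms(1,2) by (meson ex_in_conv open_contains_ball)
  obtain a b where ab: "x \<in> box a b" "box a b \<subseteq> ball x e"
    using rational_boxes[OF e(1), of x] by blast
  let ?A = "\<lambda>i. {a $ i <..< b $ i}" and ?S = "Poly_Mapping.lookup ` Poly_Mapping.keys p"
  \<comment> \<open>the same coefficients, indexed by plain functions\<close>
  define c where "c f = Poly_Mapping.lookup p (Poly_Mapping.Abs_poly_mapping f)" for f
  have "c (Poly_Mapping.lookup m) = 0"
  proof (rule monomials_independent_on_grid[of UNIV ?S ?A])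
    show "infinite (?A i)" for i
      using ab(1) by (auto simp: mem_box_cart infinite_Ioo intro: less_trans)
    show "(\<Sum>f\<in>?S. c f * (\<Prod>i\<in>UNIV. y i ^ f i)) = 0" if y: "\<And>i. i \<in> UNIV \<Longrightarrow> y i \<in> ?A i" for y
    proof -
      have "(\<chi> i. y i) \<in> box a b" using y by (auto simp: mem_box_cart)
      then have "eval_mpoly p (\<chi> i. y i) = 0" using ab e by (intro zero) blast
      then show ?thesis
        by (subst sum.reindex)
           (auto simp: inj_on_def poly_mapping_eqI c_def eval_mpoly_def lookup_inverse)
    qed
  qed (use m in auto)
  then show False using m by (simp add: c_def lookup_inverse in_keys_iff)
qed

lemma mpoly_eqI_phi:
  fixes p q :: "'n::{finite,wellorder} real_mpoly"
  assumes "\<And>x. x \<in> open_simplex \<Longrightarrow> eval_mpoly p (phi x) = eval_mpoly q (phi x)"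
  shows "p = q"
proof -
  have "p - q = 0"
    by (rule mpoly_eq_zero_on_open[OF open_phi_image]) (use assms open_simplex_nonempty in \<open>auto simp: eval_mpoly_diff\<close>)
  then show ?thesis by simp
qed

section \<open>Counting dominant weights and monomials\<close>

definition exponents_upto :: "nat \<Rightarrow> ('n::finite \<Rightarrow>\<^sub>0 nat) set" where
  "exponents_upto N = {m. (\<Sum>i\<in>UNIV. Poly_Mapping.lookup m i) \<le> N}"

lemma lookup_Abs_finite: "Poly_Mapping.lookup (Poly_Mapping.Abs_poly_mapping f) = (f :: 'n::finite \<Rightarrow> nat)"
  by (rule lookup_Abs_poly_mapping) simp

lemma finite_exponents_upto: "finite (exponents_upto N :: ('n::finite \<Rightarrow>\<^sub>0 nat) set)"
proof -
  have "Poly_Mapping.lookup ` (exponents_upto N :: ('n \<Rightarrow>\<^sub>0 nat) set) \<subseteq> PiE UNIV (\<lambda>_. {..N})"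
  proof -
    have "Poly_Mapping.lookup m i \<le> N" if "m \<in> exponents_upto N" for m :: "'n \<Rightarrow>\<^sub>0 nat" and i
      using that member_le_sum[of i UNIV "Poly_Mapping.lookup m"] by (simp add: exponents_upto_def)
    then show ?thesis by auto
  qed
  then have "finite (Poly_Mapping.lookup ` (exponents_upto N :: ('n \<Rightarrow>\<^sub>0 nat) set))"
    by (rule finite_subset) (intro finite_PiE, auto)
  then show ?thesis by (rule finite_imageD) (simp add: inj_on_def poly_mapping_eqI)
qed

lemma P_plus_upto_bounds:
  assumes "k \<in> P_plus_upto N"
  obtains q where "k $ i = real q" "q \<le> N"
proof -
  have "k $ i \<in> \<int>" "0 \<le> k $ i" "k $ i \<le> real N"
    using assms by (auto simp: P_plus_upto_def P_plus_def)
  then obtain z where "k $ i = of_int z" "0 \<le> z" "z \<le> int N"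
    by (auto elim!: Ints_cases)
  then show thesis by (intro that[of "nat z"]) auto
qed

text \<open>The partition conjugate to \<open>k\<close>, written with multiplicities: the exponent of the \<open>j\<close>-th variable
counts the columns of length \<open>j\<close> of the Young diagram of \<open>k\<close>.\<close>

definition conjugate_exponent :: "nat \<Rightarrow> real^'n::{finite,wellorder} \<Rightarrow> 'n \<Rightarrow>\<^sub>0 nat" where
  "conjugate_exponent N k = Poly_Mapping.Abs_poly_mapping (\<lambda>j. card {c \<in> {1..N}. {i. real c \<le> k $ i} = {..j}})"

lemma lookup_conjugate_exponent:
  "Poly_Mapping.lookup (conjugate_exponent N k) j = card {c \<in> {1..N}. {i. real c \<le> k $ i} = {..j}}"
  unfolding conjugate_exponent_def lookup_Abs_finite ..

lemma conjugate_exponent_in: "conjugate_exponent N k \<in> exponents_upto N"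
proof -
  have "(\<Sum>j\<in>UNIV. card {c \<in> {1..N}. {i. real c \<le> k $ i} = {..j}}) =
      card (\<Union>j\<in>UNIV. {c \<in> {1..N}. {i. real c \<le> k $ i} = {..j}})"
    by (rule card_UN_disjoint[symmetric]) auto
  also have "\<dots> \<le> card {1..N}" by (rule card_mono) auto
  finally show ?thesis by (simp add: exponents_upto_def lookup_conjugate_exponent)
qed

lemma nth_eq_sum_conjugate_exponent:
  assumes k: "k \<in> P_plus_upto N"
  shows "k $ i = real (\<Sum>j\<in>{i..}. Poly_Mapping.lookup (conjugate_exponent N k) j)"
proof -
  obtain q where q: "k $ i = real q" "q \<le> N" using P_plus_upto_bounds[OF k] .
  have "{c \<in> {1..N}. real c \<le> k $ i} = {1..q}" using q by auto
  moreover have "{c \<in> {1..N}. real c \<le> k $ i} = (\<Union>j\<in>{i..}. {c \<in> {1..N}. {i. real c \<le> k $ i} = {..j}})"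
  proof (intro equalityI subsetI)
    fix c assume c: "c \<in> {c \<in> {1..N}. real c \<le> k $ i}"
    let ?L = "{i. real c \<le> k $ i}"
    have i: "i \<in> ?L" using c by simp
    have Max: "Max ?L \<in> ?L" using i by (intro Max_in) auto
    have "?L = {..Max ?L}"
    proof (intro equalityI subsetI)
      fix l assume "l \<in> ?L" then show "l \<in> {..Max ?L}" by simp
    next
      fix l assume "l \<in> {..Max ?L}"
      then have "k $ Max ?L \<le> k $ l" using k unfolding P_plus_upto_def P_plus_def by blast
      with Max show "l \<in> ?L" by simp
    qed
    moreover have "i \<le> Max ?L" using i by simp
    ultimately show "c \<in> (\<Union>j\<in>{i..}. {c \<in> {1..N}. {i. real c \<le> k $ i} = {..j}})" using c by blast
  next
    fix c assume "c \<in> (\<Union>j\<in>{i..}. {c \<in> {1..N}. {i. real c \<le> k $ i} = {..j}})"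
    then obtain j where "i \<le> j" "c \<in> {1..N}" "{i. real c \<le> k $ i} = {..j}" by auto
    then have "i \<in> {i. real c \<le> k $ i}" by simp
    with \<open>c \<in> {1..N}\<close> show "c \<in> {c \<in> {1..N}. real c \<le> k $ i}" by simp
  qed
  ultimately have "{1..q} = (\<Union>j\<in>{i..}. {c \<in> {1..N}. {i. real c \<le> k $ i} = {..j}})" by metis
  then have "q = card (\<Union>j\<in>{i..}. {c \<in> {1..N}. {i. real c \<le> k $ i} = {..j}})"
    by (metis card_atLeastAtMost diff_Suc_1)
  also have "\<dots> = (\<Sum>j\<in>{i..}. card {c \<in> {1..N}. {i. real c \<le> k $ i} = {..j}})"
    by (rule card_UN_disjoint) auto
  finally show ?thesis using q by (simp add: lookup_conjugate_exponent)
qed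

lemma inj_on_conjugate_exponent: "inj_on (conjugate_exponent N) (P_plus_upto N)"
  by (intro inj_onI) (simp add: vec_eq_iff nth_eq_sum_conjugate_exponent)

lemma finite_P_plus_upto: "finite (P_plus_upto N)"
  by (rule inj_on_finite[OF inj_on_conjugate_exponent _ finite_exponents_upto[of N]])
     (auto simp: conjugate_exponent_in)

lemma card_P_plus_upto_le: "card (P_plus_upto N :: (real^'n::{finite,wellorder}) set) \<le> card (exponents_upto N :: ('n \<Rightarrow>\<^sub>0 nat) set)"
  by (rule card_inj_on_le[OF inj_on_conjugate_exponent _ finite_exponents_upto])
     (auto simp: conjugate_exponent_in)

text \<open>An independent set inside the span of \<open>T\<close> with at least as many elements as \<open>T\<close> spans it.\<close>

lemma span_eq_by_dimension:
  assumes "finite T" "fs.independent B" "B \<subseteq> fs.span T" "card T \<le> card B"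
  shows "T \<subseteq> fs.span B"
proof
  fix v assume v: "v \<in> T"
  show "v \<in> fs.span B"
  proof (rule ccontr)
    assume nv: "v \<notin> fs.span B"
    have fin: "finite B" using fs.independent_span_bound[OF assms(1-3)] by simp
    have "insert v B \<subseteq> fs.span T" using assms(3) v by (auto intro: fs.span_base)
    then have "card (insert v B) \<le> card T"
      using fs.independent_span_bound[OF assms(1) fs.independent_insertI[OF nv assms(2)]] by simp
    moreover have "v \<notin> B" using nv by (auto intro: fs.span_base)
    ultimately show False using assms(4) fin by simp
  qed
qed

section \<open>Cosine sums as polynomials in \<open>phi\<close>\<close>

lemma weight_box_mono: "M \<le> N \<Longrightarrow> weight_box r0 M \<subseteq> weight_box r0 N"
  unfolding weight_box_def by (blast intro: order_trans)

lemma span_weight_box_mult: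
  fixes f g :: "real^'n \<Rightarrow> real"
  assumes "f \<in> fs.span (cos_prod ` weight_box r0 M)" "g \<in> fs.span (cos_prod ` weight_box 0 N)"
  shows "f * g \<in> fs.span (cos_prod ` weight_box r0 (M + N))"
proof (rule span_cos_prod_mult[OF assms])
  fix a b e :: "real^'n"
  assume a: "a \<in> weight_box r0 M" and b: "b \<in> weight_box 0 N"
    and e: "\<And>i. e $ i = a $ i + b $ i \<or> e $ i = a $ i - b $ i"
  show "e \<in> weight_box r0 (M + N)"
    unfolding weight_box_def
  proof (intro CollectI allI conjI)
    fix i
    have ab: "a $ i - r0 \<in> \<int>" "\<bar>a $ i\<bar> \<le> M" "b $ i \<in> \<int>" "\<bar>b $ i\<bar> \<le> N"
      using a b by (auto simp: weight_box_def)
    have eq: "a $ i + b $ i - r0 = (a $ i - r0) + b $ i" "a $ i - b $ i - r0 = (a $ i - r0) - b $ i" by auto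
    show "e $ i - r0 \<in> \<int>" using e[of i] ab by (metis eq Ints_add Ints_diff)
    show "\<bar>e $ i\<bar> \<le> M + N" using e[of i] ab by linarith
  qed
qed

lemma phi_nth_in_span: "(\<lambda>x :: real^'n::{finite,wellorder}. phi x $ j) \<in> fs.span (cos_prod ` weight_box 0 1)"
proof -
  let ?w = "\<chi> i. (if i \<le> j then 1 else 0 :: real)"
  have "(\<lambda>x :: real^'n::_. phi x $ j) = (\<Sum>\<sigma> | \<sigma> permutes (UNIV :: 'n set). cos_prod (permv \<sigma> ?w))"
    by (auto simp: fun_eq_iff fscale_apply phi_def cos_plus_def cos_prod_def sum_fun_apply fscale_apply)
  also have "\<dots> \<in> fs.span (cos_prod ` weight_box 0 1)"
    by (intro fs.span_sum fs.span_base imageI) (auto simp: weight_box_def)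
  finally show ?thesis .
qed

text \<open>The function \<open>X\<^sup>m \<circ> phi\<close> times the denominator \<open>d\<close>.\<close>

definition monom_fun :: "(real^'n::{finite,wellorder} \<Rightarrow> real) \<Rightarrow> ('n \<Rightarrow>\<^sub>0 nat) \<Rightarrow> real^'n::_ \<Rightarrow> real" where
  "monom_fun d m = (\<lambda>x. eval_monom m (phi x) * d x)"

text \<open>Every factor \<open>X\<^sub>i \<circ> phi\<close> has frequencies of absolute value at most \<open>1\<close>, so it raises the bound on the
frequencies by at most one.\<close>

lemma monom_fun_in_span:
  fixes d :: "real^'n::{finite,wellorder} \<Rightarrow> real"
  assumes d: "d \<in> fs.span (cos_prod ` weight_box r0 M)"
  shows "monom_fun d m \<in> fs.span (cos_prod ` weight_box r0 (M + real (\<Sum>i\<in>UNIV. Poly_Mapping.lookup m i)))"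
proof -
  let ?X = "\<lambda>i (x :: real^'n::_). phi x $ i"
  have pow: "(\<lambda>x. ?X i x ^ e * f x) \<in> fs.span (cos_prod ` weight_box r0 (L + real e))"
    if f: "f \<in> fs.span (cos_prod ` weight_box r0 L)" for f L e i
  proof (induction e)
    case 0
    then show ?case using f unfolding power_0 mult_1_left of_nat_0 add_0_right .
  next
    case (Suc e)
    have "(\<lambda>x. ?X i x ^ e * f x) * ?X i \<in> fs.span (cos_prod ` weight_box r0 (L + real e + 1))"
      by (rule span_weight_box_mult[OF Suc.IH phi_nth_in_span])
    also have "(\<lambda>x. ?X i x ^ e * f x) * ?X i = (\<lambda>x. ?X i x ^ Suc e * f x)"
      by (auto simp: fun_eq_iff fscale_apply algebra_simps)
    finally show ?case by (simp add: algebra_simps)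
  qed
  have "(\<lambda>x. (\<Prod>i\<in>I. ?X i x ^ Poly_Mapping.lookup m i) * d x)
     \<in> fs.span (cos_prod ` weight_box r0 (M + real (\<Sum>i\<in>I. Poly_Mapping.lookup m i)))" if "finite I" for I
    using that
  proof induction
    case empty
    then show ?case using d by simp
  next
    case (insert a I)
    from pow[OF insert.IH, of a "Poly_Mapping.lookup m a"] insert.hyps show ?case
      by (simp add: algebra_simps)
  qed
  from this[of UNIV] show ?thesis by (simp add: monom_fun_def eval_monom_def)
qed

lemma eval_mpoly_in_span: "(\<lambda>x. eval_mpoly p (phi x) * d x) \<in> fs.span (range (monom_fun d))"
proof -
  have "(\<lambda>x. eval_mpoly p (phi x) * d x) =
      (\<Sum>m\<in>Poly_Mapping.keys p. fscale (Poly_Mapping.lookup p m) (monom_fun d m))"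
    by (rule ext)
       (simp add: eval_mpoly_superset[of "Poly_Mapping.keys p"] sum_fun_apply fscale_apply monom_fun_def sum_distrib_right mult.assoc)
  also have "\<dots> \<in> fs.span (range (monom_fun d))"
    by (intro fs.span_sum fs.span_scale fs.span_base) auto
  finally show ?thesis .
qed

lemma span_monom_fun_eval:
  assumes "f \<in> fs.span (range (monom_fun d))"
  shows "\<exists>p. \<forall>x. f x = eval_mpoly p (phi x) * d x"
  using assms
proof (induction rule: fs.span_induct_alt)
  case base
  show ?case by (intro exI[of _ 0]) simp
next
  case (step c f g)
  then obtain m p where "f = monom_fun d m" "\<forall>x. g x = eval_mpoly p (phi x) * d x" by auto
  then show ?case
    by (intro exI[of _ "Poly_Mapping.single m c + p"])
       (simp add: fscale_apply eval_mpoly_add eval_mpoly_single monom_fun_def algebra_simps)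
qed

text \<open>The denominator is a separate parameter because for the first family it is the constant \<open>1\<close>, whereas
the cosine sum at \<open>k = 0\<close> is \<open>n!\<close>.\<close>

locale polynomial_family = cosine_family s r0 r
  for s :: "('n::{finite,wellorder} \<Rightarrow> 'n) \<Rightarrow> real" and r0 and r :: "real^'n::_" +
  fixes d :: "real^'n::_ \<Rightarrow> real"
  assumes d_span: "d \<in> fs.span (cos_prod ` weight_box r0 (r $ first_index))"
    and d_permv: "\<sigma> permutes UNIV \<Longrightarrow> d (permv \<sigma> x) = s \<sigma> * d x"
    and d_nonzero: "x \<in> open_simplex \<Longrightarrow> d x \<noteq> 0"
begin

definition numerator :: "real^'n::_ \<Rightarrow> real^'n::_ \<Rightarrow> real" where
  "numerator k = cos_sym s (k + r)"

lemma monom_fun_in_span_numerator: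
  assumes "m \<in> exponents_upto N"
  shows "monom_fun d m \<in> fs.span (numerator ` P_plus_upto N)"
proof -
  let ?L = "r $ first_index + real (\<Sum>i\<in>UNIV. Poly_Mapping.lookup m i)"
  have "monom_fun d m \<in> fs.span (cos_sym s ` weight_box r0 ?L)"
    by (rule symmetric_in_span_cos_sym[OF monom_fun_in_span[OF d_span]])
       (simp add: monom_fun_def phi_permv d_permv)
  also have "fs.span (cos_sym s ` weight_box r0 ?L) \<subseteq> fs.span (numerator ` P_plus_upto N)"
  proof (rule fs.span_minimal[OF _ fs.subspace_span])
    have "?L \<le> real N + r $ first_index" using assms unfolding exponents_upto_def by (metis add.commute add_le_cancel_left mem_Collect_eq of_nat_le_iff)
    from weight_box_mono[OF this, of r0] show "cos_sym s ` weight_box r0 ?L \<subseteq> fs.span (numerator ` P_plus_upto N)"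
      using cos_sym_in_span_dominant[of _ N] unfolding numerator_def by blast
  qed
  finally show ?thesis .
qed

lemma monom_fun_linear_independence:
  assumes S: "finite S" and z: "\<And>x. x \<in> open_simplex \<Longrightarrow> (\<Sum>m\<in>S. c m * monom_fun d m x) = 0" and m: "m \<in> S"
  shows "c m = 0"
proof -
  define p where "p = (\<Sum>m\<in>S. Poly_Mapping.single m (c m))"
  have "eval_mpoly p x = (\<Sum>m\<in>S. c m * eval_monom m x)" for x
    unfolding p_def using S
    by (induction S) (simp_all add: eval_mpoly_add eval_mpoly_single)
  then have "eval_mpoly p (phi x) = eval_mpoly 0 (phi x)" if "x \<in> open_simplex" for x
    using z[OF that] d_nonzero[OF that]
    by (simp add: monom_fun_def mult.assoc[symmetric] sum_distrib_right[symmetric])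
  then have "p = 0" by (rule mpoly_eqI_phi)
  then have "0 = Poly_Mapping.lookup p m" by simp
  also have "\<dots> = (\<Sum>m'\<in>S. if m' = m then c m' else 0)"
    unfolding p_def lookup_sum by (rule sum.cong) (auto simp: lookup_single when_def)
  also have "\<dots> = c m" using S m by simp
  finally show ?thesis by simp
qed

lemma inj_monom_fun: "inj (monom_fun d)"
proof (rule injI, rule ccontr)
  fix m m' assume eq: "monom_fun d m = monom_fun d m'" and ne: "m \<noteq> m'"
  define c :: "('n \<Rightarrow>\<^sub>0 nat) \<Rightarrow> real" where "c l = (if l = m then 1 else -1)" for l
  have "c m = 0"
    by (rule monom_fun_linear_independence[of "{m, m'}"]) (use eq ne in \<open>auto simp: c_def\<close>)
  then show False by (simp add: c_def)
qed

lemma independent_monom_fun: "fs.independent (monom_fun d ` M)"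
  unfolding fs.independent_explicit_module
proof (intro allI impI)
  fix t u v
  assume t: "finite t" "t \<subseteq> monom_fun d ` M" and z: "(\<Sum>v\<in>t. fscale (u v) v) = 0" and v: "v \<in> t"
  obtain S where S: "S \<subseteq> M" "t = monom_fun d ` S" using t(2) by (auto simp: subset_image_iff)
  have inj: "inj_on (monom_fun d) S" using inj_monom_fun by (rule inj_on_subset) simp
  obtain m where m: "m \<in> S" "v = monom_fun d m" using v S by auto
  have "(u \<circ> monom_fun d) m = 0"
  proof (rule monom_fun_linear_independence[OF _ _ m(1)])
    show "finite S" using t(1) S(2) inj by (simp add: finite_image_iff)
    show "(\<Sum>m\<in>S. (u \<circ> monom_fun d) m * monom_fun d m x) = 0" for x
      using fun_cong[OF z, of x] unfolding S(2) sum.reindex[OF inj] by (simp add: sum_fun_apply fscale_apply)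
  qed
  then show "u v = 0" by (simp add: m)
qed

text \<open>The dimension count: the functions \<open>monom_fun d m\<close> with \<open>m\<close> of degree at most \<open>N\<close> are independent,
lie in the span of the numerators with entries at most \<open>N\<close>, and are at least as numerous.\<close>

lemma numerator_in_span_monom_fun:
  assumes "k \<in> P_plus"
  shows "numerator k \<in> fs.span (range (monom_fun d))"
proof -
  obtain N where N: "Max (range (\<lambda>i. k $ i)) \<le> real N" using real_arch_simple by blast
  have "k \<in> P_plus_upto N" using assms N by (auto simp: P_plus_upto_def)
  moreover have "numerator ` P_plus_upto N \<subseteq> fs.span (monom_fun d ` exponents_upto N)"
  proof (rule span_eq_by_dimension)
    show "finite (numerator ` P_plus_upto N)" by (simp add: finite_P_plus_upto)
    show "fs.independent (monom_fun d ` exponents_upto N)" by (rule independent_monom_fun)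
    show "monom_fun d ` exponents_upto N \<subseteq> fs.span (numerator ` P_plus_upto N)"
      using monom_fun_in_span_numerator by blast
    have "card (numerator ` P_plus_upto N) \<le> card (P_plus_upto N :: (real^'n::_) set)"
      by (rule card_image_le[OF finite_P_plus_upto])
    also have "\<dots> \<le> card (exponents_upto N :: ('n \<Rightarrow>\<^sub>0 nat) set)" by (rule card_P_plus_upto_le)
    also have "\<dots> = card (monom_fun d ` exponents_upto N)"
      by (rule card_image[symmetric], rule inj_on_subset[OF inj_monom_fun]) simp
    finally show "card (numerator ` P_plus_upto N) \<le> card (monom_fun d ` exponents_upto N)" .
  qed
  ultimately have "numerator k \<in> fs.span (monom_fun d ` exponents_upto N)" by blast
  then show ?thesis using fs.span_mono[of "monom_fun d ` exponents_upto N" "range (monom_fun d)"] by blast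
qed

lemma numerator_eq_mpoly:
  assumes "k \<in> P_plus"
  shows "\<exists>p. \<forall>x. numerator k x = eval_mpoly p (phi x) * d x"
  using span_monom_fun_eval[OF numerator_in_span_monom_fun[OF assms]] .

lemma ex1_mpoly:
  assumes "k \<in> P_plus"
  shows "\<exists>!p. \<forall>x\<in>interior F_dom. eval_mpoly p (phi x) = cos_sym s (k + r) x / d x"
proof -
  obtain p where "\<forall>x. numerator k x = eval_mpoly p (phi x) * d x" using numerator_eq_mpoly[OF assms] by blast
  then have "\<forall>x\<in>interior F_dom. eval_mpoly p (phi x) = cos_sym s (k + r) x / d x"
    using d_nonzero by (auto simp: interior_F_dom numerator_def)
  moreover have "q = p" if "\<forall>x\<in>interior F_dom. eval_mpoly q (phi x) = cos_sym s (k + r) x / d x" for q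
    by (rule mpoly_eqI_phi) (use that calculation in \<open>auto simp: interior_F_dom\<close>)
  ultimately show ?thesis by blast
qed

lemma eval_mpoly_in_span_numerator: "(\<lambda>x. eval_mpoly p (phi x) * d x) \<in> fs.span (numerator ` P_plus)"
proof -
  have "fs.span (range (monom_fun d)) \<subseteq> fs.span (numerator ` P_plus)"
  proof (rule fs.span_minimal[OF _ fs.subspace_span])
    have "monom_fun d m \<in> fs.span (numerator ` P_plus)" for m
    proof -
      have "monom_fun d m \<in> fs.span (numerator ` P_plus_upto (\<Sum>i\<in>UNIV. Poly_Mapping.lookup m i))"
        by (rule monom_fun_in_span_numerator) (simp add: exponents_upto_def)
      also have "\<dots> \<subseteq> fs.span (numerator ` P_plus)" by (rule fs.span_mono) (auto simp: P_plus_upto_def)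
      finally show ?thesis .
    qed
    then show "range (monom_fun d) \<subseteq> fs.span (numerator ` P_plus)" by blast
  qed
  then show ?thesis using eval_mpoly_in_span by blast
qed

lemma span_family_eq_UNIV:
  assumes P: "\<And>k x. k \<in> P_plus \<Longrightarrow> x \<in> open_simplex \<Longrightarrow> eval_mpoly (P k) (phi x) * d x = numerator k x"
  shows "mpoly.span (P ` P_plus) = UNIV"
proof -
  have ex: "\<exists>q\<in>mpoly.span (P ` P_plus). \<forall>x\<in>open_simplex. f x = eval_mpoly q (phi x) * d x"
    if "f \<in> fs.span (numerator ` P_plus)" for f
    using that
  proof (induction rule: fs.span_induct_alt)
    case base
    show ?case by (rule bexI[of _ 0]) (auto intro: mpoly.span_zero)
  next
    case (step c f h)
    then obtain k q where k: "k \<in> P_plus" "f = numerator k" and q: "q \<in> mpoly.span (P ` P_plus)"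
      "\<forall>x\<in>open_simplex. h x = eval_mpoly q (phi x) * d x" by auto
    show ?case
    proof (rule bexI[of _ "scale_mpoly c (P k) + q"])
      show "scale_mpoly c (P k) + q \<in> mpoly.span (P ` P_plus)"
        using k q(1) by (intro mpoly.span_add mpoly.span_scale q(1)) (auto intro: mpoly.span_base)
      show "\<forall>x\<in>open_simplex. (fscale c f + h) x = eval_mpoly (scale_mpoly c (P k) + q) (phi x) * d x"
        using k q P[OF k(1), symmetric] by (auto simp: fscale_apply eval_mpoly_add eval_mpoly_scale algebra_simps)
    qed
  qed
  have "p \<in> mpoly.span (P ` P_plus)" for p
  proof -
    obtain q where q: "q \<in> mpoly.span (P ` P_plus)"
      "\<forall>x\<in>open_simplex. eval_mpoly p (phi x) * d x = eval_mpoly q (phi x) * d x"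
      using ex[OF eval_mpoly_in_span_numerator] by blast
    have "p = q" by (rule mpoly_eqI_phi) (use q(2) d_nonzero in auto)
    with q show ?thesis by simp
  qed
  then show ?thesis by blast
qed

end

section \<open>Symmetric trigonometric polynomials and the weights\<close>

lemma polynomial_family_I_plus:
  "polynomial_family (\<lambda>_ :: 'n::{finite,wellorder} \<Rightarrow> 'n. 1) 0 0 (\<lambda>_. 1)"
proof -
  interpret sym_char "\<lambda>_ :: 'n \<Rightarrow> 'n. 1" by (rule sym_char_one)
  show ?thesis
  proof unfold_locales
    fix b :: "real^'n::_"
    assume "\<And>i. b $ i - 0 \<in> \<int>" "\<And>i. 0 \<le> b $ i" "\<And>i j. i \<le> j \<Longrightarrow> b $ j \<le> b $ i"
    then show "cos_sym (\<lambda>_. 1) b = 0 \<or> b - 0 \<in> P_plus" by (simp add: P_plus_def)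
  next
    have "cos_prod 0 = (\<lambda>_ :: real^'n::_. 1)" by (auto simp: cos_prod_def)
    then show "(\<lambda>_ :: real^'n::_. 1) \<in> fs.span (cos_prod ` weight_box 0 (0 $ first_index))"
      by (intro fs.span_base image_eqI[of _ _ 0]) (auto simp: weight_box_def)
  qed auto
qed

definition integral_weights :: "(real^'n) set" where
  "integral_weights = {l. \<forall>i. l $ i \<in> \<int>}"

text \<open>Symmetrization writes \<open>f\<close> in terms of symmetric cosine sums, which are the numerators of the family
with trivial character, shift \<open>0\<close> and denominator \<open>1\<close>.\<close>

lemma symmetric_trig_polynomial_ex1:
  fixes f :: "real^'n::{finite,wellorder} \<Rightarrow> real"
  assumes f: "f \<in> fs.span (cos_prod ` integral_weights)"
    and sym: "\<And>\<sigma> x. \<sigma> permutes UNIV \<Longrightarrow> f (permv \<sigma> x) = f x"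
  shows "\<exists>!p. \<forall>x\<in>F_dom. eval_mpoly p (phi x) = f x"
proof -
  interpret polynomial_family "\<lambda>_ :: 'n \<Rightarrow> 'n. 1" 0 0 "\<lambda>_. 1" by (rule polynomial_family_I_plus)
  have "f \<in> fs.span (cos_sym (\<lambda>_. 1) ` integral_weights)"
    by (rule symmetric_in_span_cos_sym[OF f]) (simp add: sym)
  also have "\<dots> \<subseteq> fs.span (range (monom_fun (\<lambda>_. 1)))"
  proof (rule fs.span_minimal[OF _ fs.subspace_span], clarify)
    fix l :: "real^'n::_" assume l: "l \<in> integral_weights"
    obtain N where N: "Max (range (\<lambda>i. \<bar>l $ i\<bar>)) \<le> real N" using real_arch_simple by blast
    have "l \<in> weight_box 0 (real N + 0 $ first_index)"
      using l N by (auto simp: weight_box_def integral_weights_def)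
    then have "cos_sym (\<lambda>_. 1) l \<in> fs.span ((\<lambda>k. cos_sym (\<lambda>_. 1) (k + 0)) ` P_plus_upto N)"
      by (rule cos_sym_in_span_dominant)
    also have "\<dots> \<subseteq> fs.span (range (monom_fun (\<lambda>_. 1)))"
    proof (rule fs.span_minimal[OF _ fs.subspace_span], clarify)
      fix k :: "real^'n::_" assume "k \<in> P_plus_upto N"
      then show "cos_sym (\<lambda>_. 1) (k + 0) \<in> fs.span (range (monom_fun (\<lambda>_. 1)))"
        using numerator_in_span_monom_fun[of k] by (simp add: P_plus_upto_def numerator_def)
    qed
    finally show "cos_sym (\<lambda>_. 1) l \<in> fs.span (range (monom_fun (\<lambda>_. 1)))" .
  qed
  finally obtain p where "\<forall>x. f x = eval_mpoly p (phi x) * 1"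
    using span_monom_fun_eval by blast
  then have "\<forall>x\<in>F_dom. eval_mpoly p (phi x) = f x" by simp
  moreover have "q = p" if "\<forall>x\<in>F_dom. eval_mpoly q (phi x) = f x" for q
    by (rule mpoly_eqI_phi) (use that calculation open_simplex_subset in auto)
  ultimately show ?thesis by blast
qed

lemma span_cos_prod_square:
  fixes r0 :: real
  assumes f: "f \<in> fs.span (cos_prod ` weight_box r0 M)" and r0: "2 * r0 \<in> \<int>"
  shows "f * f \<in> fs.span (cos_prod ` integral_weights)"
proof (rule span_cos_prod_mult[OF f f])
  fix a b e :: "real^'n"
  assume ab: "a \<in> weight_box r0 M" "b \<in> weight_box r0 M"
    and e: "\<And>i. e $ i = a $ i + b $ i \<or> e $ i = a $ i - b $ i"
  have "e $ i \<in> \<int>" for i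
  proof -
    have "a $ i - r0 \<in> \<int>" "b $ i - r0 \<in> \<int>" using ab by (auto simp: weight_box_def)
    then have "(a $ i - r0) + (b $ i - r0) + 2 * r0 \<in> \<int>" "(a $ i - r0) - (b $ i - r0) \<in> \<int>"
      using r0 by (blast intro: Ints_add Ints_diff)+
    moreover have "(a $ i - r0) + (b $ i - r0) + 2 * r0 = a $ i + b $ i" "(a $ i - r0) - (b $ i - r0) = a $ i - b $ i"
      by auto
    ultimately show ?thesis using e[of i] by metis
  qed
  then show "e \<in> integral_weights" by (simp add: integral_weights_def)
qed

lemma (in polynomial_family) square_ex1:
  "\<exists>!p. \<forall>x\<in>F_dom. eval_mpoly p (phi x) = (d x)\<^sup>2"
proof (rule symmetric_trig_polynomial_ex1)
  have "(\<lambda>x. (d x)\<^sup>2) = d * d" by (auto simp: fun_eq_iff fscale_apply power2_eq_square)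
  then show "(\<lambda>x. (d x)\<^sup>2) \<in> fs.span (cos_prod ` integral_weights)"
    using span_cos_prod_square[OF d_span two_r0] by simp
  show "(d (permv \<sigma> x))\<^sup>2 = (d x)\<^sup>2" if "\<sigma> permutes UNIV" for \<sigma> x
    using s_square[of \<sigma>] by (simp add: d_permv[OF that] power_mult_distrib power2_eq_square)
qed

lemma integral_trig_mult:
  fixes f :: "real^'n \<Rightarrow> real"
  assumes "f \<in> fs.span (cos_prod ` integral_weights)" "h \<in> fs.span (cos_prod ` integral_weights)"
  shows "f * h \<in> fs.span (cos_prod ` integral_weights)"
proof (rule span_cos_prod_mult[OF assms])
  fix a b e :: "real^'n"
  assume "a \<in> integral_weights" "b \<in> integral_weights"
    and "\<And>i. e $ i = a $ i + b $ i \<or> e $ i = a $ i - b $ i"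
  then show "e \<in> integral_weights"
    unfolding integral_weights_def mem_Collect_eq by (metis Ints_add Ints_diff)
qed

lemma integral_trig_const: "(\<lambda>_. c) \<in> fs.span (cos_prod ` (integral_weights :: (real^'n) set))"
proof -
  have "(\<lambda>_. c) = fscale c (cos_prod (0 :: real^'n))" by (auto simp: fun_eq_iff fscale_apply cos_prod_def)
  then show ?thesis by (simp only:) (intro fs.span_scale fs.span_base imageI, simp add: integral_weights_def)
qed

lemma integral_trig_prod:
  fixes f :: "'i \<Rightarrow> real^'n \<Rightarrow> real"
  assumes "\<And>i. i \<in> I \<Longrightarrow> f i \<in> fs.span (cos_prod ` integral_weights)"
  shows "(\<lambda>x. \<Prod>i\<in>I. f i x) \<in> fs.span (cos_prod ` integral_weights)"
  using assms
proof (induction I rule: infinite_finite_induct)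
  case (insert a I)
  have "f a * (\<lambda>x. \<Prod>i\<in>I. f i x) \<in> fs.span (cos_prod ` integral_weights)"
    using insert by (intro integral_trig_mult) auto
  moreover have "f a * (\<lambda>x. \<Prod>i\<in>I. f i x) = (\<lambda>x. \<Prod>i\<in>insert a I. f i x)"
    using insert.hyps by (auto simp: fun_eq_iff fscale_apply)
  ultimately show ?case by simp
qed (simp_all add: integral_trig_const)

lemma integral_trig_sum:
  fixes f :: "'i \<Rightarrow> real^'n \<Rightarrow> real"
  assumes "\<And>i. i \<in> I \<Longrightarrow> f i \<in> fs.span (cos_prod ` integral_weights)"
  shows "(\<lambda>x. \<Sum>i\<in>I. f i x) \<in> fs.span (cos_prod ` integral_weights)"
proof -
  have "(\<lambda>x. \<Sum>i\<in>I. f i x) = (\<Sum>i\<in>I. f i)" by (auto simp: fun_eq_iff fscale_apply sum_fun_apply fscale_apply)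
  then show ?thesis using assms by (simp add: fs.span_sum)
qed

lemma integral_trig_sin_square:
  "(\<lambda>x :: real^'n. (sin (pi * x $ i))\<^sup>2) \<in> fs.span (cos_prod ` integral_weights)"
proof -
  let ?l = "axis i 2 :: real^'n"
  have "cos_prod ?l x = cos (pi * 2 * x $ i)" for x
  proof -
    have "cos_prod ?l x = (\<Prod>l\<in>{i}. cos (pi * ?l $ l * x $ l))"
      unfolding cos_prod_def by (rule prod.mono_neutral_right) (auto simp: axis_def)
    then show ?thesis by simp
  qed
  moreover have "cos (pi * 2 * t) = 1 - 2 * (sin (pi * t))\<^sup>2" for t
    using cos_double_sin[of "pi * t"] by (simp add: mult.assoc mult.left_commute)
  ultimately have "cos_prod ?l x = 1 - 2 * (sin (pi * x $ i))\<^sup>2" for x by simp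
  then have "(\<lambda>x :: real^'n. (sin (pi * x $ i))\<^sup>2) = (\<lambda>_. 1/2) + fscale (-1/2) (cos_prod ?l)"
    by (auto simp: fun_eq_iff fscale_apply field_simps)
  moreover have "?l \<in> integral_weights" by (auto simp: integral_weights_def axis_def)
  ultimately show ?thesis
    by (simp only:) (intro fs.span_add fs.span_scale fs.span_base imageI integral_trig_const)
qed

text \<open>Squaring turns the sines in the Jacobian into \<open>sin\<^sup>2 (\<pi> x\<^sub>i) = (1 - cos (2 \<pi> x\<^sub>i)) / 2\<close> and makes the
Jacobian symmetric.\<close>

lemma J_det_square_ex1:
  "\<exists>!p :: 'n::{finite,wellorder} real_mpoly. \<forall>x\<in>F_dom. eval_mpoly p (phi x) = (J_det x)\<^sup>2"
proof (rule symmetric_trig_polynomial_ex1)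
  show "(J_det (permv \<sigma> x))\<^sup>2 = (J_det x)\<^sup>2" if "\<sigma> permutes UNIV" for \<sigma> and x :: "real^'n::_"
    by (rule J_det_permv_square[OF that])
  have factor: "phi_factor j i \<in> fs.span (cos_prod ` integral_weights)" for i j :: 'n
    unfolding phi_factor_def[abs_def]
  proof (rule integral_trig_sum)
    fix \<sigma> :: "'n \<Rightarrow> 'n"
    let ?l = "\<chi> l. (if l \<noteq> i \<and> \<sigma> l \<le> j then 1 else 0 :: real)"
    have "fscale (if \<sigma> i \<le> j then 1 else 0) (cos_prod ?l) \<in> fs.span (cos_prod ` integral_weights)"
      by (intro fs.span_scale fs.span_base imageI) (simp add: integral_weights_def)
    then show "(\<lambda>x. (if \<sigma> i \<le> j then 1 else 0) * cos_prod ?l x) \<in> fs.span (cos_prod ` integral_weights)"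
      by (simp only: fscale_def)
  qed
  let ?D = "\<lambda>x :: real^'n::_. det (\<chi> i j. phi_factor j i x)"
  have D: "?D \<in> fs.span (cos_prod ` integral_weights)"
    unfolding det_def
  proof (rule integral_trig_sum)
    fix \<sigma> :: "'n \<Rightarrow> 'n"
    have "(\<lambda>_. of_int (sign \<sigma>)) * (\<lambda>x. \<Prod>i\<in>UNIV. phi_factor (\<sigma> i) i x) \<in> fs.span (cos_prod ` integral_weights)"
      by (intro integral_trig_mult integral_trig_const integral_trig_prod factor)
    then show "(\<lambda>x. of_int (sign \<sigma>) * (\<Prod>i\<in>UNIV. (\<chi> i j. phi_factor j i x) $ i $ \<sigma> i)) \<in> fs.span (cos_prod ` integral_weights)"
      by (simp add: times_fun_def)
  qed
  have "(\<lambda>_. (pi\<^sup>2) ^ CARD('n)) * (\<lambda>x. \<Prod>i\<in>UNIV. (sin (pi * x $ i))\<^sup>2) * (?D * ?D) \<in> fs.span (cos_prod ` integral_weights)"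
    by (intro integral_trig_mult integral_trig_const integral_trig_prod integral_trig_sin_square D)
  also have "(\<lambda>_. (pi\<^sup>2) ^ CARD('n)) * (\<lambda>x. \<Prod>i\<in>UNIV. (sin (pi * x $ i))\<^sup>2) * (?D * ?D) = (\<lambda>x. (J_det x)\<^sup>2)"
  proof (rule ext)
    fix x :: "real^'n::_"
    have "(\<Prod>i\<in>UNIV. - pi * sin (pi * x $ i))\<^sup>2 = (\<Prod>i\<in>UNIV. pi\<^sup>2 * (sin (pi * x $ i))\<^sup>2)"
      unfolding prod_power_distrib by (simp add: power_mult_distrib)
    then show "((\<lambda>_. (pi\<^sup>2) ^ CARD('n)) * (\<lambda>x. \<Prod>i\<in>UNIV. (sin (pi * x $ i))\<^sup>2) * (?D * ?D)) x = (J_det x)\<^sup>2"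
      by (simp add: J_det_eq power_mult_distrib prod.distrib power2_eq_square[of "?D x"])
  qed
  finally show "(\<lambda>x. (J_det x)\<^sup>2) \<in> fs.span (cos_prod ` (integral_weights :: (real^'n::_) set))" .
qed

lemma eval_p_I_plus: "x \<in> F_dom \<Longrightarrow> eval_mpoly p_I_plus (phi x) = (J_det x)\<^sup>2"
  unfolding p_I_plus_def using theI'[OF J_det_square_ex1] by blast

lemma J_frak_phi: "x \<in> F_dom \<Longrightarrow> J_frak (phi x) = \<bar>J_det x\<bar>"
  by (simp add: J_frak_def eval_p_I_plus)

section \<open>Integration over the fundamental domain\<close>

text \<open>A real function is regarded as a function into \<open>real^1\<close>, which brings it under the substitution
rule for vector-valued functions.\<close>

lemma change_of_variables_real:
  fixes f :: "real^'m::{finite,wellorder} \<Rightarrow> real" and g :: "real^'m::_ \<Rightarrow> real^'m::_"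
  assumes S: "S \<in> sets lebesgue"
    and der: "\<And>x. x \<in> S \<Longrightarrow> (g has_derivative g' x) (at x within S)"
    and inj: "inj_on g S"
    and int: "(\<lambda>x. \<bar>det (matrix (g' x))\<bar> * f (g x)) absolutely_integrable_on S"
  shows "f absolutely_integrable_on g ` S"
    and "integral (g ` S) f = integral S (\<lambda>x. \<bar>det (matrix (g' x))\<bar> * f (g x))"
proof -
  define F :: "real^'m::_ \<Rightarrow> real^1" where "F X = vec (f X)" for X
  let ?D = "\<lambda>x. \<bar>det (matrix (g' x))\<bar> *\<^sub>R F (g x)"
  have "?D absolutely_integrable_on S"
    using int by (simp add: absolutely_integrable_on_1_iff F_def)
  then have F: "F absolutely_integrable_on g ` S \<and> integral (g ` S) F = integral S ?D"
    using has_absolute_integral_change_of_variables[OF S der inj, of F] by blast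
  then show "f absolutely_integrable_on g ` S"
    by (simp add: absolutely_integrable_on_1_iff F_def)
  have "integral (g ` S) F $ 1 = integral S ?D $ 1" using F by simp
  then show "integral (g ` S) f = integral S (\<lambda>x. \<bar>det (matrix (g' x))\<bar> * f (g x))"
    by (simp add: integral_on_1_eq F_def)
qed

lemma inj_permv: "\<sigma> permutes UNIV \<Longrightarrow> inj (permv \<sigma>)"
  by (auto simp: inj_def vec_eq_iff) (metis permutes_def)

lemma integral_permv_image:
  fixes f :: "real^'n::{finite,wellorder} \<Rightarrow> real"
  assumes \<sigma>: "\<sigma> permutes UNIV" and S: "S \<in> sets lebesgue"
    and f: "f absolutely_integrable_on S" and sym: "\<And>x. f (permv \<sigma> x) = f x"
  shows "f absolutely_integrable_on permv \<sigma> ` S" "integral (permv \<sigma> ` S) f = integral S f"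
proof -
  have der: "(permv \<sigma> has_derivative permv \<sigma>) (at x within S)" for x :: "real^'n::_"
    by (rule linear_imp_has_derivative[OF linear_permv])
  have inj: "inj_on (permv \<sigma>) S" using inj_permv[OF \<sigma>] by (rule inj_on_subset) simp
  have int: "(\<lambda>x. \<bar>det (matrix (permv \<sigma> :: real^'n::_ \<Rightarrow> real^'n::_))\<bar> * f (permv \<sigma> x)) absolutely_integrable_on S"
    using f by (simp add: abs_det_matrix_permv[OF \<sigma>] sym)
  show "f absolutely_integrable_on permv \<sigma> ` S"
    by (rule change_of_variables_real(1)[OF S der inj int])
  show "integral (permv \<sigma> ` S) f = integral S f"
    using change_of_variables_real(2)[OF S der inj int] by (simp add: abs_det_matrix_permv[OF \<sigma>] sym)
qed

abbreviation unit_cube :: "(real^'n) set" where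
  "unit_cube \<equiv> cbox 0 (\<chi> i. 1)"

lemma F_dom_subset_cube: "F_dom \<subseteq> unit_cube"
  by (auto simp: F_dom_def mem_box_cart)

lemma open_simplex_subset_cube: "open_simplex \<subseteq> unit_cube"
  using open_simplex_subset F_dom_subset_cube by blast

lemma open_simplex_lebesgue: "open_simplex \<in> sets (lebesgue :: (real^'n::{finite,wellorder}) measure)"
  by (rule sets_completionI_sets) (simp add: borel_open open_open_simplex)

lemma absolutely_integrable_open_simplex:
  fixes f :: "real^'n::{finite,wellorder} \<Rightarrow> real"
  assumes "continuous_on UNIV f"
  shows "f absolutely_integrable_on open_simplex"
proof (rule set_integrable_subset[OF absolutely_integrable_continuous[of 0 "\<chi> i. 1"]])
  show "continuous_on unit_cube f" using assms by (rule continuous_on_subset) simp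
  show "open_simplex \<in> sets (lebesgue :: (real^'n::_) measure)"
    by (rule open_simplex_lebesgue)
qed (rule open_simplex_subset_cube)

lemma negligible_diagonal:
  fixes i j :: "'n::finite"
  assumes "i \<noteq> j"
  shows "negligible {x :: real^'n. x $ i = x $ j}"
proof -
  have "axis i 1 - axis j 1 \<noteq> (0 :: real^'n)"
    using assms by (auto simp: vec_eq_iff axis_def)
  then have "negligible {x. (axis i 1 - axis j 1 :: real^'n) \<bullet> x = 0}"
    by (intro negligible_hyperplane) simp
  then show ?thesis by (simp add: inner_diff_left inner_axis')
qed

lemma negligible_coordinate: "negligible {x :: real^'n. x $ i = c}"
proof -
  have "axis i 1 \<noteq> (0 :: real^'n)" by (simp add: axis_eq_0_iff)
  then have "negligible {x. (axis i 1 :: real^'n) \<bullet> x = c}" by (intro negligible_hyperplane) simp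
  then show ?thesis by (simp add: inner_axis')
qed

text \<open>Up to a null set, where two coordinates agree or a coordinate is \<open>0\<close> or \<open>1\<close>, the cube is the disjoint
union of the \<open>n!\<close> images of the open simplex under permutations of the coordinates.\<close>

lemma integral_cube_symmetric:
  fixes f :: "real^'n::{finite,wellorder} \<Rightarrow> real"
  assumes cont: "continuous_on UNIV f"
    and sym: "\<And>\<sigma> x. \<sigma> permutes UNIV \<Longrightarrow> f (permv \<sigma> x) = f x"
  shows "integral unit_cube f = fact CARD('n) * integral open_simplex f"
proof -
  let ?P = "{\<sigma>. \<sigma> permutes (UNIV :: 'n set)}"
  let ?T = "\<lambda>\<sigma>. permv \<sigma> ` (open_simplex :: (real^'n::_) set)"
  let ?U = "\<Union>\<sigma>\<in>?P. ?T \<sigma>"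
  have leb: "open_simplex \<in> sets (lebesgue :: (real^'n::_) measure)"
    by (rule open_simplex_lebesgue)
  note ai = absolutely_integrable_open_simplex[OF cont]
  have hi: "(f has_integral integral open_simplex f) (?T \<sigma>)" if "\<sigma> \<in> ?P" for \<sigma>
  proof -
    have \<sigma>: "\<sigma> permutes UNIV" using that by simp
    have "f integrable_on ?T \<sigma>"
      using integral_permv_image(1)[OF \<sigma> leb ai sym[OF \<sigma>]]
      by (rule absolutely_integrable_on_def[THEN iffD1, THEN conjunct1])
    then show ?thesis
      using integral_permv_image(2)[OF \<sigma> leb ai sym[OF \<sigma>]] by (metis integrable_integral)
  qed
  have disj: "?T \<sigma> \<inter> ?T \<tau> = {}" if "\<sigma> permutes UNIV" "\<tau> permutes UNIV" "\<sigma> \<noteq> \<tau>" for \<sigma> \<tau>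
  proof (rule ccontr)
    assume "?T \<sigma> \<inter> ?T \<tau> \<noteq> {}"
    then obtain x y where x: "x \<in> open_simplex" and y: "y \<in> open_simplex" and eq: "permv \<sigma> x = permv \<tau> y"
      by auto
    have e: "x $ \<sigma> i = y $ \<tau> i" for i using eq by (metis permv_nth)
    have "(\<lambda>i. x $ i) = (\<lambda>i. y $ i)"
      using that e open_simplex_antimono[OF x] open_simplex_antimono[OF y]
      by (intro antimono_permutation_unique[where \<sigma> = \<sigma> and \<tau> = \<tau>]) auto
    then have xy: "x $ i = y $ i" for i by (rule fun_cong)
    have "\<sigma> i = \<tau> i" for i
      using e[of i] xy by (intro open_simplex_coordinate_inj[OF x]) simp
    with that(3) show False by blast
  qed
  have "(f has_integral (\<Sum>\<sigma>\<in>?P. integral open_simplex f)) ?U"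
  proof (rule has_integral_UN[OF _ hi])
    show "finite ?P" by (simp add: finite_permutations)
    show "pairwise (\<lambda>\<sigma> \<tau>. negligible (?T \<sigma> \<inter> ?T \<tau>)) ?P"
      using disj by (auto simp: pairwise_def)
  qed
  then have "integral ?U f = fact CARD('n) * integral open_simplex f"
    by (simp add: integral_unique card_permutations)
  moreover have "integral ?U f = integral unit_cube f"
  proof (rule integral_subset_negligible)
    show "?U \<subseteq> unit_cube"
      by (auto simp: open_simplex_def mem_box_cart less_imp_le)
    let ?N = "(\<Union>i. {x :: real^'n::_. x $ i = 0}) \<union> (\<Union>i. {x. x $ i = 1}) \<union> (\<Union>i. \<Union>j\<in>-{i}. {x. x $ i = x $ j})"
    have "unit_cube - ?U \<subseteq> ?N"
    proof
      fix x :: "real^'n::_" assume x: "x \<in> unit_cube - ?U"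
      show "x \<in> ?N"
      proof (rule ccontr)
        assume nN: "x \<notin> ?N"
        obtain \<sigma> where \<sigma>: "\<sigma> permutes UNIV" and anti: "antimono ((\<lambda>i. x $ i) \<circ> \<sigma>)"
          using exists_antimono_permutation by blast
        have "permv \<sigma> x \<in> open_simplex"
          unfolding open_simplex_def
        proof (intro CollectI conjI allI impI)
          fix i
          have "0 \<le> x $ \<sigma> i" "x $ \<sigma> i \<le> 1" "x $ \<sigma> i \<noteq> 0" "x $ \<sigma> i \<noteq> 1"
            using x nN by (auto simp: mem_box_cart)
          then show "0 < permv \<sigma> x $ i" "permv \<sigma> x $ i < 1" by auto
        next
          fix i j :: 'n assume ij: "i < j"
          have "\<sigma> i \<noteq> \<sigma> j" using permutes_inj[OF \<sigma>] ij by (auto dest: injD)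
          then have "x $ \<sigma> i \<noteq> x $ \<sigma> j" using nN by auto
          moreover have "x $ \<sigma> j \<le> x $ \<sigma> i" using antimonoD[OF anti, of i j] ij by simp
          ultimately show "permv \<sigma> x $ j < permv \<sigma> x $ i" by simp
        qed
        moreover have "x = permv (inv \<sigma>) (permv \<sigma> x)"
          using permutes_inverses(1)[OF \<sigma>] by (simp add: vec_eq_iff)
        ultimately have "x \<in> ?U" using permutes_inv[OF \<sigma>] by blast
        with x show False by blast
      qed
    qed
    moreover have "negligible ?N"
      by (intro negligible_Un negligible_Union)
         (auto intro!: negligible_diagonal negligible_coordinate negligible_Union)
    ultimately show "negligible (unit_cube - ?U)" by (rule negligible_subset[rotated])
  qed
  ultimately show ?thesis by simp
qed

text \<open>Fubini: Lebesgue measure is the product measure over the standard basis.\<close>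

lemma integral_cube_prod:
  fixes f :: "'n::finite \<Rightarrow> real \<Rightarrow> real"
  assumes cont: "\<And>i. continuous_on UNIV (f i)"
  shows "integral unit_cube (\<lambda>x :: real^'n. \<Prod>i\<in>UNIV. f i (x $ i)) = (\<Prod>i\<in>UNIV. integral {0..1} (f i))"
proof -
  interpret product_sigma_finite "\<lambda>_ :: real^'n. lborel :: real measure" ..
  define ax where "ax = (\<lambda>i. axis i 1 :: real^'n)"
  have inj: "inj ax" by (auto simp: ax_def inj_def axis_eq_axis)
  have Basis: "Basis = range ax" by (auto simp: Basis_vec_def ax_def)
  define G where "G b t = indicator {0..1} t * f (inv ax b) t" for b and t :: real
  have inv: "inv ax (ax i) = i" for i using inj by simp
  have meas: "f i \<in> borel_measurable borel" for i
    by (rule borel_measurable_continuous_onI[OF cont])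
  have Gmeas: "G b \<in> borel_measurable borel" for b
    unfolding G_def using meas by measurable
  have int1: "set_integrable lborel {0..1} (f i)" for i
    using borel_integrable_atLeastAtMost'[of 0 1 "f i"] cont[of i] continuous_on_subset by blast
  have intG: "integrable lborel (G b)" for b
    using int1[of "inv ax b"] by (simp add: set_integrable_def G_def[abs_def])
  have prodG: "(\<Prod>b\<in>Basis. G b (x \<bullet> b)) = indicator unit_cube x * (\<Prod>i\<in>UNIV. f i (x $ i))" for x :: "real^'n"
  proof -
    have "(\<Prod>b\<in>Basis. G b (x \<bullet> b)) = (\<Prod>i\<in>UNIV. G (ax i) (x \<bullet> ax i))"
      unfolding Basis by (simp add: prod.reindex[OF inj])
    also have "\<dots> = (\<Prod>i\<in>UNIV. indicator {0..1} (x $ i)) * (\<Prod>i\<in>UNIV. f i (x $ i))"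
      by (simp add: G_def inv ax_def inner_axis flip: prod.distrib)
        (simp add: inv[unfolded ax_def])
    also have "(\<Prod>i\<in>UNIV. indicator {0..1} (x $ i)) = (indicator unit_cube x :: real)"
      by (auto simp: indicator_def mem_box_cart prod_zero_iff split: if_splits)
    finally show ?thesis .
  qed
  have "(LINT x : unit_cube | lborel. \<Prod>i\<in>UNIV. f i (x $ i)) = (\<integral>x. (\<Prod>b\<in>Basis. G b (x \<bullet> b)) \<partial>lborel)"
    unfolding set_lebesgue_integral_def prodG by simp
  also have "\<dots> = (\<integral>y. (\<Prod>b\<in>Basis. G b ((\<Sum>b\<in>Basis. y b *\<^sub>R b) \<bullet> b)) \<partial>(\<Pi>\<^sub>M b\<in>Basis. lborel))"
  proof (subst lborel_eq, rule integral_distr)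
    show "(\<lambda>y. \<Sum>b\<in>Basis. y b *\<^sub>R b) \<in> (\<Pi>\<^sub>M b\<in>Basis. lborel) \<rightarrow>\<^sub>M (borel :: (real^'n) measure)" by measurable
    show "(\<lambda>x :: real^'n. \<Prod>b\<in>Basis. G b (x \<bullet> b)) \<in> borel_measurable borel"
      by (intro borel_measurable_prod measurable_compose[OF _ Gmeas]) simp
  qed
  also have "\<dots> = (\<integral>y. (\<Prod>b\<in>Basis. G b (y b)) \<partial>(\<Pi>\<^sub>M b\<in>Basis. lborel))"
    by (intro Bochner_Integration.integral_cong prod.cong refl) simp
  also have "\<dots> = (\<Prod>b\<in>Basis. integral\<^sup>L lborel (G b))"
    by (rule product_integral_prod[OF finite_Basis intG])
  also have "\<dots> = (\<Prod>i\<in>UNIV. integral\<^sup>L lborel (G (ax i)))"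
    unfolding Basis by (simp add: prod.reindex[OF inj])
  also have "\<dots> = (\<Prod>i\<in>UNIV. integral {0..1} (f i))"
  proof (rule prod.cong[OF refl])
    fix i
    have "integral\<^sup>L lborel (G (ax i)) = (LINT t : {0..1} | lborel. f i t)"
      by (simp add: set_lebesgue_integral_def G_def[abs_def] inv)
    then show "integral\<^sup>L lborel (G (ax i)) = integral {0..1} (f i)"
      using set_borel_integral_eq_integral(2)[OF int1] by simp
  qed
  finally have "(LINT x : unit_cube | lborel. \<Prod>i\<in>UNIV. f i (x $ i)) = (\<Prod>i\<in>UNIV. integral {0..1} (f i))" .
  moreover have si: "set_integrable lborel unit_cube (\<lambda>x :: real^'n. \<Prod>i\<in>UNIV. f i (x $ i))"
    unfolding set_integrable_def
    by (intro borel_integrable_compact compact_cbox continuous_intros continuous_on_compose2[OF cont]) auto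
  ultimately show ?thesis unfolding set_borel_integral_eq_integral(2)[OF si] by simp
qed

lemma integral_cos_Ints:
  assumes "m \<in> \<int>"
  shows "((\<lambda>t. cos (pi * m * t)) has_integral (if m = 0 then 1 else 0)) {0..1}"
proof (cases "m = 0")
  case True
  then show ?thesis using has_integral_const_real[of "1::real" 0 1] by simp
next
  case False
  have "((\<lambda>t. cos (pi * m * t)) has_integral (sin (pi * m * 1) / (pi * m) - sin (pi * m * 0) / (pi * m))) {0..1}"
    by (rule fundamental_theorem_of_calculus)
       (use False in \<open>auto intro!: derivative_eq_intros simp: has_real_derivative_iff_has_vector_derivative[symmetric]\<close>)
  moreover have "sin (pi * m) = 0" using assms by (metis mult.commute sin_times_pi_eq_0)
  ultimately show ?thesis using False by simp
qed

lemma integral_cos_cos: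
  assumes "a + b \<in> \<int>" "a - b \<in> \<int>" "0 \<le> a" "0 \<le> b"
  shows "integral {0..1} (\<lambda>t. cos (pi * a * t) * cos (pi * b * t)) =
    (if a = b then if a = 0 then 1 else 1/2 else 0)"
proof -
  have "((\<lambda>t. (cos (pi * (a - b) * t) + cos (pi * (a + b) * t)) / 2) has_integral
      ((if a - b = 0 then 1 else 0) + (if a + b = 0 then 1 else 0)) / 2) {0..1}"
    by (intro has_integral_divide has_integral_add integral_cos_Ints assms)
  moreover have "(\<lambda>t. cos (pi * a * t) * cos (pi * b * t)) =
      (\<lambda>t. (cos (pi * (a - b) * t) + cos (pi * (a + b) * t)) / 2)"
    by (rule ext) (simp add: cos_times_cos algebra_simps)
  ultimately have "integral {0..1} (\<lambda>t. cos (pi * a * t) * cos (pi * b * t)) =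
      ((if a - b = 0 then 1 else 0) + (if a + b = 0 then 1 else 0)) / 2"
    by (simp only: integral_unique)
  then show ?thesis using assms(3,4) by (auto split: if_splits)
qed

lemma integral_cos_prod_cos_prod:
  fixes a b :: "real^'n"
  assumes ab: "\<And>i. a $ i + b $ i \<in> \<int>" "\<And>i. a $ i - b $ i \<in> \<int>" "\<And>i. 0 \<le> a $ i" "\<And>i. 0 \<le> b $ i"
  shows "integral unit_cube (\<lambda>x. cos_prod a x * cos_prod b x) = (if a = b then h_const a else 0)"
proof -
  have "integral unit_cube (\<lambda>x. cos_prod a x * cos_prod b x) =
      (\<Prod>i\<in>UNIV. integral {0..1} (\<lambda>t. cos (pi * a $ i * t) * cos (pi * b $ i * t)))"
    unfolding cos_prod_def prod.distrib[symmetric]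
    by (rule integral_cube_prod) (intro continuous_intros)
  also have "\<dots> = (\<Prod>i\<in>UNIV. if a $ i = b $ i then if a $ i = 0 then 1 else 1/2 else 0)"
    by (intro prod.cong refl integral_cos_cos ab)
  also have "\<dots> = (if a = b then h_const a else 0)"
  proof (cases "a = b")
    case True
    then show ?thesis by (simp add: h_const_def)
  next
    case False
    then obtain i where "a $ i \<noteq> b $ i" by (auto simp: vec_eq_iff)
    then have "(\<Prod>i\<in>UNIV. if a $ i = b $ i then if a $ i = 0 then 1 else 1/2 else 0 :: real) = 0"
      by (intro prod_zero bexI[of _ i]) auto
    with False show ?thesis by simp
  qed
  finally show ?thesis .
qed

lemma h_const_permv:
  assumes "\<sigma> permutes UNIV"
  shows "h_const (permv \<sigma> a) = h_const a"
proof -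
  have "h_const a = (\<Prod>i\<in>UNIV. ((\<lambda>i. if a $ i = 0 then 1 else 1/2) \<circ> \<sigma>) i)"
    unfolding h_const_def by (rule prod.permute[OF assms])
  then show ?thesis by (simp add: h_const_def)
qed

lemma continuous_cos_prod: "continuous_on UNIV (cos_prod a)"
  unfolding cos_prod_def[abs_def] by (intro continuous_intros)

lemma continuous_span_cos_prod:
  assumes "f \<in> fs.span (cos_prod ` A)"
  shows "continuous_on UNIV f"
  using assms
proof (induction rule: fs.span_induct_alt)
  case base
  show ?case unfolding zero_fun_def by (rule continuous_on_const)
next
  case (step c f1 f2)
  then show ?case
    unfolding plus_fun_def fscale_def by (auto intro!: continuous_intros continuous_cos_prod)
qed

lemma continuous_cos_sym: "continuous_on UNIV (cos_sym s a)"
  unfolding cos_sym_def[abs_def] by (intro continuous_intros continuous_cos_prod)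

context cosine_family
begin

definition dominant :: "real^'n::_ \<Rightarrow> bool" where
  "dominant a \<longleftrightarrow> (\<forall>i. a $ i - r0 \<in> \<int> \<and> 0 \<le> a $ i) \<and> antimono (\<lambda>i. a $ i)"

lemma dominant_add_r: "k \<in> P_plus \<Longrightarrow> dominant (k + r)"
  unfolding dominant_def antimono_def P_plus_def
  using r_shift r_nonneg r_antimono
  by (auto intro: add_mono simp: add_diff_eq[symmetric])

text \<open>On the cube, the terms of the two sums for \<open>\<sigma>\<close> and \<open>\<tau>\<close> are orthogonal unless \<open>permv \<sigma> a = permv \<tau> b\<close>.
Sorted vectors with a common rearrangement agree, so this forces \<open>a = b\<close>; then \<open>\<tau> = \<pi> \<circ> \<sigma>\<close> for \<open>\<pi>\<close> in
the stabilizer of \<open>a\<close>, and each of the \<open>n!\<close> choices of \<open>\<sigma>\<close> contributes the same amount.\<close>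

lemma integral_cos_sym_cos_sym:
  assumes a: "dominant a" and b: "dominant b"
  shows "integral open_simplex (\<lambda>x. cos_sym s a x * cos_sym s b x) =
    (if a = b then h_const a * (\<Sum>\<pi> | \<pi> permutes UNIV \<and> permv \<pi> a = a. s \<pi>) else 0)"
proof -
  let ?P = "{\<sigma>. \<sigma> permutes (UNIV :: 'n set)}"
  let ?f = "\<lambda>x. cos_sym s a x * cos_sym s b x"
  have fin: "finite ?P" by (simp add: finite_permutations)
  have orth: "integral unit_cube (\<lambda>x. cos_prod (permv \<sigma> a) x * cos_prod (permv \<tau> b) x) =
      (if permv \<sigma> a = permv \<tau> b then h_const a else 0)" if "\<sigma> \<in> ?P" for \<sigma> \<tau>
  proof -
    have "a $ i - r0 \<in> \<int>" "b $ i - r0 \<in> \<int>" for i using a b by (auto simp: dominant_def)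
    then have "(a $ i - r0) + (b $ j - r0) + 2 * r0 \<in> \<int>" "(a $ i - r0) - (b $ j - r0) \<in> \<int>" for i j
      using two_r0 by (blast intro: Ints_add Ints_diff)+
    moreover have "(a $ i - r0) + (b $ j - r0) + 2 * r0 = a $ i + b $ j"
        "(a $ i - r0) - (b $ j - r0) = a $ i - b $ j" for i j by auto
    ultimately have "a $ i + b $ j \<in> \<int>" "a $ i - b $ j \<in> \<int>" for i j by metis+
    then have "integral unit_cube (\<lambda>x. cos_prod (permv \<sigma> a) x * cos_prod (permv \<tau> b) x) =
        (if permv \<sigma> a = permv \<tau> b then h_const (permv \<sigma> a) else 0)"
      using a b by (intro integral_cos_prod_cos_prod) (auto simp: dominant_def)
    then show ?thesis using that by (simp only: h_const_permv mem_Collect_eq)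
  qed
  have "fact CARD('n) * integral open_simplex ?f = integral unit_cube ?f"
  proof (rule integral_cube_symmetric[symmetric])
    show "continuous_on UNIV ?f" by (intro continuous_intros continuous_cos_sym)
    show "?f (permv \<sigma> x) = ?f x" if "\<sigma> permutes UNIV" for \<sigma> x
      using s_square[of \<sigma>] by (simp add: cos_sym_permv_right[OF that] algebra_simps)
  qed
  also have "\<dots> = integral unit_cube (\<lambda>x. \<Sum>\<sigma>\<in>?P. \<Sum>\<tau>\<in>?P. s \<sigma> * s \<tau> * (cos_prod (permv \<sigma> a) x * cos_prod (permv \<tau> b) x))"
    by (rule integral_cong) (simp add: cos_sym_def sum_product algebra_simps)
  also have "\<dots> = (\<Sum>\<sigma>\<in>?P. \<Sum>\<tau>\<in>?P. s \<sigma> * s \<tau> * integral unit_cube (\<lambda>x. cos_prod (permv \<sigma> a) x * cos_prod (permv \<tau> b) x))"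
  proof -
    have int: "(\<lambda>x. s \<sigma> * s \<tau> * (cos_prod (permv \<sigma> a) x * cos_prod (permv \<tau> b) x)) integrable_on unit_cube" for \<sigma> \<tau>
      by (intro integrable_continuous continuous_intros continuous_on_subset[OF continuous_cos_prod]) auto
    show ?thesis
      by (subst integral_sum, simp add: fin, intro integrable_sum int, simp add: fin)
         (intro sum.cong refl, subst integral_sum, auto simp: fin int)
  qed
  also have "\<dots> = (\<Sum>\<sigma>\<in>?P. \<Sum>\<tau>\<in>?P. s \<sigma> * s \<tau> * (if permv \<sigma> a = permv \<tau> b then h_const a else 0))"
    by (intro sum.cong refl) (simp add: orth)
  also have "\<dots> = fact CARD('n) * (if a = b then h_const a * (\<Sum>\<pi> | \<pi> permutes UNIV \<and> permv \<pi> a = a. s \<pi>) else 0)"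
  proof (cases "a = b")
    case False
    have "permv \<sigma> a \<noteq> permv \<tau> b" if "\<sigma> \<in> ?P" "\<tau> \<in> ?P" for \<sigma> \<tau>
    proof
      assume eq: "permv \<sigma> a = permv \<tau> b"
      have "(\<lambda>i. a $ i) = (\<lambda>i. b $ i)"
      proof (rule antimono_permutation_unique[where \<sigma> = \<sigma> and \<tau> = \<tau>])
        show "a $ \<sigma> i = b $ \<tau> i" for i using eq by (metis permv_nth)
      qed (use a b that in \<open>auto simp: dominant_def\<close>)
      with False show False by (simp add: vec_eq_iff fun_eq_iff)
    qed
    with False show ?thesis by simp
  next
    case True
    have "(\<Sum>\<tau>\<in>?P. s \<sigma> * s \<tau> * (if permv \<sigma> a = permv \<tau> a then h_const a else 0)) =
        h_const a * (\<Sum>\<pi> | \<pi> permutes UNIV \<and> permv \<pi> a = a. s \<pi>)" if \<sigma>: "\<sigma> permutes UNIV" for \<sigma>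
    proof -
      have "(\<Sum>\<tau>\<in>?P. s \<sigma> * s \<tau> * (if permv \<sigma> a = permv \<tau> a then h_const a else 0)) =
          (\<Sum>\<pi>\<in>?P. s \<sigma> * s (\<pi> \<circ> \<sigma>) * (if permv \<sigma> a = permv (\<pi> \<circ> \<sigma>) a then h_const a else 0))"
        by (rule sum_permutations_compose_right[OF \<sigma>])
      also have "\<dots> = (\<Sum>\<pi>\<in>?P. if permv \<pi> a = a then h_const a * s \<pi> else 0)"
      proof (rule sum.cong[OF refl])
        fix \<pi> assume "\<pi> \<in> ?P"
        then have e1: "s \<sigma> * s (\<pi> \<circ> \<sigma>) = s \<pi>"
          using s_square[of \<sigma>] by (simp add: s_compose \<sigma>)
        have e2: "permv \<sigma> a = permv (\<pi> \<circ> \<sigma>) a \<longleftrightarrow> permv \<pi> a = a"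
          unfolding permv_permv[symmetric] inj_eq[OF inj_permv[OF \<sigma>]] by (rule eq_commute)
        show "s \<sigma> * s (\<pi> \<circ> \<sigma>) * (if permv \<sigma> a = permv (\<pi> \<circ> \<sigma>) a then h_const a else 0) =
            (if permv \<pi> a = a then h_const a * s \<pi> else 0)"
          unfolding e1 e2 by (simp add: mult.commute)
      qed
      also have "\<dots> = h_const a * (\<Sum>\<pi> | \<pi> permutes UNIV \<and> permv \<pi> a = a. s \<pi>)"
      proof -
        have "{\<pi>. \<pi> permutes UNIV \<and> permv \<pi> a = a} = {\<pi> \<in> ?P. permv \<pi> a = a}" by simp
        then show ?thesis unfolding sum_distrib_left by (simp only: sum.inter_filter[OF fin])
      qed
      finally show ?thesis .
    qed
    then show ?thesis using True by (simp add: card_permutations)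
  qed
  finally show ?thesis by simp
qed

end

lemma compact_F_frak: "compact F_frak"
  unfolding F_frak_def by (rule compact_continuous_image[OF continuous_on_phi compact_F_dom])

lemma negligible_F_frak_diff: "negligible (F_frak - phi ` open_simplex :: (real^'n::{finite,wellorder}) set)"
proof -
  have "negligible (phi ` (F_dom - open_simplex) :: (real^'n::_) set)"
    by (rule negligible_differentiable_image_negligible[OF order_refl negligible_F_dom_boundary])
       (auto simp: differentiable_on_def differentiable_def intro: has_derivative_phi)
  then show ?thesis by (rule negligible_subset) (auto simp: F_frak_def)
qed

text \<open>Only the open simplex matters: the rest of \<open>F_dom\<close> is a null set, and a differentiable map sends it to
a null set.\<close>

lemma integral_F_frak_substitution:
  fixes h :: "real^'n::{finite,wellorder} \<Rightarrow> real"
  assumes meas: "h \<in> borel_measurable borel"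
    and eq: "\<And>x. x \<in> open_simplex \<Longrightarrow> \<bar>J_det x\<bar> * h (phi x) = u x"
    and u: "continuous_on UNIV u"
  shows "set_integrable lborel F_frak h" "(LINT X : F_frak | lborel. h X) = integral open_simplex u"
proof -
  let ?S = "open_simplex :: (real^'n::_) set"
  have S: "?S \<in> sets lebesgue" by (rule open_simplex_lebesgue)
  have "u absolutely_integrable_on ?S" by (rule absolutely_integrable_open_simplex[OF u])
  then have int: "(\<lambda>x. \<bar>det (matrix (dphi x))\<bar> * h (phi x)) absolutely_integrable_on ?S"
    using eq by (subst set_integrable_cong[OF refl refl, of _ _ u]) (auto simp: J_det_eq_dphi)
  have ai: "h absolutely_integrable_on phi ` ?S"
    by (rule change_of_variables_real(1)[OF S has_derivative_phi inj_on_phi int])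
  have val: "integral (phi ` ?S) h = integral ?S u"
    using change_of_variables_real(2)[OF S has_derivative_phi inj_on_phi int] eq
    by (simp add: J_det_eq_dphi cong: integral_cong)
  have sub: "phi ` ?S \<subseteq> F_frak" using open_simplex_subset by (auto simp: F_frak_def)
  have "h absolutely_integrable_on F_frak"
  proof (subst absolutely_integrable_spike_set_eq)
    show "negligible {x \<in> F_frak - phi ` ?S. h x \<noteq> 0}"
      by (rule negligible_subset[OF negligible_F_frak_diff]) auto
    show "negligible {x \<in> phi ` ?S - F_frak. h x \<noteq> 0}"
      by (rule negligible_subset[OF negligible_empty]) (use sub in auto)
  qed (rule ai)
  moreover have "(\<lambda>x. indicator F_frak x *\<^sub>R h x) \<in> borel_measurable lborel"
    using meas borel_closed[OF compact_imp_closed[OF compact_F_frak]]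
    by (intro borel_measurable_scaleR borel_measurable_indicator) auto
  ultimately show si: "set_integrable lborel F_frak h"
    unfolding set_integrable_def by (simp add: integrable_completion)
  have "(LINT X : F_frak | lborel. h X) = integral F_frak h"
    by (rule set_borel_integral_eq_integral(2)[OF si])
  also have "\<dots> = integral (phi ` ?S) h"
    by (rule integral_subset_negligible[OF sub negligible_F_frak_diff, symmetric])
  finally show "(LINT X : F_frak | lborel. h X) = integral ?S u" by (simp add: val)
qed

section \<open>Orthogonality\<close>

lemma weighted_integral_zero_left: "weighted_integral w 0 f = 0"
  by (simp add: weighted_integral_def set_lebesgue_integral_def)

lemma scalar_product_sum_left:
  assumes ip: "is_scalar_product ip" and zero: "\<And>z. ip 0 z = 0"
  shows "ip (\<Sum>v\<in>t. scale_mpoly (u v) v) z = (\<Sum>v\<in>t. u v * ip v z)"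
proof -
  have add: "ip (f + h) z = ip f z + ip h z" and scale: "ip (scale_mpoly c f) z = c * ip f z" for f h c
    using ip unfolding is_scalar_product_def by blast+
  show ?thesis
    by (induction t rule: infinite_finite_induct) (simp_all add: zero add scale)
qed

lemma independent_orthogonal:
  assumes ip: "is_scalar_product ip" and zero: "\<And>z. ip 0 z = 0"
    and nz: "\<And>v. v \<in> B \<Longrightarrow> ip v v \<noteq> 0"
    and orth: "\<And>v z. v \<in> B \<Longrightarrow> z \<in> B \<Longrightarrow> v \<noteq> z \<Longrightarrow> ip v z = 0"
  shows "mpoly.independent B"
  unfolding mpoly.independent_explicit_module
proof (intro allI impI)
  fix t u v
  assume t: "finite t" "t \<subseteq> B" and s: "(\<Sum>v\<in>t. scale_mpoly (u v) v) = 0" and v: "v \<in> t"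
  have "0 = ip (\<Sum>v\<in>t. scale_mpoly (u v) v) v" by (simp add: s zero)
  also have "\<dots> = (\<Sum>z\<in>t. u z * ip z v)" by (rule scalar_product_sum_left[OF ip zero])
  also have "\<dots> = (\<Sum>z\<in>{v}. u z * ip z v)"
    using t v orth by (intro sum.mono_neutral_right) auto
  finally show "u v = 0" using nz[of v] t v by auto
qed

context polynomial_family
begin

lemma continuous_d: "continuous_on UNIV d"
  by (rule continuous_span_cos_prod[OF d_span])

text \<open>The integrand of the weighted scalar product pulled back to the simplex, where the weight times the
absolute value of the Jacobian is \<open>d\<^sup>2\<close>.\<close>

definition pairing :: "'n real_mpoly \<Rightarrow> 'n real_mpoly \<Rightarrow> real^'n::_ \<Rightarrow> real" where
  "pairing f h x = (eval_mpoly f (phi x) * d x) * (eval_mpoly h (phi x) * d x)"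

lemma continuous_pairing: "continuous_on UNIV (pairing f h)"
  unfolding pairing_def[abs_def] by (intro continuous_intros continuous_d continuous_on_phi)

lemma pairing_integrable: "pairing f h integrable_on open_simplex"
  using absolutely_integrable_open_simplex[OF continuous_pairing]
  by (rule absolutely_integrable_on_def[THEN iffD1, THEN conjunct1])

text \<open>The integrand is continuous and nonnegative, and it is positive at some point since a nonzero
polynomial cannot vanish on the open image of \<open>phi\<close>.\<close>

lemma integral_pairing_pos:
  assumes "f \<noteq> 0"
  shows "0 < integral open_simplex (pairing f f)"
proof -
  obtain x where x: "x \<in> open_simplex" and fx: "eval_mpoly f (phi x) \<noteq> 0"
    using mpoly_eqI_phi[of f 0] assms by auto
  obtain e where e: "e > 0" "ball x e \<subseteq> open_simplex"
    using open_open_simplex x open_contains_ball by blast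
  obtain a b where ab: "x \<in> box a b" "cbox a b \<subseteq> ball x e"
    using open_contains_cbox[of "ball x e" x] e(1) by (metis centre_in_ball open_ball)
  have cont: "continuous_on (cbox a b) (pairing f f)"
    by (rule continuous_on_subset[OF continuous_pairing]) simp
  have nonneg: "0 \<le> pairing f f y" for y by (simp add: pairing_def)
  have int: "pairing f f integrable_on cbox a b" by (rule integrable_continuous[OF cont])
  have "integral (cbox a b) (pairing f f) \<noteq> 0"
  proof
    assume "integral (cbox a b) (pairing f f) = 0"
    then have "(pairing f f has_integral 0) (cbox a b)" using int by (metis integrable_integral)
    then have "pairing f f x = 0"
      using ab(1) box_subset_cbox[of a b]
      by (intro has_integral_0_cbox_imp_0[OF cont]) (auto simp: nonneg)
    then show False using fx d_nonzero[OF x] by (simp add: pairing_def)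
  qed
  moreover have "0 \<le> integral (cbox a b) (pairing f f)"
    by (rule integral_nonneg[OF int]) (simp add: nonneg)
  moreover have "integral (cbox a b) (pairing f f) \<le> integral open_simplex (pairing f f)"
    by (rule integral_subset_le) (use ab e int pairing_integrable nonneg in auto)
  ultimately show ?thesis by simp
qed

text \<open>The sum of the character over the stabilizer is \<open>H_const k\<close> for the trivial character, and \<open>1\<close> for
the sign character, where \<open>k + r\<close> has distinct entries.\<close>

definition square_norm :: "real^'n::_ \<Rightarrow> real" where
  "square_norm k = h_const (k + r) * (\<Sum>\<pi> | \<pi> permutes UNIV \<and> permv \<pi> (k + r) = k + r. s \<pi>)"

theorem orthogonal_family:
  assumes meas: "w \<in> borel_measurable borel"
    and w: "\<And>x. x \<in> open_simplex \<Longrightarrow> w (phi x) = (d x)\<^sup>2 / \<bar>J_det x\<bar>"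
    and P: "\<And>k x. k \<in> P_plus \<Longrightarrow> x \<in> open_simplex \<Longrightarrow> eval_mpoly (P k) (phi x) * d x = numerator k x"
    and pos: "\<And>k. k \<in> P_plus \<Longrightarrow> square_norm k \<noteq> 0"
  shows "orthogonal_basis w P_plus P \<and>
    (\<forall>k\<in>P_plus. \<forall>k'\<in>P_plus. weighted_integral w (P k) (P k') = (if k = k' then square_norm k else 0))"
proof -
  let ?h = "\<lambda>f h X. eval_mpoly f X * eval_mpoly h X * w X"
  have eq: "\<bar>J_det x\<bar> * ?h f h (phi x) = pairing f h x" if "x \<in> open_simplex" for f h x
    using J_det_nonzero[OF that] by (simp add: w[OF that] pairing_def power2_eq_square)
  have hmeas: "?h f h \<in> borel_measurable borel" for f h
  proof -
    have "(\<lambda>X :: real^'n::_. eval_mpoly p X) \<in> borel_measurable borel" for p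
      by (intro borel_measurable_continuous_onI continuous_intros)
    then show ?thesis using meas by measurable
  qed
  note subst = integral_F_frak_substitution[OF hmeas eq continuous_pairing]
  have W: "weighted_integral w f h = integral open_simplex (pairing f h)" for f h
    using subst(2) by (simp add: weighted_integral_def)
  have ip: "is_scalar_product (weighted_integral w)"
    unfolding is_scalar_product_def W
  proof (intro conjI allI impI)
    fix f h l :: "'n real_mpoly" and c :: real
    show "integral open_simplex (pairing f h) = integral open_simplex (pairing h f)"
      by (simp add: pairing_def[abs_def] mult.commute)
    have "pairing (f + h) l = (\<lambda>x. pairing f l x + pairing h l x)"
      by (auto simp: pairing_def eval_mpoly_add algebra_simps)
    then show "integral open_simplex (pairing (f + h) l) = integral open_simplex (pairing f l) + integral open_simplex (pairing h l)"
      by (simp add: integral_add pairing_integrable)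
    have "pairing (scale_mpoly c f) h = (\<lambda>x. c * pairing f h x)"
      by (auto simp: pairing_def eval_mpoly_scale algebra_simps)
    then show "integral open_simplex (pairing (scale_mpoly c f) h) = c * integral open_simplex (pairing f h)"
      by simp
    show "0 < integral open_simplex (pairing f f)" if "f \<noteq> 0"
      by (rule integral_pairing_pos[OF that])
  qed
  have val: "weighted_integral w (P k) (P k') = (if k = k' then square_norm k else 0)"
    if k: "k \<in> P_plus" "k' \<in> P_plus" for k k'
  proof -
    have "weighted_integral w (P k) (P k') = integral open_simplex (\<lambda>x. cos_sym s (k + r) x * cos_sym s (k' + r) x)"
      unfolding W by (rule integral_cong) (simp add: pairing_def P k numerator_def)
    then show ?thesis
      using integral_cos_sym_cos_sym[OF dominant_add_r[OF k(1)] dominant_add_r[OF k(2)]]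
      by (simp add: square_norm_def)
  qed
  have inj: "inj_on P P_plus"
  proof (rule inj_onI, rule ccontr)
    fix k k' assume k: "k \<in> P_plus" "k' \<in> P_plus" and e: "P k = P k'" and "k \<noteq> k'"
    then have "weighted_integral w (P k) (P k') = 0" using val[OF k] by simp
    then show False using e val[OF k(1) k(1)] pos[OF k(1)] by simp
  qed
  have "orthogonal_basis w P_plus P"
    unfolding orthogonal_basis_def
  proof (intro conjI allI)
    show "set_integrable lborel F_frak (?h f h)" for f h by (rule subst(1))
    show "mpoly.independent (P ` P_plus)"
    proof (rule independent_orthogonal[OF ip weighted_integral_zero_left])
      show "weighted_integral w v v \<noteq> 0" if "v \<in> P ` P_plus" for v using that val pos by auto
      show "weighted_integral w v z = 0" if "v \<in> P ` P_plus" "z \<in> P ` P_plus" "v \<noteq> z" for v z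
        using that val by auto
    qed
    show "mpoly.span (P ` P_plus) = UNIV" by (rule span_family_eq_UNIV[OF P])
  qed (use ip inj val in auto)
  with val show ?thesis by blast
qed

end

section \<open>The four families\<close>

lemma (in cosine_family) polynomial_family_cos_sym:
  assumes "\<And>x. x \<in> open_simplex \<Longrightarrow> cos_sym s r x \<noteq> 0"
  shows "polynomial_family s r0 r (cos_sym s r)"
proof unfold_locales
  have "cos_sym s r = (\<Sum>\<sigma> | \<sigma> permutes (UNIV :: 'n set). fscale (s \<sigma>) (cos_prod (permv \<sigma> r)))"
    by (rule ext) (simp add: cos_sym_def sum_fun_apply fscale_apply)
  also have "\<dots> \<in> fs.span (cos_prod ` weight_box r0 (r $ first_index))"
    using r_shift r_nonneg r_antimono[OF first_index_le]
    by (intro fs.span_sum fs.span_scale fs.span_base imageI) (auto simp: weight_box_def)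
  finally show "cos_sym s r \<in> fs.span (cos_prod ` weight_box r0 (r $ first_index))" .
qed (use assms cos_sym_permv_right in auto)

text \<open>For \<open>r0 = 0\<close> these are the Chebyshev polynomials of the first kind; for \<open>r0 = 1/2\<close> the factor
\<open>cos (\<pi> t / 2)\<close> is split off.  Both satisfy the recursion \<open>p\<^sub>m\<^sub>+\<^sub>2 = 2 X p\<^sub>m\<^sub>+\<^sub>1 - p\<^sub>m\<close>.\<close>

lemma chebyshev_polynomial:
  assumes "r0 = 0 \<or> r0 = 1/2"
  shows "\<exists>p :: real poly. degree p = m \<and> (\<forall>t. cos (pi * (real m + r0) * t) = cos (pi * r0 * t) * poly p (cos (pi * t)))"
proof (induction m rule: induct_nat_012)
  case 0
  show ?case by (rule exI[of _ 1]) simp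
next
  case 1
  show ?case
    using assms
  proof
    assume "r0 = 0"
    then show ?thesis by (intro exI[of _ "[:0, 1:]"]) simp
  next
    assume r0: "r0 = 1/2"
    have "cos (pi * (real (Suc 0) + r0) * t) = cos (pi * r0 * t) * poly [:-1, 2:] (cos (pi * t))" for t
    proof -
      have e: "pi * (real (Suc 0) + r0) * t = pi * t + pi * r0 * t" "pi * r0 * t = pi * t - pi * r0 * t"
        by (simp_all add: r0 field_simps)
      have "cos (pi * t + pi * r0 * t) + cos (pi * t - pi * r0 * t) = 2 * cos (pi * t) * cos (pi * r0 * t)"
        by (simp add: cos_add cos_diff)
      then show ?thesis unfolding e(1) e(2)[symmetric] by (simp add: algebra_simps)
    qed
    then show ?thesis by (intro exI[of _ "[:-1, 2:]"]) simp
  qed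
next
  case (ge2 m)
  then obtain p q where p: "degree p = m" "\<forall>t. cos (pi * (real m + r0) * t) = cos (pi * r0 * t) * poly p (cos (pi * t))"
    and q: "degree q = Suc m" "\<forall>t. cos (pi * (real (Suc m) + r0) * t) = cos (pi * r0 * t) * poly q (cos (pi * t))"
    by blast
  have "degree ([:0, 2:] * q) = Suc (Suc m)"
    using q(1) by (subst degree_mult_eq) auto
  then have deg: "degree ([:0, 2:] * q - p) = Suc (Suc m)"
    using degree_add_eq_left[of "- p" "[:0, 2:] * q"] p(1) by simp
  have "cos (pi * (real (Suc (Suc m)) + r0) * t) = cos (pi * r0 * t) * poly ([:0, 2:] * q - p) (cos (pi * t))" for t
  proof -
    have e: "pi * (real (Suc (Suc m)) + r0) * t = pi * (real (Suc m) + r0) * t + pi * t"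
       "pi * (real m + r0) * t = pi * (real (Suc m) + r0) * t - pi * t"
      by (simp_all add: algebra_simps)
    have "cos (pi * (real (Suc (Suc m)) + r0) * t) =
        2 * cos (pi * t) * cos (pi * (real (Suc m) + r0) * t) - cos (pi * (real m + r0) * t)"
      unfolding e cos_add cos_diff by simp
    then show ?thesis unfolding p(2)[rule_format] q(2)[rule_format] by (simp add: right_diff_distrib)
  qed
  with deg show ?case by blast
qed

text \<open>\<open>cos_minus l x\<close> is a determinant.  A vector \<open>v\<close> in the kernel of its matrix combines the polynomials
of \<open>chebyshev_polynomial\<close>, one for each degree below \<open>n\<close>, to a polynomial of degree less than \<open>n\<close>
that vanishes at the \<open>n\<close> distinct points \<open>y\<^sub>i\<close>.  As the degrees are distinct, \<open>v = 0\<close>.\<close>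

lemma cos_minus_nonzero:
  fixes l :: "real^'n::{finite,wellorder}"
  assumes r0: "r0 = 0 \<or> r0 = 1/2" and l: "\<And>j. l $ j = real (card {i. j < i}) + r0"
    and x: "x \<in> open_simplex"
  shows "cos_minus l x \<noteq> 0"
proof -
  define c where "c j = card {i. j < i}" for j :: 'n
  have c_less: "c j < c i" if "i < j" for i j
    unfolding c_def using that by (intro psubset_card_mono) auto
  obtain p :: "nat \<Rightarrow> real poly" where p: "\<And>m. degree (p m) = m"
      "\<And>m t. cos (pi * (real m + r0) * t) = cos (pi * r0 * t) * poly (p m) (cos (pi * t))"
    using chebyshev_polynomial[OF r0] by metis
  define A :: "(real^'n::_)^'n::_" where "A = (\<chi> i j. cos (pi * l $ j * x $ i))"
  have det: "cos_minus l x = det A"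
    by (simp add: cos_minus_def det_def A_def)
  have "v = 0" if v: "A *v v = 0" for v
  proof (rule ccontr)
    assume "v \<noteq> 0"
    then have ex: "\<exists>j. v $ j \<noteq> 0" by (auto simp: vec_eq_iff)
    \<comment> \<open>the first index with \<open>v $ j \<noteq> 0\<close> carries the highest degree\<close>
    define j where "j = (LEAST j. v $ j \<noteq> 0)"
    have vj: "v $ j \<noteq> 0" unfolding j_def by (rule LeastI_ex[OF ex])
    have less: "v $ i = 0" if "i < j" for i using not_less_Least that unfolding j_def by blast
    define q where "q = (\<Sum>i\<in>UNIV. smult (v $ i) (p (c i)))"
    have p0: "p m \<noteq> 0" if "m > 0" for m using p(1)[of m] that by auto
    have lead: "coeff (p m) m \<noteq> 0" for m
    proof (cases "p m = 0")
      case True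
      have "cos (pi * (real m + r0) * 0) = cos (pi * r0 * 0) * poly (p m) (cos (pi * 0))" by (rule p(2))
      with True show ?thesis by simp
    next
      case False
      then show ?thesis using leading_coeff_0_iff[of "p m"] p(1)[of m] by simp
    qed
    have "coeff q (c j) = (\<Sum>i\<in>UNIV. v $ i * coeff (p (c i)) (c j))" by (simp add: q_def coeff_sum)
    also have "\<dots> = (\<Sum>i\<in>{j}. v $ i * coeff (p (c i)) (c j))"
    proof (rule sum.mono_neutral_right)
      show "\<forall>i\<in>UNIV - {j}. v $ i * coeff (p (c i)) (c j) = 0"
      proof
        fix i assume "i \<in> UNIV - {j}"
        then consider "i < j" | "j < i" by (metis DiffE insertI1 linorder_neqE)
        then show "v $ i * coeff (p (c i)) (c j) = 0"
        proof cases
          case 1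
          then show ?thesis by (simp add: less)
        next
          case 2
          then show ?thesis using c_less[OF 2] p(1)[of "c i"] by (simp add: coeff_eq_0)
        qed
      qed
    qed auto
    finally have "coeff q (c j) \<noteq> 0" using vj lead by simp
    then have q0: "q \<noteq> 0" by auto
    have deg: "degree q < CARD('n)"
    proof -
      have "c i \<le> CARD('n) - 1" for i
      proof -
        have "c i < CARD('n)" unfolding c_def by (rule psubset_card_mono) auto
        then show ?thesis by simp
      qed
      then have "degree q \<le> CARD('n) - 1"
        unfolding q_def using p(1) by (intro degree_sum_le) (auto intro: order_trans[OF degree_smult_le])
      then show ?thesis by (metis One_nat_def Suc_pred le_imp_less_Suc zero_less_card_finite)
    qed
    have "(\<lambda>i. cos (pi * x $ i)) ` UNIV \<subseteq> {t. poly q t = 0}"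
    proof clarify
      fix i
      have kpos: "0 < cos (pi * r0 * x $ i)"
      proof -
        have "0 < x $ i" "x $ i < 1" using x by (auto simp: open_simplex_def)
        moreover have "0 \<le> r0" "r0 \<le> 1/2" using r0 by auto
        ultimately have "0 \<le> r0 * x $ i" "r0 * x $ i \<le> 1/2 * x $ i" "1/2 * x $ i < 1/2"
          by (auto intro: mult_right_mono simp del: times_divide_eq_left)
        then have "0 \<le> r0 * x $ i" "r0 * x $ i < 1/2" by linarith+
        then have "0 \<le> pi * (r0 * x $ i)" "pi * (r0 * x $ i) < pi * (1/2)"
          using mult_nonneg_nonneg[OF pi_ge_zero] mult_strict_left_mono[OF _ pi_gt_zero] by blast+
        then have "0 \<le> pi * r0 * x $ i" "pi * r0 * x $ i < pi / 2" by (simp_all add: mult.assoc)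
        then show ?thesis using pi_gt_zero by (intro cos_gt_zero_pi; linarith)
      qed
      have "0 = (A *v v) $ i" by (simp add: v)
      also have "\<dots> = (\<Sum>m\<in>UNIV. cos (pi * r0 * x $ i) * (v $ m * poly (p (c m)) (cos (pi * x $ i))))"
      proof -
        have "A $ i $ m = cos (pi * r0 * x $ i) * poly (p (c m)) (cos (pi * x $ i))" for m
          by (simp only: A_def vec_lambda_beta l c_def[symmetric] p(2))
        then show ?thesis by (simp add: matrix_vector_mult_def mult.assoc mult.commute mult.left_commute)
      qed
      also have "\<dots> = cos (pi * r0 * x $ i) * poly q (cos (pi * x $ i))"
        by (simp add: q_def poly_sum sum_distrib_left)
      finally show "poly q (cos (pi * x $ i)) = 0" using kpos by simp
    qed
    moreover have "inj (\<lambda>i. cos (pi * x $ i))"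
    proof (rule injI)
      fix i m assume eq: "cos (pi * x $ i) = cos (pi * x $ m)"
      show "i = m" by (rule open_simplex_coordinate_inj[OF x open_simplex_cos_inj[OF x x eq]])
    qed
    ultimately have "CARD('n) \<le> card {t. poly q t = 0}"
      using poly_roots_finite[OF q0] by (metis card_image card_mono)
    also have "\<dots> \<le> degree q" by (rule card_poly_roots_bound[OF q0])
    finally show False using deg by simp
  qed
  then have "inj ((*v) A)"
    using linear_injective_0[OF matrix_vector_mul_linear[of A]] by blast
  then have "det (matrix ((*v) A)) \<noteq> 0"
    by (simp only: det_nz_iff_inj[OF matrix_vector_mul_linear[of A]])
  then show ?thesis by (simp add: det matrix_of_matrix_vector_mul)
qed

text \<open>If two entries of \<open>b\<close> agree, exchanging them shows that the alternating sum is its own negative.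
Otherwise the entries are distinct elements of a coset of the integers, hence decrease by at least
\<open>1\<close> at every step, and subtracting the staircase \<open>r\<close> leaves a decreasing vector.\<close>

lemma cosine_family_sign:
  fixes r :: "real^'n::{finite,wellorder}"
  assumes r0: "r0 = 0 \<or> r0 = 1/2" and r: "\<And>j. r $ j = real (card {i. j < i}) + r0"
  shows "cosine_family (\<lambda>\<sigma>. real_of_int (sign \<sigma>)) r0 r"
proof -
  let ?s = "\<lambda>\<sigma> :: 'n \<Rightarrow> 'n. real_of_int (sign \<sigma>)"
  interpret sym_char ?s by (rule sym_char_sign)
  have split: "card {l. i < l} = card {l. i < l \<and> l \<le> j} + card {l. j < l}" if "i \<le> j" for i j :: 'n
  proof -
    have e: "{l. i < l \<and> l \<le> j} \<union> {l. j < l} = {l. i < l}" using that by auto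
    have "card ({l. i < l \<and> l \<le> j} \<union> {l. j < l}) = card {l. i < l \<and> l \<le> j} + card {l. j < l}"
      by (rule card_Un_disjoint) auto
    then show ?thesis unfolding e .
  qed
  show ?thesis
  proof
    have "2 * r0 = 0 \<or> 2 * r0 = 1" using r0 by auto
    then show "2 * r0 \<in> \<int>" by (metis Ints_0 Ints_1)
    show "r $ i - r0 \<in> \<int>" "0 \<le> r $ i" for i using r0 by (auto simp: r)
    show "r $ j \<le> r $ i" if "i \<le> j" for i j using split[OF that] by (simp add: r)
  next
    fix b :: "real^'n::_"
    assume int: "\<And>i. b $ i - r0 \<in> \<int>" and nonneg: "\<And>i. 0 \<le> b $ i"
      and anti: "\<And>i j. i \<le> j \<Longrightarrow> b $ j \<le> b $ i"
    show "cos_sym ?s b = 0 \<or> b - r \<in> P_plus"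
    proof (cases "inj (\<lambda>i. b $ i)")
      case False
      then obtain i j where ij: "i \<noteq> j" "b $ i = b $ j" by (auto simp: inj_def)
      let ?t = "Transposition.transpose i j"
      have t: "?t permutes UNIV" by (rule permutes_swap_id) auto
      have "permv ?t b = b" using ij(2) by (simp add: vec_eq_iff Transposition.transpose_def)
      then have "cos_sym ?s b x = ?s ?t * cos_sym ?s b x" for x
        using cos_sym_permv_left[OF t, of b x] by simp
      then have "cos_sym ?s b x = 0" for x using ij(1) by (simp add: sign_swap_id)
      then show ?thesis by (auto simp: fun_eq_iff)
    next
      case True
      \<comment> \<open>the integer entries; \<open>z\<close> maps an interval of indices injectively into an interval of integers\<close>
      define z where "z i = \<lfloor>b $ i - r0\<rfloor>" for i
      have z: "b $ i = of_int (z i) + r0" for i using int[of i] by (simp add: z_def)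
      have z_nonneg: "0 \<le> z i" for i
      proof -
        have "- 1 < real_of_int (z i)" using nonneg[of i] r0 z[of i] by auto
        then show ?thesis by linarith
      qed
      have z_less: "z j < z i" if "i < j" for i j
      proof -
        have "b $ j \<le> b $ i" "b $ j \<noteq> b $ i" using anti[of i j] True that by (auto dest: injD)
        then show ?thesis by (simp add: z)
      qed
      have inj: "inj_on z S" for S
      proof (rule inj_onI)
        fix i j assume "z i = z j"
        then show "i = j" using z_less[of i j] z_less[of j i] by (cases i j rule: linorder_cases) auto
      qed
      have "int (card {l. i < l \<and> l \<le> j}) \<le> z i - z j" if "i \<le> j" for i j
      proof -
        have zij: "z j \<le> z i" using that z_less[of i j] by (metis order.order_iff_strict)
        have "z ` {l. i < l \<and> l \<le> j} \<subseteq> {z j..<z i}"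
          using z_less by (auto simp: order.order_iff_strict)
        then have "card (z ` {l. i < l \<and> l \<le> j}) \<le> card {z j..<z i}" by (intro card_mono) auto
        then show ?thesis using zij by (simp add: card_image[OF inj])
      qed
      then have gap: "real (card {l. i < l \<and> l \<le> j}) \<le> of_int (z i) - of_int (z j)" if "i \<le> j" for i j
        using that by (metis of_int_diff of_int_le_iff of_int_of_nat_eq)
      have "(b - r) $ j \<le> (b - r) $ i" if "i \<le> j" for i j
        using gap[OF that] split[OF that] by (simp add: z r)
      moreover have "0 \<le> (b - r) $ i" for i
      proof -
        have "z ` {l. i < l} \<subseteq> {0..<z i}" using z_less z_nonneg by auto
        then have "card (z ` {l. i < l}) \<le> card {0..<z i}" by (intro card_mono) auto
        then have "int (card {l. i < l}) \<le> z i" using z_nonneg[of i] by (simp add: card_image[OF inj])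
        then have "real (card {l. i < l}) \<le> of_int (z i)" by linarith
        then show ?thesis by (simp add: z r)
      qed
      moreover have "(b - r) $ i \<in> \<int>" for i by (simp add: z r)
      ultimately show ?thesis by (simp add: P_plus_def)
    qed
  qed
qed

lemma cosine_family_III_plus:
  "cosine_family (\<lambda>_ :: 'n::{finite,wellorder} \<Rightarrow> 'n. 1) (1/2) rho"
proof -
  interpret sym_char "\<lambda>_ :: 'n \<Rightarrow> 'n. 1" by (rule sym_char_one)
  show ?thesis
  proof
    fix b :: "real^'n::_"
    assume int: "\<And>i. b $ i - 1/2 \<in> \<int>" and nonneg: "\<And>i. 0 \<le> b $ i"
      and anti: "\<And>i j. i \<le> j \<Longrightarrow> b $ j \<le> b $ i"
    have "0 \<le> b $ i - 1/2" for i
    proof -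
      obtain z where z: "b $ i - 1/2 = of_int z" using int[of i] by (auto elim: Ints_cases)
      then have "- 1 < real_of_int z" using nonneg[of i] by linarith
      then have "0 \<le> z" by linarith
      with z show ?thesis by simp
    qed
    then show "cos_sym (\<lambda>_. 1) b = 0 \<or> b - rho \<in> P_plus"
      using int anti by (simp add: P_plus_def rho_def)
  qed (auto simp: rho_def)
qed

lemma cos_plus_rho_nonzero:
  assumes "x \<in> open_simplex"
  shows "cos_plus rho x \<noteq> 0"
proof -
  have "cos (pi * (1/2) * x $ i) \<noteq> 0" for i
  proof -
    have "0 < cos (pi * (1/2) * x $ i)"
      using assms by (intro cos_gt_zero_pi) (auto simp: open_simplex_def intro: less_trans[of _ 0])
    then show ?thesis by simp
  qed
  then show ?thesis
    by (simp add: cos_plus_def rho_def prod_zero_iff card_permutations)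
qed

lemma H_const_eq: "H_const k = card {\<pi>. \<pi> permutes UNIV \<and> permv \<pi> k = k}"
  by (simp add: H_const_def permv_def)

lemma H_const_pos: "0 < H_const k"
proof -
  have "finite {\<pi>. \<pi> permutes UNIV \<and> permv \<pi> k = k}"
    by (rule finite_subset[OF _ finite_permutations[of UNIV]]) auto
  moreover have "id \<in> {\<pi>. \<pi> permutes UNIV \<and> permv \<pi> k = k}"
    by (auto simp: permutes_id vec_eq_iff)
  ultimately show ?thesis unfolding H_const_eq by (metis card_gt_0_iff empty_iff)
qed

lemma h_const_pos: "0 < h_const k"
  unfolding h_const_def by (rule prod_pos) auto

lemma stabilizer_strict:
  fixes a :: "real^'n::{finite,wellorder}"
  assumes "\<And>i j. i < j \<Longrightarrow> a $ j < a $ i"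
  shows "{\<pi>. \<pi> permutes UNIV \<and> permv \<pi> a = a} = {id}"
proof (intro equalityI subsetI)
  fix \<pi> assume "\<pi> \<in> {\<pi>. \<pi> permutes UNIV \<and> permv \<pi> a = a}"
  then have "a $ \<pi> i = a $ i" for i by (metis (mono_tags, lifting) mem_Collect_eq permv_nth)
  then have "\<pi> i = i" for i using assms by (metis less_irrefl linorder_neqE)
  then show "\<pi> \<in> {id}" by auto
qed (auto simp: permutes_id vec_eq_iff)

lemma card_greater_less:
  fixes i j :: "'n::{finite,wellorder}"
  shows "i < j \<Longrightarrow> card {l. j < l} < card {l. i < l}"
  by (rule psubset_card_mono) auto

lemma borel_measurable_J_frak: "J_frak \<in> borel_measurable borel"
  unfolding J_frak_def[abs_def] by (intro borel_measurable_continuous_onI continuous_intros)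

lemma borel_measurable_eval_div:
  "(\<lambda>X. eval_mpoly p X / J_frak X) \<in> borel_measurable borel"
  by (intro borel_measurable_divide borel_measurable_J_frak borel_measurable_continuous_onI continuous_intros)

theorem proposition4p3:
  shows "orthogonal_basis w_I_plus (P_plus :: (real^'n::{finite,wellorder}) set) poly_I_plus \<and>
    orthogonal_basis w_I_minus (P_plus :: (real^'n::_) set) poly_I_minus \<and>
    orthogonal_basis w_III_plus (P_plus :: (real^'n::_) set) poly_III_plus \<and>
    orthogonal_basis w_III_minus (P_plus :: (real^'n::_) set) poly_III_minus \<and>
    (\<forall>k\<in>(P_plus :: (real^'n::_) set). \<forall>k'\<in>P_plus.
      weighted_integral w_I_plus (poly_I_plus k) (poly_I_plus k')
        = (if k = k' then h_const k * H_const k else 0) \<and>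
      weighted_integral w_I_minus (poly_I_minus k) (poly_I_minus k')
        = (if k = k' then h_const (k + rho1) else 0) \<and>
      weighted_integral w_III_plus (poly_III_plus k) (poly_III_plus k')
        = (if k = k' then H_const k / 2 ^ CARD('n) else 0) \<and>
      weighted_integral w_III_minus (poly_III_minus k) (poly_III_minus k')
        = (if k = k' then 1 / 2 ^ CARD('n) else 0))"
proof -
  note simplexD = subsetD[OF open_simplex_subset]

  interpret Ip: polynomial_family "\<lambda>_ :: 'n \<Rightarrow> 'n. 1" 0 0 "\<lambda>_. 1" by (rule polynomial_family_I_plus)
  have norm_Ip: "Ip.square_norm k = h_const k * H_const k" for k
    by (simp add: Ip.square_norm_def H_const_eq)
  have Ip: "orthogonal_basis w_I_plus (P_plus :: (real^'n::_) set) poly_I_plus \<and>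
    (\<forall>k\<in>P_plus. \<forall>k'\<in>P_plus. weighted_integral w_I_plus (poly_I_plus k) (poly_I_plus k') =
      (if k = k' then Ip.square_norm k else 0))"
  proof (rule Ip.orthogonal_family)
    show "(w_I_plus :: real^'n::_ \<Rightarrow> real) \<in> borel_measurable borel"
      unfolding w_I_plus_def[abs_def] by (intro borel_measurable_divide borel_measurable_J_frak) auto
    show "w_I_plus (phi x) = 1\<^sup>2 / \<bar>J_det x\<bar>" if "x \<in> open_simplex" for x :: "real^'n::_"
      using simplexD[OF that] by (simp add: w_I_plus_def J_frak_phi)
    show "eval_mpoly (poly_I_plus k) (phi x) * 1 = Ip.numerator k x" if "k \<in> P_plus" "x \<in> open_simplex" for k x :: "real^'n::_"
      using theI'[OF Ip.ex1_mpoly[OF that(1)]] that(2)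
      by (simp add: poly_I_plus_def cos_plus_eq interior_F_dom Ip.numerator_def)
    show "Ip.square_norm k \<noteq> 0" for k :: "real^'n::_"
      using H_const_pos[of k] h_const_pos[of k] by (simp add: norm_Ip)
  qed

  have rho1: "rho1 $ j = real (card {i. j < i}) + 0" for j :: 'n by (simp add: rho1_def)
  interpret cIm: cosine_family "\<lambda>\<sigma> :: 'n \<Rightarrow> 'n. real_of_int (sign \<sigma>)" 0 rho1
    by (rule cosine_family_sign[OF _ rho1]) simp
  interpret Im: polynomial_family "\<lambda>\<sigma> :: 'n \<Rightarrow> 'n. real_of_int (sign \<sigma>)" 0 rho1 "cos_minus rho1"
    unfolding cos_minus_eq
    by (rule cIm.polynomial_family_cos_sym) (metis cos_minus_eq cos_minus_nonzero[OF disjI1[OF refl] rho1])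
  have norm_Im: "Im.square_norm k = h_const (k + rho1)" if "k \<in> P_plus" for k
  proof -
    have "(k + rho1) $ j < (k + rho1) $ i" if "i < j" for i j
      using \<open>k \<in> P_plus\<close> card_greater_less[OF that] that
      by (auto simp: P_plus_def rho1 intro!: add_le_less_mono)
    from stabilizer_strict[of "k + rho1", OF this] show ?thesis by (simp add: Im.square_norm_def)
  qed
  have Im: "orthogonal_basis w_I_minus (P_plus :: (real^'n::_) set) poly_I_minus \<and>
    (\<forall>k\<in>P_plus. \<forall>k'\<in>P_plus. weighted_integral w_I_minus (poly_I_minus k) (poly_I_minus k') =
      (if k = k' then Im.square_norm k else 0))"
  proof (rule Im.orthogonal_family)
    show "(w_I_minus :: real^'n::_ \<Rightarrow> real) \<in> borel_measurable borel"
      unfolding w_I_minus_def[abs_def] by (rule borel_measurable_eval_div)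
    show "w_I_minus (phi x) = (cos_minus rho1 x)\<^sup>2 / \<bar>J_det x\<bar>" if "x \<in> open_simplex" for x :: "real^'n::_"
      using simplexD[OF that] theI'[OF Im.square_ex1] by (simp add: w_I_minus_def J_I_minus_def J_frak_phi)
    show "eval_mpoly (poly_I_minus k) (phi x) * cos_minus rho1 x = Im.numerator k x" if "k \<in> P_plus" "x \<in> open_simplex" for k x :: "real^'n::_"
      using theI'[OF Im.ex1_mpoly[OF that(1)]] that(2) Im.d_nonzero[OF that(2)]
      by (simp add: poly_I_minus_def cos_minus_eq interior_F_dom Im.numerator_def)
    show "Im.square_norm k \<noteq> 0" if "k \<in> P_plus" for k :: "real^'n::_"
      using h_const_pos[of "k + rho1"] by (simp add: norm_Im[OF that])
  qed

  interpret cIIIp: cosine_family "\<lambda>_ :: 'n \<Rightarrow> 'n. 1" "1/2" rho by (rule cosine_family_III_plus)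
  interpret IIIp: polynomial_family "\<lambda>_ :: 'n \<Rightarrow> 'n. 1" "1/2" rho "cos_plus rho"
    unfolding cos_plus_eq
    by (rule cIIIp.polynomial_family_cos_sym) (metis cos_plus_eq cos_plus_rho_nonzero)
  have h_half: "h_const a = 1 / 2 ^ CARD('n)" if "\<And>i. 0 < a $ i" for a :: "real^'n::_"
  proof -
    have "a $ i \<noteq> 0" for i using that[of i] by simp
    then show ?thesis by (simp add: h_const_def power_divide)
  qed
  have norm_IIIp: "IIIp.square_norm k = H_const k / 2 ^ CARD('n)" if "k \<in> P_plus" for k
  proof -
    have "0 < (k + rho) $ i" for i using that by (auto simp: P_plus_def rho_def intro: add_nonneg_pos)
    moreover have "permv \<pi> (k + rho) = k + rho \<longleftrightarrow> permv \<pi> k = k" for \<pi> by (simp add: vec_eq_iff rho_def)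
    ultimately show ?thesis by (simp add: IIIp.square_norm_def h_half H_const_eq)
  qed
  have IIIp: "orthogonal_basis w_III_plus (P_plus :: (real^'n::_) set) poly_III_plus \<and>
    (\<forall>k\<in>P_plus. \<forall>k'\<in>P_plus. weighted_integral w_III_plus (poly_III_plus k) (poly_III_plus k') =
      (if k = k' then IIIp.square_norm k else 0))"
  proof (rule IIIp.orthogonal_family)
    show "(w_III_plus :: real^'n::_ \<Rightarrow> real) \<in> borel_measurable borel"
      unfolding w_III_plus_def[abs_def] by (rule borel_measurable_eval_div)
    show "w_III_plus (phi x) = (cos_plus rho x)\<^sup>2 / \<bar>J_det x\<bar>" if "x \<in> open_simplex" for x :: "real^'n::_"
      using simplexD[OF that] theI'[OF IIIp.square_ex1] by (simp add: w_III_plus_def J_III_plus_def J_frak_phi)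
    show "eval_mpoly (poly_III_plus k) (phi x) * cos_plus rho x = IIIp.numerator k x" if "k \<in> P_plus" "x \<in> open_simplex" for k x :: "real^'n::_"
      using theI'[OF IIIp.ex1_mpoly[OF that(1)]] that(2) IIIp.d_nonzero[OF that(2)]
      by (simp add: poly_III_plus_def cos_plus_eq interior_F_dom IIIp.numerator_def)
    show "IIIp.square_norm k \<noteq> 0" if "k \<in> P_plus" for k :: "real^'n::_"
      using H_const_pos[of k] by (simp add: norm_IIIp[OF that])
  qed

  have rho2: "rho2 $ j = real (card {i. j < i}) + 1/2" for j :: 'n by (simp add: rho2_def)
  interpret cIIIm: cosine_family "\<lambda>\<sigma> :: 'n \<Rightarrow> 'n. real_of_int (sign \<sigma>)" "1/2" rho2
    by (rule cosine_family_sign[OF _ rho2]) simp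
  interpret IIIm: polynomial_family "\<lambda>\<sigma> :: 'n \<Rightarrow> 'n. real_of_int (sign \<sigma>)" "1/2" rho2 "cos_minus rho2"
    unfolding cos_minus_eq
    by (rule cIIIm.polynomial_family_cos_sym) (metis cos_minus_eq cos_minus_nonzero[OF disjI2[OF refl] rho2])
  have norm_IIIm: "IIIm.square_norm k = 1 / 2 ^ CARD('n)" if "k \<in> P_plus" for k
  proof -
    have "(k + rho2) $ j < (k + rho2) $ i" if "i < j" for i j
      using \<open>k \<in> P_plus\<close> card_greater_less[OF that] that
      by (auto simp: P_plus_def rho2 intro!: add_le_less_mono)
    note stabilizer_strict[of "k + rho2", OF this]
    moreover have "0 < (k + rho2) $ i" for i
      using that by (auto simp: P_plus_def rho2 intro: add_nonneg_pos)
    ultimately show ?thesis by (simp add: IIIm.square_norm_def h_half)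
  qed
  have IIIm: "orthogonal_basis w_III_minus (P_plus :: (real^'n::_) set) poly_III_minus \<and>
    (\<forall>k\<in>P_plus. \<forall>k'\<in>P_plus. weighted_integral w_III_minus (poly_III_minus k) (poly_III_minus k') =
      (if k = k' then IIIm.square_norm k else 0))"
  proof (rule IIIm.orthogonal_family)
    show "(w_III_minus :: real^'n::_ \<Rightarrow> real) \<in> borel_measurable borel"
      unfolding w_III_minus_def[abs_def] by (rule borel_measurable_eval_div)
    show "w_III_minus (phi x) = (cos_minus rho2 x)\<^sup>2 / \<bar>J_det x\<bar>" if "x \<in> open_simplex" for x :: "real^'n::_"
      using simplexD[OF that] theI'[OF IIIm.square_ex1] by (simp add: w_III_minus_def J_III_minus_def J_frak_phi)
    show "eval_mpoly (poly_III_minus k) (phi x) * cos_minus rho2 x = IIIm.numerator k x" if "k \<in> P_plus" "x \<in> open_simplex" for k x :: "real^'n::_"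
      using theI'[OF IIIm.ex1_mpoly[OF that(1)]] that(2) IIIm.d_nonzero[OF that(2)]
      by (simp add: poly_III_minus_def cos_minus_eq interior_F_dom IIIm.numerator_def)
    show "IIIm.square_norm k \<noteq> 0" if "k \<in> P_plus" for k :: "real^'n::_"
      by (simp add: norm_IIIm[OF that])
  qed

  show ?thesis
    using Ip Im IIIp IIIm norm_Ip norm_Im norm_IIIp norm_IIIm by simp
qed

end
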